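(* Let $X$ be a locally compact non-compact abelian group and let $(\mathscr G,\mathscr H)$ and $(\mathscr E,\mathscr K)$ be stable Friedrichs $X$-modules over the group $X$. Let $D\in\mathcal B(\mathscr G,\mathscr E)$ and $a\in\mathcal B(\mathscr E,\mathscr E^* )$ be operators of class $C^{\rm u}(Q)$ such that $D^*aD-z:\mathscr G\to\mathscr G^*$ is bijective for some complex number $z$, and let $\Delta_a$ be the operator on $\mathscr H$ associated to $D^*aD$. Then the operator $D(\Delta_a-z)^{-1}\in\mathcal B(\mathscr H,\mathscr E)$ is decay preserving.
   Context: Let $X^*$ be the dual group of $X$. A Banach $X$-module over the group $X$ is a Banach space $\mathscr H$ with a strongly continuous representation $\{V_k\}_{k\in X^*}$ of $X^*$ on $\mathscr H$. Its canonical Banach module structure has multiplier algebra $\mathcal M(\mathscr H)$ equal to the norm closure in $\mathcal B(\mathscr H)$ of the set of operators $\varphi(Q)=\int_{X^*}\widehat\varphi(k)V_k\,dk$, where $\varphi$ runs over the functions on $X$ whose Fourier transform $\widehat\varphi(k)=\int_X\overline{k(x)}\varphi(x)dx$ is integrable with compact support on $X^*$ (Haar measures normalized so that $\varphi(x)=\int_{X^*}k(x)\widehat\varphi(k)dk$). A Hilbert $X$-module is a Hilbert space with such a representation which is unitary (equivalently, a Hilbert space with a non-degenerate $*$-morphism $\varphi\mapsto\varphi(Q)$ of $C_0(X)$ into $\mathcal B(\mathscr H)$, with $V_k=k(Q)$). A stable Friedrichs $X$-module $(\mathscr G,\mathscr H)$ consists of a Hilbert $X$-module $\mathscr H$ and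 a Hilbert space $\mathscr G\subset\mathscr H$, embedded continuously and densely, such that $V_k\mathscr G\subset\mathscr G$ for all $k\in X^*$ and $\sup_{k\in K}\|V_ku\|_{\mathscr G}<\infty$ for each $u\in\mathscr G$ and each compact $K\subset X^*$. Then $V_k|\mathscr G$ makes $\mathscr G$ a Banach $X$-module. $\mathscr G^*$ is the space of antilinear continuous forms, $\mathscr G\subset\mathscr H\subset\mathscr G^*$ with $\mathscr H^*=\mathscr H$, and $\mathscr G^*$ is a Banach $X$-module for the representation $k\mapsto(V_{\bar k})^*$ ($\bar k=k^{-1}$), which extends $V_k$ from $\mathscr H$ and is also denoted $V_k$. An operator $S\in\mathcal B(\mathscr F_1,\mathscr F_2)$ between Banach $X$-modules is of class $C^{\rm u}(Q)$ if $k\mapsto V_k^{-1}SV_k\in\mathcal B(\mathscr F_1,\mathscr F_2)$ is norm continuous. $\Delta_a$ is the restriction of $D^*aD\in\mathcal B(\mathscr G,\mathscr G^* )$ to the domain $\{u\in\mathscr G:D^*aDu\in\mathscr H\}$, as an operator in $\mathscr H$. $S\in\mathcal B(\mathscr F_1,\mathscr F_2)$ is decay preserving if for every $M\in\mathcal M(\mathscr F_1)$ the operator $SM$ belongs to the norm-closed linear span of $\{NT:N\in\mathcal M(\mathscr F_2),T\in\mathcal B(\mathscr F_1,\mathscr F_2)\}$, and for every $N\in\mathcal M(\mathscr F_2)$ the operator $NS$ belongs to the norm-closed linear span of $\{TM:M\in\mathcal M(\mathscr F_1),T\in\mathcal B(\mathscr F_1,\mathscr F_2)\}$. *)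

theory Defs
  imports "HOL-Analysis.Analysis"
begin

class complex_vector = real_vector +
  fixes scaleC :: "complex \<Rightarrow> 'a \<Rightarrow> 'a" (infixr \<open>*\<^sub>C\<close> 75)
  assumes scaleC_add_right: "c *\<^sub>C (x + y) = c *\<^sub>C x + c *\<^sub>C y"
    and scaleC_add_left: "(c + d) *\<^sub>C x = c *\<^sub>C x + d *\<^sub>C x"
    and scaleC_scaleC: "c *\<^sub>C d *\<^sub>C x = (c * d) *\<^sub>C x"
    and scaleC_of_real: "complex_of_real r *\<^sub>C x = r *\<^sub>R x"

class complex_banach = banach + complex_vector +
  assumes norm_scaleC: "norm (c *\<^sub>C x) = cmod c * norm x"

class complex_hilbert = complex_banach +
  fixes cinner :: "'a \<Rightarrow> 'a \<Rightarrow> complex"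
  assumes cinner_commute: "cinner x y = cnj (cinner y x)"
    and cinner_add_right: "cinner x (y + z) = cinner x y + cinner x z"
    and cinner_scaleC_right: "cinner x (c *\<^sub>C y) = c * cinner x y"
    and cinner_self: "cinner x x = complex_of_real ((norm x)\<^sup>2)"

instantiation complex :: complex_hilbert
begin

definition scaleC_complex :: "complex \<Rightarrow> complex \<Rightarrow> complex"
  where "scaleC_complex c x = c * x"

definition cinner_complex :: "complex \<Rightarrow> complex \<Rightarrow> complex"
  where "cinner_complex x y = cnj x * y"

instance
  by standard
    (auto simp: scaleC_complex_def cinner_complex_def algebra_simps scaleR_conv_of_real
      norm_mult complex_norm_square simp del: of_real_power)

end

lemma cinner_scaleC_left: "cinner (c *\<^sub>C x) y = cnj c * cinner x y"
  by (metis cinner_commute cinner_scaleC_right complex_cnj_mult)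

lemma cinner_add_left: "cinner (x + y) z = cinner x z + cinner y z"
  by (metis cinner_commute cinner_add_right complex_cnj_add)

lemma cinner_Cauchy_Schwarz: "cmod (cinner x y) \<le> norm x * norm y"
proof (cases "y = 0")
  case True
  have "cinner x 0 = 0"
    using cinner_add_right[of x 0 0] by simp
  with True show ?thesis by simp
next
  case False
  define d where "d = cinner y x"
  define b where "b = complex_of_real ((norm y)\<^sup>2)"
  define w where "w = b *\<^sub>C x + (- d) *\<^sub>C y"
  have xy: "cinner x y = cnj d"
    unfolding d_def by (rule cinner_commute)
  have "cinner w w = b * (b * cinner x x) - b * (d * cnj d)"
    unfolding w_def
    by (simp add: cinner_add_left cinner_add_right cinner_scaleC_left cinner_scaleC_right xy
        cinner_self[of y] flip: d_def b_def) (simp add: b_def algebra_simps)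
  also have "\<dots> = complex_of_real ((norm y)\<^sup>2 * ((norm y)\<^sup>2 * (norm x)\<^sup>2 - (cmod d)\<^sup>2))"
    by (simp add: b_def cinner_self algebra_simps flip: complex_norm_square)
  finally have "(norm y)\<^sup>2 * ((norm y)\<^sup>2 * (norm x)\<^sup>2 - (cmod d)\<^sup>2) = (norm w)\<^sup>2"
    unfolding cinner_self of_real_eq_iff by simp
  then have "0 \<le> (norm y)\<^sup>2 * ((norm y)\<^sup>2 * (norm x)\<^sup>2 - (cmod d)\<^sup>2)"
    by simp
  then have "(cmod d)\<^sup>2 \<le> (norm x * norm y)\<^sup>2"
    using False by (simp add: zero_le_mult_iff power_mult_distrib mult.commute)
  then show ?thesis
    by (simp add: xy power2_le_iff_abs_le)
qed

text \<open>
  \<open>'a \<Rightarrow>\<^sub>L 'b\<close> consists of the real-linear bounded operators; \<open>bops\<close> singles out the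
  complex-linear ones, i.e. it is the space \<open>B(F\<^sub>1, F\<^sub>2)\<close>. The operator norm is the same.
\<close>

definition bops :: "('a::complex_banach \<Rightarrow>\<^sub>L 'b::complex_banach) set"
  where "bops = {T. \<forall>c x. blinfun_apply T (c *\<^sub>C x) = c *\<^sub>C blinfun_apply T x}"

typedef (overloaded) ('a::complex_banach) antidual =
  "{f :: 'a \<Rightarrow>\<^sub>L complex. \<forall>c x. blinfun_apply f (c *\<^sub>C x) = cnj c * blinfun_apply f x}"
  morphisms form_of Antidual
  by (rule exI[of _ 0]) simp

setup_lifting type_definition_antidual

instantiation antidual :: (complex_banach) real_normed_vector
begin

lift_definition zero_antidual :: "'a antidual" is 0
  by simp

lift_definition plus_antidual :: "'a antidual \<Rightarrow> 'a antidual \<Rightarrow> 'a antidual" is "(+)"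
  by (simp add: blinfun.add_left algebra_simps)

lift_definition minus_antidual :: "'a antidual \<Rightarrow> 'a antidual \<Rightarrow> 'a antidual" is "(-)"
  by (simp add: blinfun.diff_left algebra_simps)

lift_definition uminus_antidual :: "'a antidual \<Rightarrow> 'a antidual" is uminus
  by (simp add: blinfun.minus_left)

lift_definition scaleR_antidual :: "real \<Rightarrow> 'a antidual \<Rightarrow> 'a antidual" is "scaleR"
  by (simp add: blinfun.scaleR_left)

lift_definition norm_antidual :: "'a antidual \<Rightarrow> real" is norm .

definition dist_antidual :: "'a antidual \<Rightarrow> 'a antidual \<Rightarrow> real"
  where "dist_antidual f g = norm (f - g)"

definition sgn_antidual :: "'a antidual \<Rightarrow> 'a antidual"
  where "sgn_antidual f = scaleR (inverse (norm f)) f"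

definition uniformity_antidual :: "('a antidual \<times> 'a antidual) filter"
  where "uniformity_antidual = (INF e\<in>{0<..}. principal {(f, g). dist f g < e})"

definition open_antidual :: "'a antidual set \<Rightarrow> bool"
  where "open_antidual U = (\<forall>x\<in>U. \<forall>\<^sub>F (x', y) in uniformity. x' = x \<longrightarrow> y \<in> U)"

instance
proof
  fix f g h :: "'a antidual" and r s :: real
  show "f + g + h = f + (g + h)" "f + g = g + f" "0 + f = f" "- f + f = 0" "f - g = f + - g"
    by (transfer, simp)+
  show "r *\<^sub>R (f + g) = r *\<^sub>R f + r *\<^sub>R g" "(r + s) *\<^sub>R f = r *\<^sub>R f + s *\<^sub>R f"
    "r *\<^sub>R s *\<^sub>R f = (r * s) *\<^sub>R f" "1 *\<^sub>R f = f"
    by (transfer, simp add: algebra_simps)+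
  show "dist f g = norm (f - g)" "sgn f = scaleR (inverse (norm f)) f"
    by (simp_all add: dist_antidual_def sgn_antidual_def)
  show "(uniformity :: ('a antidual \<times> 'a antidual) filter) =
      (INF e\<in>{0<..}. principal {(f, g). dist f g < e})"
    by (rule uniformity_antidual_def)
  show "open U = (\<forall>x\<in>U. \<forall>\<^sub>F (x', y) in uniformity. x' = x \<longrightarrow> y \<in> U)" for U :: "'a antidual set"
    by (rule open_antidual_def)
  show "(norm f = 0) = (f = 0)" "norm (f + g) \<le> norm f + norm g"
    "norm (r *\<^sub>R f) = \<bar>r\<bar> * norm f"
    by (transfer, simp add: norm_triangle_ineq)+
qed

end

instantiation antidual :: (complex_banach) complex_banach
begin

lift_definition scaleC_antidual :: "complex \<Rightarrow> 'a antidual \<Rightarrow> 'a antidual"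
  is "\<lambda>c f. blinfun_compose (Blinfun ((*) c)) f"
  by (simp add: bounded_linear_Blinfun_apply bounded_linear_mult_right)

instance
proof
  fix f g :: "'a antidual" and r :: real and c d :: complex
  show "c *\<^sub>C (f + g) = c *\<^sub>C f + c *\<^sub>C g" "(c + d) *\<^sub>C f = c *\<^sub>C f + d *\<^sub>C f"
    "c *\<^sub>C d *\<^sub>C f = (c * d) *\<^sub>C f" "complex_of_real r *\<^sub>C f = r *\<^sub>R f"
    by (transfer, rule blinfun_eqI, simp add: bounded_linear_Blinfun_apply
        bounded_linear_mult_right blinfun.add_left blinfun.scaleR_left algebra_simps
        scaleR_conv_of_real)+
  show "norm (c *\<^sub>C f) = cmod c * norm f"
  proof (transfer, goal_cases)
    case (1 c f)
    have le: "norm (blinfun_compose (Blinfun ((*) c)) h) \<le> cmod c * norm h"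
      for c and h :: "'a \<Rightarrow>\<^sub>L complex"
    proof (rule norm_blinfun_bound)
      show "norm (blinfun_apply (blinfun_compose (Blinfun ((*) c)) h) x) \<le> cmod c * norm h * norm x" for x
        using mult_left_mono[OF norm_blinfun[of h x], of "cmod c"]
        by (simp add: bounded_linear_Blinfun_apply bounded_linear_mult_right norm_mult mult.assoc)
    qed simp
    show ?case
    proof (cases "c = 0")
      case True
      then show ?thesis using le[of c f] by simp
    next
      case False
      have "blinfun_compose (Blinfun ((*) (inverse c))) (blinfun_compose (Blinfun ((*) c)) f) = f"
        using False
        by (intro blinfun_eqI) (simp add: bounded_linear_Blinfun_apply bounded_linear_mult_right)
      then have "norm f \<le> cmod (inverse c) * norm (blinfun_compose (Blinfun ((*) c)) f)"
        using le[of "inverse c" "blinfun_compose (Blinfun ((*) c)) f"] by simp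
      then have "cmod c * norm f \<le> norm (blinfun_compose (Blinfun ((*) c)) f)"
        using False by (simp add: norm_divide field_simps)
      with le[of c f] show ?thesis by simp
    qed
  qed
next
  fix X :: "nat \<Rightarrow> 'a antidual"
  assume X: "Cauchy X"
  have dist: "dist (form_of f) (form_of g) = dist f g" for f g :: "'a antidual"
    by (simp add: dist_norm norm_antidual.rep_eq minus_antidual.rep_eq)
  have anti: "blinfun_apply (form_of f) (c *\<^sub>C x) = cnj c * blinfun_apply (form_of f) x"
    for f :: "'a antidual" and c x
    using form_of[of f] by simp
  have "Cauchy (\<lambda>n. form_of (X n))"
    using X by (simp add: Cauchy_def dist)
  then obtain L where L: "(\<lambda>n. form_of (X n)) \<longlonglongrightarrow> L"
    using Cauchy_convergent convergent_def by blast
  have "blinfun_apply L (c *\<^sub>C x) = cnj c * blinfun_apply L x" for c x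
  proof (rule LIMSEQ_unique)
    show "(\<lambda>n. blinfun_apply (form_of (X n)) (c *\<^sub>C x)) \<longlonglongrightarrow> blinfun_apply L (c *\<^sub>C x)"
      by (intro tendsto_intros L)
    have "(\<lambda>n. cnj c * blinfun_apply (form_of (X n)) x) \<longlonglongrightarrow> cnj c * blinfun_apply L x"
      by (intro tendsto_intros L)
    then show "(\<lambda>n. blinfun_apply (form_of (X n)) (c *\<^sub>C x)) \<longlonglongrightarrow> cnj c * blinfun_apply L x"
      by (simp add: anti)
  qed
  then have "form_of (Antidual L) = L"
    by (simp add: Antidual_inverse)
  then have "X \<longlonglongrightarrow> Antidual L"
    using L by (simp add: LIMSEQ_def dist[symmetric])
  then show "convergent X"
    by (rule convergentI)
qed

end

text \<open>
  The adjoint \<open>S\<^sup>* : F\<^sub>2\<^sup>* \<rightarrow> F\<^sub>1\<^sup>*\<close>, \<open>S\<^sup>* f = f \<circ> S\<close>, of \<open>S \<in> B(F\<^sub>1, F\<^sub>2)\<close>. It is meaningful only for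
  complex-linear \<open>S\<close>, since otherwise \<open>f \<circ> S\<close> need not be antilinear.
\<close>

definition adj :: "('a::complex_banach \<Rightarrow>\<^sub>L 'b::complex_banach) \<Rightarrow> ('b antidual \<Rightarrow>\<^sub>L 'a antidual)"
  where "adj S = Blinfun (\<lambda>f. Antidual (form_of f o\<^sub>L S))"

lemma form_of_adj:
  assumes "S \<in> bops"
  shows "form_of (blinfun_apply (adj S) f) = form_of f o\<^sub>L S"
proof -
  have Anti: "form_of (Antidual (form_of f o\<^sub>L S)) = form_of f o\<^sub>L S" for f
    using assms form_of[of f] by (intro Antidual_inverse) (auto simp: bops_def)
  have "bounded_linear (\<lambda>f. Antidual (form_of f o\<^sub>L S))"
  proof (rule bounded_linear_intro[where K = "norm S"])
    fix f g :: "'b antidual" and r :: real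
    show "Antidual (form_of (f + g) o\<^sub>L S) = Antidual (form_of f o\<^sub>L S) + Antidual (form_of g o\<^sub>L S)"
      unfolding form_of_inject[symmetric] unfolding Anti unfolding plus_antidual.rep_eq Anti
      by (rule blinfun_eqI) (simp add: blinfun.add_left)
    show "Antidual (form_of (r *\<^sub>R f) o\<^sub>L S) = r *\<^sub>R Antidual (form_of f o\<^sub>L S)"
      unfolding form_of_inject[symmetric] unfolding Anti unfolding scaleR_antidual.rep_eq Anti
      by (rule blinfun_eqI) (simp add: blinfun.scaleR_left)
    show "norm (Antidual (form_of f o\<^sub>L S)) \<le> norm f * norm S"
      unfolding norm_antidual.rep_eq Anti by (rule norm_blinfun_compose)
  qed
  then show ?thesis
    by (simp add: adj_def bounded_linear_Blinfun_apply Anti)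
qed

text \<open>
  The group \<open>X\<close> is written additively. The continuous characters with values in the unit circle
  form the dual group; it is written additively too, so that \<open>k + l\<close> is the pointwise product
  and \<open>- k\<close> is the complex conjugate of \<open>k\<close>. Its topology is the compact-open one.
\<close>

typedef (overloaded) ('x::topological_ab_group_add) dual =
  "{k :: 'x \<Rightarrow> complex. continuous_on UNIV k \<and> (\<forall>x. cmod (k x) = 1) \<and>
     (\<forall>x y. k (x + y) = k x * k y)}"
  morphisms char_of Char
  by (rule exI[of _ "\<lambda>_. 1"]) simp

setup_lifting type_definition_dual

instantiation dual :: (topological_ab_group_add) ab_group_add
begin

lift_definition zero_dual :: "'a dual" is "\<lambda>_. 1"
  by simp

lift_definition plus_dual :: "'a dual \<Rightarrow> 'a dual \<Rightarrow> 'a dual" is "\<lambda>k l x. k x * l x"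
  by (auto simp: norm_mult intro!: continuous_intros)

lift_definition uminus_dual :: "'a dual \<Rightarrow> 'a dual" is "\<lambda>k x. cnj (k x)"
  by (auto intro!: continuous_intros)

lift_definition minus_dual :: "'a dual \<Rightarrow> 'a dual \<Rightarrow> 'a dual" is "\<lambda>k l x. k x * cnj (l x)"
  by (auto simp: norm_mult intro!: continuous_intros)

instance
  by standard
    (transfer; auto simp: fun_eq_iff mult.assoc mult.commute complex_norm_square[symmetric]; fail)+

end

instantiation dual :: (topological_ab_group_add) topological_space
begin

definition open_dual :: "'a dual set \<Rightarrow> bool"
  where "open_dual = generate_topology
    {{k. char_of k ` C \<subseteq> U} | C U. compact C \<and> open U}"

instance
  by standard (auto simp: open_dual_def intro: generate_topology.intros)

end

definition haar_measure :: "'x::{topological_space, ab_group_add} measure \<Rightarrow> bool"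
  where "haar_measure m \<longleftrightarrow> sets m = sets borel \<and> emeasure m UNIV \<noteq> 0 \<and>
    (\<forall>C. compact C \<longrightarrow> emeasure m C < \<infinity>) \<and>
    (\<forall>x. \<forall>A\<in>sets borel. emeasure m ((+) x ` A) = emeasure m A) \<and>
    (\<forall>A\<in>sets borel. emeasure m A = (INF U\<in>{U. open U \<and> A \<subseteq> U}. emeasure m U)) \<and>
    (\<forall>U. open U \<longrightarrow> emeasure m U = (SUP C\<in>{C. compact C \<and> C \<subseteq> U}. emeasure m C))"

definition fourier :: "'x::topological_ab_group_add measure \<Rightarrow> ('x \<Rightarrow> complex) \<Rightarrow> 'x dual \<Rightarrow> complex"
  where "fourier m \<phi> k = (\<integral>x. cnj (char_of k x) * \<phi> x \<partial>m)"

definition dual_haar_measures ::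
    "'x::topological_ab_group_add measure \<Rightarrow> 'x dual measure \<Rightarrow> bool"
  where "dual_haar_measures m n \<longleftrightarrow> haar_measure m \<and> haar_measure n \<and>
    (\<forall>\<phi>. integrable m \<phi> \<longrightarrow> integrable n (fourier m \<phi>) \<longrightarrow>
      (AE x in m. \<phi> x = (\<integral>k. char_of k x * fourier m \<phi> k \<partial>n)))"

definition banach_module ::
    "('x::topological_ab_group_add dual \<Rightarrow> ('f::complex_banach \<Rightarrow>\<^sub>L 'f)) \<Rightarrow> bool"
  where "banach_module V \<longleftrightarrow> (\<forall>k. V k \<in> bops) \<and> V 0 = id_blinfun \<and>
    (\<forall>k l. V (k + l) = V k o\<^sub>L V l) \<and>
    (\<forall>u. continuous_on UNIV (\<lambda>k. blinfun_apply (V k) u))"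

definition hilbert_module ::
    "('x::topological_ab_group_add dual \<Rightarrow> ('f::complex_hilbert \<Rightarrow>\<^sub>L 'f)) \<Rightarrow> bool"
  where "hilbert_module V \<longleftrightarrow> banach_module V \<and>
    (\<forall>k u v. cinner (blinfun_apply (V k) u) (blinfun_apply (V k) v) = cinner u v)"

text \<open>
  \<open>A = \<integral> f(k) V\<^sub>k dk\<close>. The Bochner integral of the library is restricted to second countable
  spaces, so the vector-valued integral is expressed through the continuous linear functionals,
  which determine \<open>A\<close>.
\<close>

definition has_operator_integral ::
    "'x::topological_ab_group_add dual measure \<Rightarrow> ('x dual \<Rightarrow> complex) \<Rightarrow>
     ('x dual \<Rightarrow> ('f::complex_banach \<Rightarrow>\<^sub>L 'f)) \<Rightarrow> ('f \<Rightarrow>\<^sub>L 'f) \<Rightarrow> bool"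
  where "has_operator_integral n f V A \<longleftrightarrow> A \<in> bops \<and>
    (\<forall>u. \<forall>l \<in> (bops :: ('f \<Rightarrow>\<^sub>L complex) set).
      has_bochner_integral n (\<lambda>k. f k * blinfun_apply l (blinfun_apply (V k) u))
        (blinfun_apply l (blinfun_apply A u)))"

definition multiplier_algebra ::
    "'x::topological_ab_group_add measure \<Rightarrow> 'x dual measure \<Rightarrow>
     ('x dual \<Rightarrow> ('f::complex_banach \<Rightarrow>\<^sub>L 'f)) \<Rightarrow> ('f \<Rightarrow>\<^sub>L 'f) set"
  where "multiplier_algebra m n V = closure {A. \<exists>\<phi>. integrable m \<phi> \<and>
    integrable n (fourier m \<phi>) \<and> compact (closure {k. fourier m \<phi> k \<noteq> 0}) \<and>
    has_operator_integral n (fourier m \<phi>) V A}"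

definition class_Cu ::
    "('x::topological_ab_group_add dual \<Rightarrow> ('a::complex_banach \<Rightarrow>\<^sub>L 'a)) \<Rightarrow>
     ('x dual \<Rightarrow> ('b::complex_banach \<Rightarrow>\<^sub>L 'b)) \<Rightarrow> ('a \<Rightarrow>\<^sub>L 'b) \<Rightarrow> bool"
  where "class_Cu V1 V2 S \<longleftrightarrow> S \<in> bops \<and>
    continuous_on UNIV (\<lambda>k. V2 (- k) o\<^sub>L S o\<^sub>L V1 k)"

text \<open>
  The real span below is the complex span, because the spanning sets are closed under
  multiplication by complex scalars (absorbed into \<open>T\<close>).
\<close>

definition decay_preserving ::
    "'x::topological_ab_group_add measure \<Rightarrow> 'x dual measure \<Rightarrow>
     ('x dual \<Rightarrow> ('a::complex_banach \<Rightarrow>\<^sub>L 'a)) \<Rightarrow>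
     ('x dual \<Rightarrow> ('b::complex_banach \<Rightarrow>\<^sub>L 'b)) \<Rightarrow> ('a \<Rightarrow>\<^sub>L 'b) \<Rightarrow> bool"
  where "decay_preserving m n V1 V2 S \<longleftrightarrow> S \<in> bops \<and>
    (\<forall>M \<in> multiplier_algebra m n V1.
      S o\<^sub>L M \<in> closure (span {N o\<^sub>L T | N T. N \<in> multiplier_algebra m n V2 \<and> T \<in> bops})) \<and>
    (\<forall>N \<in> multiplier_algebra m n V2.
      N o\<^sub>L S \<in> closure (span {T o\<^sub>L M | T M. M \<in> multiplier_algebra m n V1 \<and> T \<in> bops}))"

text \<open>
  The inclusion of \<open>G\<close> in \<open>H\<close> is a continuous injective linear map \<open>j\<close> with dense range;
  \<open>restr j V k\<close> is the operator \<open>V\<^sub>k\<close> restricted to \<open>G\<close>. In a stable Friedrichs module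
  this restriction is everywhere defined, and bounded by the closed graph theorem.
\<close>

definition restr ::
    "('g::complex_hilbert \<Rightarrow>\<^sub>L 'h::complex_hilbert) \<Rightarrow>
     ('x::topological_ab_group_add dual \<Rightarrow> ('h \<Rightarrow>\<^sub>L 'h)) \<Rightarrow> 'x dual \<Rightarrow> ('g \<Rightarrow>\<^sub>L 'g)"
  where "restr j V k =
    Blinfun (\<lambda>u. inv (blinfun_apply j) (blinfun_apply (V k) (blinfun_apply j u)))"

definition stable_friedrichs_module ::
    "('g::complex_hilbert \<Rightarrow>\<^sub>L 'h::complex_hilbert) \<Rightarrow>
     ('x::topological_ab_group_add dual \<Rightarrow> ('h \<Rightarrow>\<^sub>L 'h)) \<Rightarrow> bool"
  where "stable_friedrichs_module j V \<longleftrightarrow> hilbert_module V \<and>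
    j \<in> bops \<and> inj (blinfun_apply j) \<and> closure (range (blinfun_apply j)) = UNIV \<and>
    (\<forall>k. blinfun_apply (V k) ` range (blinfun_apply j) \<subseteq> range (blinfun_apply j)) \<and>
    (\<forall>u C. compact C \<longrightarrow> bdd_above
      ((\<lambda>k. norm (inv (blinfun_apply j) (blinfun_apply (V k) (blinfun_apply j u)))) ` C))"

definition antidual_rep ::
    "('x::topological_ab_group_add dual \<Rightarrow> ('g::complex_banach \<Rightarrow>\<^sub>L 'g)) \<Rightarrow>
     'x dual \<Rightarrow> ('g antidual \<Rightarrow>\<^sub>L 'g antidual)"
  where "antidual_rep W k = adj (W (- k))"

text \<open>The embedding of \<open>H = H\<^sup>*\<close> into \<open>G\<^sup>*\<close>: the vector \<open>h\<close> is the form \<open>u \<mapsto> \<langle>u, h\<rangle>\<close> on \<open>G\<close>.\<close>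

definition embed :: "('g::complex_hilbert \<Rightarrow>\<^sub>L 'h::complex_hilbert) \<Rightarrow> 'h \<Rightarrow> 'g antidual"
  where "embed j h = Antidual (Blinfun (\<lambda>u. cinner (blinfun_apply j u) h))"

lemma form_of_embed:
  assumes "j \<in> bops"
  shows "blinfun_apply (form_of (embed j h)) u = cinner (blinfun_apply j u) h"
proof -
  have "bounded_linear (\<lambda>u. cinner (blinfun_apply j u) h)"
  proof (rule bounded_linear_intro[where K = "norm j * norm h"])
    fix u v :: 'a and r :: real
    show "cinner (blinfun_apply j (u + v)) h = cinner (blinfun_apply j u) h + cinner (blinfun_apply j v) h"
      by (simp add: blinfun.add_right cinner_add_left)
    show "cinner (blinfun_apply j (r *\<^sub>R u)) h = r *\<^sub>R cinner (blinfun_apply j u) h"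
      unfolding blinfun.scaleR_right unfolding scaleC_of_real[symmetric] cinner_scaleC_left
      by (simp add: scaleC_complex_def)
    have "cmod (cinner (blinfun_apply j u) h) \<le> norm (blinfun_apply j u) * norm h"
      by (rule cinner_Cauchy_Schwarz)
    also have "\<dots> \<le> (norm j * norm u) * norm h"
      by (intro mult_right_mono norm_blinfun norm_ge_zero)
    finally show "cmod (cinner (blinfun_apply j u) h) \<le> norm u * (norm j * norm h)"
      by (simp add: mult_ac)
  qed
  then show ?thesis
    using assms
    by (simp add: embed_def Antidual_inverse bounded_linear_Blinfun_apply bops_def cinner_scaleC_left)
qed

text \<open>
  The operator in \<open>H\<close> associated with \<open>L \<in> B(G, G\<^sup>*)\<close>: the restriction of \<open>L\<close> to those
  \<open>u \<in> G\<close> for which \<open>L u \<in> H\<close>. Its domain is a subspace of \<open>H\<close>.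
\<close>

definition assoc_dom ::
    "('g::complex_hilbert \<Rightarrow>\<^sub>L 'h::complex_hilbert) \<Rightarrow> ('g \<Rightarrow>\<^sub>L 'g antidual) \<Rightarrow> 'h set"
  where "assoc_dom j L = blinfun_apply j ` {u. blinfun_apply L u \<in> range (embed j)}"

definition assoc_op ::
    "('g::complex_hilbert \<Rightarrow>\<^sub>L 'h::complex_hilbert) \<Rightarrow> ('g \<Rightarrow>\<^sub>L 'g antidual) \<Rightarrow> 'h \<Rightarrow> 'h"
  where "assoc_op j L x = inv (embed j) (blinfun_apply L (inv (blinfun_apply j) x))"

definition resolvent ::
    "('g::complex_hilbert \<Rightarrow>\<^sub>L 'h::complex_hilbert) \<Rightarrow> ('g \<Rightarrow>\<^sub>L 'g antidual) \<Rightarrow> complex \<Rightarrow> 'h \<Rightarrow> 'h"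
  where "resolvent j L z = inv_into (assoc_dom j L) (\<lambda>x. assoc_op j L x - z *\<^sub>C x)"

end

theory Submission
  imports Defs
begin

text \<open>
  Let \<open>S \<in> B(F\<^sub>1, F\<^sub>2)\<close> with \<open>V\<^sub>k\<^sup>-\<^sup>1 S V\<^sub>k \<rightarrow> S\<close> in norm as \<open>k \<rightarrow> 0\<close>, and let \<open>M = \<phi>(Q)\<close> where the transform
  of \<open>\<phi>\<close> has compact support. Then \<open>V\<^sub>k S M = (V\<^sub>k S V\<^sub>k\<^sup>-\<^sup>1) V\<^sub>k M \<rightarrow> S M\<close> in norm, so \<open>e(Q) S M\<close> is close
  to \<open>S M\<close> as soon as the transform of \<open>e\<close> has integral \<open>1\<close>, bounded \<open>L\<^sup>1\<close> norm, support in a fixed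
  compact set, and is concentrated near \<open>0\<close>; the other side is symmetric. Such functions \<open>e\<close> are
  linear combinations of translates of one nonzero \<open>\<phi>\<close> times a character. If there is no nonzero \<open>\<phi>\<close>, the
  multiplier algebras are zero; otherwise the set where the transform of \<open>\<phi>\<close> does not vanish makes
  the dual group locally compact. For \<open>S = D (\<Delta>\<^sub>a - z)\<^sup>-\<^sup>1\<close> the limit property follows from that of
  \<open>D\<close> and \<open>a\<close>, because conjugating \<open>(D\<^sup>* a D - z)\<^sup>-\<^sup>1\<close> gives the inverse of the conjugated operator.
\<close>

text \<open>The limits that matter are norm limits, while the integrals defining the multipliers are
  accessible only through matrix elements. Operators are therefore built from bounded sesquilinear
  forms, and norm estimates are bounds for \<open>cinner v (A u)\<close> uniform in \<open>u\<close>
  and \<open>v\<close>; this is why the Riesz representation comes early.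

  The second obstacle is that a Friedrichs module is given by pointwise data: \<open>V k\<close>
  maps the smaller space into itself, and orbits are bounded on compact sets vector by vector.
  Bounded operators on that space, locally uniform bounds for their norms, and the bounded inverse
  of \<open>D\<^sup>* a D - z\<close> all come from completeness, through one principle on
  seminorms.

  The third is that \<open>V k\<close> need not be norm continuous. The product of
  \<open>V k\<close> with a multiplier is, because translating its symbol by a small
  \<open>k\<close> changes it little in the uniform norm and keeps its support in one compact set.
  Hence the roles of a compact neighbourhood of \<open>0\<close> in the dual group and of the
  uniform continuity of Fourier transforms.\<close>

section \<open>Consequences of the Baire category theorem\<close>

text \<open>Zabreiko's lemma, the common source of the closed graph theorem and of uniform
  boundedness. By Baire some sublevel set is dense in a ball; symmetry and convexity move the ball
  to the origin. Each vector is then approximated up to half its norm by one with controlled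
  \<open>p\<close>, and iterating gives a series to which countable subadditivity applies.\<close>

lemma zabreiko:
  fixes p :: "'a::banach \<Rightarrow> real"
  assumes add: "\<And>x y. p (x + y) \<le> p x + p y"
    and scale: "\<And>r x. p (r *\<^sub>R x) = \<bar>r\<bar> * p x"
    and sub: "\<And>u x. u sums x \<Longrightarrow> summable (\<lambda>n::nat. p (u n)) \<Longrightarrow> p x \<le> (\<Sum>n. p (u n))"
  shows "\<exists>C. \<forall>x. p x \<le> C * norm x"
proof -
  define A where "A N = closure {x. p x \<le> real N}" for N :: nat
  have nonneg: "0 \<le> p x" for x
    using add[of x "-1 *\<^sub>R x"] scale[of 0 x] scale[of "-1" x] by simp
  have diff: "p (x - y) \<le> p x + p y" for x y
    using add[of x "-1 *\<^sub>R y"] scale[of "-1" y] by simp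
  have "\<exists>N. interior (A N) \<noteq> {}"
  proof (rule ccontr)
    assume "\<not> ?thesis"
    then have "(Met_TC.mtopology :: 'a topology) interior_of \<Union>(range A) = {}"
      by (intro Met_TC.metric_Baire_category_alt)
        (auto simp: A_def mcomplete_iff_complete complete_UNIV mtopology_is_euclidean)
    moreover have "\<Union>(range A) = UNIV"
    proof -
      have "x \<in> A (nat \<lceil>p x\<rceil>)" for x
        unfolding A_def by (rule subsetD[OF closure_subset]) (simp add: real_nat_ceiling_ge)
      then show ?thesis by blast
    qed
    ultimately show False
      by (simp add: mtopology_is_euclidean)
  qed
  then obtain N x0 r where r: "0 < r" and ball: "ball x0 r \<subseteq> A N"
    by (metis ex_in_conv mem_interior)
  have approx0: "\<exists>u. p u \<le> real N \<and> norm (y - u) < d" if y: "norm y < r" and d: "0 < d" for y d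
  proof -
    \<comment> \<open>The centre \<open>x0\<close> cancels in the half difference of approximations
      to \<open>x0 + y\<close> and \<open>x0 - y\<close>.\<close>
    have "x0 + y \<in> A N" "x0 - y \<in> A N"
      using ball y by (auto simp: subset_iff dist_norm)
    then obtain a b where ab: "p a \<le> N" "norm (a - (x0 + y)) < d" "p b \<le> N" "norm (b - (x0 - y)) < d"
      unfolding A_def closure_approachable dist_norm using d by blast
    have "y - (1/2) *\<^sub>R (a - b) = (1/2) *\<^sub>R ((b - (x0 - y)) - (a - (x0 + y)))"
      by (simp add: algebra_simps flip: scaleR_left.add)
    then have "norm (y - (1/2) *\<^sub>R (a - b)) \<le> (1/2) * (norm (b - (x0 - y)) + norm (a - (x0 + y)))"
      using norm_triangle_ineq4[of "b - (x0 - y)" "a - (x0 + y)"] by simp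
    with ab have "norm (y - (1/2) *\<^sub>R (a - b)) < d" by simp
    moreover have "p ((1/2) *\<^sub>R (a - b)) \<le> N"
      using scale[of "1/2" "a - b"] diff[of a b] ab by simp
    ultimately show ?thesis by blast
  qed
  define K where "K = 2 * real N / r"
  have approx: "\<exists>u. p u \<le> K * norm y \<and> norm (y - u) \<le> norm y / 2" for y
  proof (cases "y = 0")
    case True
    then show ?thesis using scale[of 0 0] by (intro exI[of _ 0]) simp
  next
    case False
    \<comment> \<open>This factor gives \<open>y /\<^sub>R s\<close> the norm \<open>r / 2\<close>,
      inside the ball; the tolerance chosen below scales back to \<open>norm y / 2\<close>.\<close>
    define s where "s = 2 * norm y / r"
    have s: "0 < s" using False r by (simp add: s_def)
    have "norm (y /\<^sub>R s) < r" using False r by (simp add: s_def field_simps)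
    moreover have "0 < norm y / (2 * s)" using False s by simp
    ultimately obtain u where u: "p u \<le> N" "norm (y /\<^sub>R s - u) < norm y / (2 * s)"
      using approx0 by blast
    have "y - s *\<^sub>R u = s *\<^sub>R (y /\<^sub>R s - u)"
      using s by (simp add: algebra_simps)
    then have "norm (y - s *\<^sub>R u) = s * norm (y /\<^sub>R s - u)"
      using s by simp
    also have "\<dots> \<le> s * (norm y / (2 * s))"
      using u(2) s by (intro mult_left_mono) auto
    also have "\<dots> = norm y / 2"
      using s by simp
    finally have "norm (y - s *\<^sub>R u) \<le> norm y / 2" .
    moreover have "p (s *\<^sub>R u) \<le> K * norm y"
    proof -
      have "p (s *\<^sub>R u) = s * p u"
        using s by (simp add: scale)
      also have "\<dots> \<le> s * N"
        using u(1) s by (intro mult_left_mono) auto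
      finally show ?thesis by (simp add: s_def K_def mult_ac)
    qed
    ultimately show ?thesis by blast
  qed
  then obtain g where g: "\<And>y. p (g y) \<le> K * norm y" "\<And>y. norm (y - g y) \<le> norm y / 2"
    by metis
  have K: "0 \<le> K" using r by (simp add: K_def)
  have "p x \<le> (2 * K) * norm x" for x
  proof -
    \<comment> \<open>\<open>y n\<close> is the error left after \<open>n\<close> corrections. Its
      norm halves at each step, so the bounds for the corrections sum to
      \<open>2 * K * norm x\<close>.\<close>
    define y where "y n = ((\<lambda>y. y - g y) ^^ n) x" for n
    have ySuc: "y (Suc n) = y n - g (y n)" and y0: "y 0 = x" for n
      by (simp_all add: y_def)
    have ny: "norm (y n) \<le> norm x * (1/2) ^ n" for n
    proof (induction n)
      case (Suc n)
      then show ?case using g(2)[of "y n"] by (simp add: ySuc)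
    qed (simp add: y0)
    have geo: "(\<lambda>n. (1/2::real) ^ n) sums 2"
      using geometric_sums[of "1/2::real"] by simp
    have "(\<lambda>n. norm x * (1/2) ^ n) \<longlonglongrightarrow> norm x * 0"
      by (intro tendsto_intros LIMSEQ_power_zero) simp
    then have "y \<longlonglongrightarrow> 0"
      using ny by (intro Lim_null_comparison[where f = y]) auto
    then have "(\<lambda>n. x - y n) \<longlonglongrightarrow> x - 0"
      by (intro tendsto_intros)
    moreover have "(\<Sum>k<n. g (y k)) = x - y n" for n
      by (induction n) (simp_all add: y0 ySuc algebra_simps)
    ultimately have s1: "(\<lambda>n. g (y n)) sums x"
      by (simp add: sums_def)
    have b: "p (g (y n)) \<le> K * norm x * (1/2) ^ n" for n
      using order_trans[OF g(1) mult_left_mono[OF ny K]] by (simp add: mult_ac)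
    have geo': "(\<lambda>n. K * norm x * (1/2) ^ n) sums (K * norm x * 2)"
      by (intro sums_mult geo)
    have s2: "summable (\<lambda>n. p (g (y n)))"
      using b nonneg by (intro summable_comparison_test'[OF sums_summable[OF geo']]) auto
    have "p x \<le> (\<Sum>n. p (g (y n)))"
      by (rule sub[OF s1 s2])
    also have "\<dots> \<le> K * norm x * 2"
      using b suminf_le[OF _ s2 sums_summable[OF geo']] sums_unique[OF geo'] by simp
    finally show ?thesis by simp
  qed
  then show ?thesis by blast
qed

text \<open>Zabreiko's lemma is applied to \<open>\<lambda>x. norm (T x)\<close>. An absolutely
  summable series of images converges in the complete target space, and closedness of the graph
  identifies its sum with the image of the sum.\<close>

theorem closed_graph:
  fixes T :: "'a::banach \<Rightarrow> 'b::banach"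
  assumes lin: "linear T"
    and closed: "\<And>u x y. u \<longlonglongrightarrow> x \<Longrightarrow> (\<lambda>n::nat. T (u n)) \<longlonglongrightarrow> y \<Longrightarrow> T x = y"
  shows "bounded_linear T"
proof -
  have "\<exists>C. \<forall>x. norm (T x) \<le> C * norm x"
  proof (rule zabreiko)
    fix u x assume u: "u sums x" "summable (\<lambda>n::nat. norm (T (u n)))"
    then have "(\<lambda>n. T (u n)) sums (\<Sum>n. T (u n))"
      by (simp add: summable_norm_cancel summable_sums)
    then have "T x = (\<Sum>n. T (u n))"
      using u(1) by (intro closed[of "\<lambda>n. \<Sum>k<n. u k"]) (auto simp: sums_def linear_sum[OF lin])
    then show "norm (T x) \<le> (\<Sum>n. norm (T (u n)))"
      using summable_norm[OF u(2)] by simp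
  next
    show "norm (T (x + y)) \<le> norm (T x) + norm (T y)" for x y
      by (metis lin linear_add norm_triangle_ineq)
    show "norm (T (r *\<^sub>R x)) = \<bar>r\<bar> * norm (T x)" for r x
      by (metis lin linear_scale norm_scaleR)
  qed
  then obtain C where "\<And>x. norm (T x) \<le> C * norm x" by blast
  then show ?thesis
    using lin by (intro bounded_linear.intro bounded_linear_axioms.intro exI[of _ C]) (simp_all add: mult.commute)
qed

text \<open>The graph of \<open>inv T\<close> is that of \<open>T\<close> with the coordinates
  exchanged, so continuity of \<open>T\<close> makes it closed.\<close>

theorem bounded_inverse:
  fixes T :: "'a::banach \<Rightarrow> 'b::banach"
  assumes "bounded_linear T" "bij T"
  shows "bounded_linear (inv T)"
proof (rule closed_graph)
  have lin: "linear T" using assms(1) by (rule bounded_linear.linear)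
  then show "linear (inv T)"
    by (intro linearI; intro inv_f_eq bij_is_inj assms(2))
      (simp_all add: linear_add linear_scale bij_is_surj[OF assms(2)] surj_f_inv_f)
  fix u x y assume "u \<longlonglongrightarrow> x" "(\<lambda>n::nat. inv T (u n)) \<longlonglongrightarrow> y"
  moreover have "T (inv T (u n)) = u n" for n
    using assms(2) by (simp add: bij_is_surj surj_f_inv_f)
  ultimately have "T y = x"
    using bounded_linear.tendsto[OF assms(1), of "\<lambda>n. inv T (u n)" y] LIMSEQ_unique by fastforce
  then show "inv T x = y"
    using assms(2) by (auto simp: bij_is_inj)
qed

text \<open>The pointwise supremum is countably subadditive because each \<open>T i\<close> is
  continuous; Zabreiko's lemma then bounds it by a multiple of the norm.\<close>

theorem uniform_boundedness:
  fixes T :: "'i \<Rightarrow> 'a::banach \<Rightarrow>\<^sub>L 'b::banach"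
  assumes bdd: "\<And>x. bdd_above ((\<lambda>i. norm (T i x)) ` I)"
  shows "bdd_above ((\<lambda>i. norm (T i)) ` I)"
\<comment> \<open>An empty index set is set apart because the supremum of the empty set of reals is
  an unspecified value.\<close>
proof (cases "I = {}")
  case False
  define p where "p x = (SUP i\<in>I. norm (T i x))" for x
  have up: "norm (T i x) \<le> p x" if "i \<in> I" for i x
    unfolding p_def using that bdd by (intro cSUP_upper)
  have least: "p x \<le> c" if "\<And>i. i \<in> I \<Longrightarrow> norm (T i x) \<le> c" for x c
    unfolding p_def using that False by (intro cSUP_least)
  have "\<exists>C. \<forall>x. p x \<le> C * norm x"
  proof (rule zabreiko)
    show "p (x + y) \<le> p x + p y" for x y
      by (rule least) (metis add_mono blinfun.add_right norm_triangle_le up)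
    have le: "p (r *\<^sub>R x) \<le> \<bar>r\<bar> * p x" for r x
      by (rule least) (simp add: blinfun.scaleR_right mult_left_mono up)
    show "p (r *\<^sub>R x) = \<bar>r\<bar> * p x" for r x
    proof (cases "r = 0")
      case True
      then show ?thesis
        using False by (simp add: p_def)
    next
      case False
      then have "\<bar>r\<bar> * p x \<le> p (r *\<^sub>R x)"
        using le[of "inverse r" "r *\<^sub>R x"] by (simp add: field_simps)
      with le show ?thesis by (simp add: order_antisym)
    qed
    fix u x assume u: "u sums x" and s: "summable (\<lambda>n::nat. p (u n))"
    show "p x \<le> (\<Sum>n. p (u n))"
    proof (rule least)
      fix i assume i: "i \<in> I"
      have s': "summable (\<lambda>n. norm (T i (u n)))"
        by (rule summable_comparison_test'[OF s]) (simp add: up[OF i])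
      have "T i x = (\<Sum>n. T i (u n))"
        using bounded_linear.sums[OF blinfun.bounded_linear_right u, of "T i"] by (rule sums_unique)
      also have "norm \<dots> \<le> (\<Sum>n. norm (T i (u n)))"
        by (rule summable_norm[OF s'])
      also have "\<dots> \<le> (\<Sum>n. p (u n))"
        by (intro suminf_le s s' up i)
      finally show "norm (T i x) \<le> (\<Sum>n. p (u n))" .
    qed
  qed
  then obtain C where C: "\<And>x. p x \<le> C * norm x" by blast
  \<comment> \<open>On a trivial space \<open>C\<close> may be negative, while
    \<open>norm_blinfun_bound\<close> asks for a nonnegative constant.\<close>
  have "norm (T i) \<le> max C 0" if "i \<in> I" for i
  proof (rule norm_blinfun_bound)
    fix x
    have "norm (T i x) \<le> C * norm x"
      using up[OF that] C by (rule order_trans)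
    also have "\<dots> \<le> max C 0 * norm x"
      by (intro mult_right_mono) auto
    finally show "norm (T i x) \<le> max C 0 * norm x" .
  qed simp
  then show ?thesis by (intro bdd_aboveI2)
qed simp

section \<open>Complex Hilbert spaces\<close>

lemma cinner_zero_right [simp]: "cinner x 0 = 0"
  using cinner_add_right[of x 0 0] by simp

lemma cinner_zero_left [simp]: "cinner 0 x = 0"
  using cinner_add_left[of 0 0 x] by simp

lemma cinner_diff_right: "cinner x (y - z) = cinner x y - cinner x z"
  using cinner_add_right[of x "y - z" z] by simp

lemma cinner_diff_left: "cinner (x - y) z = cinner x z - cinner y z"
  using cinner_add_left[of "x - y" y z] by simp

lemma cinner_scaleR_right: "cinner x (r *\<^sub>R y) = r *\<^sub>R cinner x y"
  by (metis cinner_scaleC_right scaleC_of_real scaleR_conv_of_real)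

lemma norm_le_cinnerI:
  assumes "0 \<le> c" "\<And>v. cmod (cinner v x) \<le> c * norm v"
  shows "norm x \<le> c"
proof (cases "x = 0")
  case False
  have "norm x * norm x \<le> c * norm x"
    using assms(2)[of x] by (simp add: cinner_self norm_power norm_mult power2_eq_square)
  then show ?thesis using False by simp
qed (simp add: assms)

lemma cinner_ext: "(\<And>v. cinner v x = cinner v y) \<Longrightarrow> x = y"
  using norm_le_cinnerI[of 0 "x - y"] by (simp add: cinner_diff_right)

text \<open>Operator integrals are known only by their matrix elements; norm estimates for them go
  through this bound.\<close>

lemma norm_blinfun_le_cinnerI:
  fixes A :: "'a::complex_hilbert \<Rightarrow>\<^sub>L 'b::complex_hilbert"
  assumes "0 \<le> c" "\<And>u v. cmod (cinner v (A u)) \<le> c * norm u * norm v"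
  shows "norm A \<le> c"
  by (rule norm_blinfun_bound[OF assms(1)], rule norm_le_cinnerI) (use assms in auto)

section \<open>Orthogonality, the Riesz representation, and operators given by forms\<close>

lemma norm_add_square:
  "(norm (x + y))\<^sup>2 = (norm x)\<^sup>2 + (norm y)\<^sup>2 + 2 * Re (cinner x y)"
proof -
  have "complex_of_real ((norm (x + y))\<^sup>2) = complex_of_real ((norm x)\<^sup>2) + complex_of_real ((norm y)\<^sup>2)
      + (cinner x y + cnj (cinner x y))"
    unfolding cinner_self[symmetric] cinner_commute[of y x, symmetric]
    by (simp only: cinner_add_left cinner_add_right ac_simps)
  also have "\<dots> = complex_of_real ((norm x)\<^sup>2 + (norm y)\<^sup>2 + 2 * Re (cinner x y))"
    by (simp add: complex_add_cnj)
  finally show ?thesis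
    unfolding of_real_eq_iff .
qed

lemma parallelogram:
  fixes x y :: "'a::complex_hilbert"
  shows "(norm (x + y))\<^sup>2 + (norm (x - y))\<^sup>2 = 2 * (norm x)\<^sup>2 + 2 * (norm y)\<^sup>2"
proof -
  have "cinner x (- y) = - cinner x y"
    using cinner_diff_right[of x 0 y] by simp
  then show ?thesis
    using norm_add_square[of x y] norm_add_square[of x "- y"] by simp
qed

lemma bounded_linear_cinner: "bounded_linear (cinner v)"
  by (rule bounded_linear_intro[where K = "norm v"])
    (simp_all add: cinner_add_right cinner_scaleR_right cinner_Cauchy_Schwarz mult.commute[of "norm _" "norm v"])

definition cinner_form :: "'a::complex_hilbert \<Rightarrow> 'a \<Rightarrow>\<^sub>L complex"
  where "cinner_form v = Blinfun (cinner v)"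

lemma cinner_form_apply [simp]: "cinner_form v u = cinner v u"
  by (simp add: cinner_form_def bounded_linear_Blinfun_apply bounded_linear_cinner)

lemma bopsI: "(\<And>c x. T (c *\<^sub>C x) = c *\<^sub>C T x) \<Longrightarrow> T \<in> bops"
  for T :: "'a::complex_banach \<Rightarrow>\<^sub>L 'b::complex_banach"
  by (simp add: bops_def)

lemma bops_scaleC: "T \<in> bops \<Longrightarrow> T (c *\<^sub>C x) = c *\<^sub>C T x"
  for T :: "'a::complex_banach \<Rightarrow>\<^sub>L 'b::complex_banach"
  by (simp add: bops_def)

lemma bops_compose [intro]: "S \<in> bops \<Longrightarrow> T \<in> bops \<Longrightarrow> S o\<^sub>L T \<in> bops"
  for T :: "'a::complex_banach \<Rightarrow>\<^sub>L 'b::complex_banach"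
  by (simp add: bops_def)

lemma cinner_form_bops [intro, simp]: "cinner_form v \<in> bops"
  by (auto intro!: bopsI simp: cinner_scaleC_right scaleC_complex_def)

text \<open>The difference between \<open>x\<close> and its nearest point in \<open>Y\<close> is
  orthogonal to \<open>Y\<close>. The parallelogram law makes minimizing sequences Cauchy, since
  midpoints stay in \<open>Y\<close> and cannot be nearer to \<open>x\<close> than the
  infimum.\<close>

theorem exists_orthogonal:
  fixes Y :: "'a::complex_hilbert set"
  assumes "closed Y" "0 \<in> Y" and add: "\<And>x y. x \<in> Y \<Longrightarrow> y \<in> Y \<Longrightarrow> x + y \<in> Y"
    and scale: "\<And>c x. x \<in> Y \<Longrightarrow> c *\<^sub>C x \<in> Y" and "x \<notin> Y"
  obtains w where "w \<noteq> 0" "\<And>y. y \<in> Y \<Longrightarrow> cinner y w = 0"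
proof -
  define d where "d = (INF y\<in>Y. (norm (x - y))\<^sup>2)"
  have bdd: "bdd_below ((\<lambda>y. (norm (x - y))\<^sup>2) ` Y)"
    by (rule bdd_belowI2[where m = 0]) simp
  have low: "d \<le> (norm (x - y))\<^sup>2" if "y \<in> Y" for y
    unfolding d_def by (rule cINF_lower[OF bdd that])
  have "\<exists>y\<in>Y. (norm (x - y))\<^sup>2 < d + 1 / (real n + 1)" for n :: nat
    using \<open>0 \<in> Y\<close> cINF_less_iff[OF _ bdd, of "d + 1 / (real n + 1)"] unfolding d_def[symmetric] by auto
  then obtain y where y: "\<And>n :: nat. y n \<in> Y" "\<And>n :: nat. (norm (x - y n))\<^sup>2 < d + 1 / (real n + 1)"
    by metis
  have close: "(norm (y n - y k))\<^sup>2 \<le> 2 / (real n + 1) + 2 / (real k + 1)" for n k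
  proof -
    have "(1/2) *\<^sub>R (y n + y k) \<in> Y"
      unfolding scaleC_of_real[symmetric] by (intro scale add y)
    then have "4 * d \<le> 4 * (norm (x - (1/2) *\<^sub>R (y n + y k)))\<^sup>2"
      using low by simp
    also have "\<dots> = (norm (2 *\<^sub>R (x - (1/2) *\<^sub>R (y n + y k))))\<^sup>2"
      by (simp add: power_mult_distrib)
    also have "2 *\<^sub>R (x - (1/2) *\<^sub>R (y n + y k)) = (x - y n) + (x - y k)"
      by (simp add: algebra_simps scaleR_2)
    finally have "4 * d \<le> (norm ((x - y n) + (x - y k)))\<^sup>2" .
    moreover have "(x - y n) - (x - y k) = - (y n - y k)"
      by simp
    then have "norm ((x - y n) - (x - y k)) = norm (y n - y k)"
      by (metis norm_minus_cancel)
    ultimately show ?thesis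
      using parallelogram[of "x - y n" "x - y k"] y(2)[of n] y(2)[of k] by simp
  qed
  have "Cauchy y"
  proof (rule CauchyI)
    fix e :: real assume e: "0 < e"
    obtain N where N: "4 / e\<^sup>2 < real N" using reals_Archimedean2 by blast
    have "norm (y m - y n) < e" if "N \<le> m" "N \<le> n" for m n
    proof -
      have "0 < real N" using N e by (meson divide_pos_pos less_trans zero_less_numeral zero_less_power)
      have "(norm (y m - y n))\<^sup>2 \<le> 2 / (real m + 1) + 2 / (real n + 1)"
        by (rule close)
      also have "\<dots> \<le> 2 / real N + 2 / real N"
        using that \<open>0 < real N\<close> by (intro add_mono divide_left_mono) auto
      also have "\<dots> < e\<^sup>2"
        using N e \<open>0 < real N\<close> by (simp add: field_simps)
      finally show ?thesis
        using e power_less_imp_less_base by fastforce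
    qed
    then show "\<exists>M. \<forall>m\<ge>M. \<forall>n\<ge>M. norm (y m - y n) < e" by blast
  qed
  then obtain y0 where y0: "y \<longlonglongrightarrow> y0"
    using Cauchy_convergent convergent_def by blast
  then have "y0 \<in> Y"
    using \<open>closed Y\<close> y(1) closed_sequentially by blast
  have "(\<lambda>n. d + 1 / (real n + 1)) \<longlonglongrightarrow> d + 0"
    using LIMSEQ_inverse_real_of_nat by (intro tendsto_intros) (simp add: inverse_eq_divide add.commute)
  moreover have "(\<lambda>n. (norm (x - y n))\<^sup>2) \<longlonglongrightarrow> (norm (x - y0))\<^sup>2"
    by (intro tendsto_intros y0)
  ultimately have min: "(norm (x - y0))\<^sup>2 \<le> d"
    using y(2) by (intro LIMSEQ_le[where X = "\<lambda>n. (norm (x - y n))\<^sup>2" and Y = "\<lambda>n. d + 1 / (real n + 1)"])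
      (auto intro: less_imp_le)
  define w where "w = x - y0"
  have "w \<noteq> 0" using \<open>y0 \<in> Y\<close> \<open>x \<notin> Y\<close> by (auto simp: w_def)
  moreover have "cinner y w = 0" if "y \<in> Y" for y
  proof -
    \<comment> \<open>Comparing \<open>y0\<close> with a point shifted along \<open>y\<close> gives
      \<open>0 \<le> t * (cmod b)\<^sup>2 * (t * (norm y)\<^sup>2 - 2)\<close>. This
      \<open>t\<close> keeps \<open>t * (norm y)\<^sup>2\<close> at most \<open>1\<close>, which
      forces \<open>b = 0\<close>; the \<open>1\<close> in the denominator covers
      \<open>y = 0\<close>.\<close>
    define t where "t = 1 / (1 + (norm y)\<^sup>2)"
    have t: "0 < t" "t * (norm y)\<^sup>2 \<le> 1"
      by (auto simp: t_def add_pos_nonneg field_simps)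
    define b where "b = cinner y w"
    define c where "c = - (complex_of_real t * b)"
    have "y0 + (- c) *\<^sub>C y \<in> Y"
      using \<open>y0 \<in> Y\<close> that by (intro add scale)
    then have "(norm w)\<^sup>2 \<le> (norm (x - (y0 + (- c) *\<^sub>C y)))\<^sup>2"
      unfolding w_def by (intro order_trans[OF min low])
    also have "(- c) *\<^sub>C y = - (c *\<^sub>C y)"
      using scaleC_add_left[of "-c" c y] scaleC_of_real[of 0 y] by (simp add: eq_neg_iff_add_eq_0)
    then have "x - (y0 + (- c) *\<^sub>C y) = w + c *\<^sub>C y"
      by (simp add: w_def)
    also have "(norm (w + c *\<^sub>C y))\<^sup>2 = (norm w)\<^sup>2 + (cmod c * norm y)\<^sup>2 + 2 * Re (c * cnj b)"
      using cinner_commute[of w y] by (simp add: norm_add_square norm_scaleC cinner_scaleC_right b_def)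
    also have "c * cnj b = complex_of_real (- (t * (cmod b)\<^sup>2))"
      using complex_norm_square[of b] by (simp add: c_def mult.assoc)
    also have "cmod c = t * cmod b"
      using t by (simp add: c_def norm_mult)
    finally have "0 \<le> t * (cmod b)\<^sup>2 * (t * (norm y)\<^sup>2 - 2)"
      by (simp add: power_mult_distrib algebra_simps power2_eq_square)
    then have "(cmod b)\<^sup>2 \<le> 0"
      using t by (simp add: zero_le_mult_iff mult_le_0_iff)
    then show ?thesis by (simp add: b_def)
  qed
  ultimately show ?thesis by (rule that)
qed

text \<open>The kernel of a nonzero functional has a nonzero orthogonal vector \<open>w\<close>. For
  each \<open>u\<close> the vector \<open>l w *\<^sub>C u - l u *\<^sub>C w\<close> lies in the
  kernel, and its orthogonality to \<open>w\<close> expresses \<open>l u\<close> by the inner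
  product of \<open>w\<close> and \<open>u\<close>.\<close>

theorem riesz_representation:
  fixes l :: "'a::complex_hilbert \<Rightarrow>\<^sub>L complex"
  assumes l: "l \<in> bops"
  obtains v where "l = cinner_form v"
proof (cases "\<forall>x. l x = 0")
  case True
  then show ?thesis by (intro that[of 0] blinfun_eqI) simp
next
  case False
  then obtain x where x: "l x \<noteq> 0" by blast
  have lC: "l (c *\<^sub>C y) = c * l y" for c y
    using bops_scaleC[OF l] by (simp add: scaleC_complex_def)
  obtain w where w: "w \<noteq> 0" "\<And>y. y \<in> {y. l y = 0} \<Longrightarrow> cinner y w = 0"
  proof (rule exists_orthogonal)
    show "closed {y. l y = 0}"
      by (intro closed_Collect_eq continuous_intros)
  qed (use x in \<open>auto simp: blinfun.add_right lC blinfun.zero_right\<close>)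
  have "l w \<noteq> 0"
    using w(1) w(2)[of w] by (auto simp: cinner_self)
  \<comment> \<open>The coefficient is conjugated because \<open>cinner\<close> is antilinear in its
    first argument.\<close>
  show ?thesis
  proof (rule that[of "cnj (l w / cinner w w) *\<^sub>C w"], rule blinfun_eqI)
    fix u
    have "cinner (l w *\<^sub>C u - l u *\<^sub>C w) w = 0"
      by (rule w) (simp add: blinfun.diff_right lC)
    then have "cnj (l w) * cinner u w = cnj (l u) * cinner w w"
      by (simp add: cinner_diff_left cinner_scaleC_left)
    then have "cnj (cnj (l w) * cinner u w) = cnj (cnj (l u) * cinner w w)"
      by (rule arg_cong)
    then have "l w * cinner w u = l u * cinner w w"
      unfolding complex_cnj_mult complex_cnj_cnj by (metis cinner_commute)
    then show "l u = cinner_form (cnj (l w / cinner w w) *\<^sub>C w) u"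
      using w(1) by (simp add: cinner_scaleC_left cinner_self field_simps)
  qed
qed

text \<open>The representing vectors of the functionals \<open>cinner h \<circ> j\<close> are the vectors \<open>j\<^sup>* h\<close>.\<close>

lemma adjoint_range_total:
  fixes j :: "'g::complex_hilbert \<Rightarrow>\<^sub>L 'h::complex_hilbert"
  assumes j: "j \<in> bops" "inj j" and Y: "closed Y" "\<And>x y. x \<in> Y \<Longrightarrow> y \<in> Y \<Longrightarrow> x + y \<in> Y"
      "\<And>c x. x \<in> Y \<Longrightarrow> c *\<^sub>C x \<in> Y"
    and adj: "\<And>h v. (\<And>u. cinner v u = cinner h (j u)) \<Longrightarrow> v \<in> Y"
  shows "v \<in> Y"
proof (rule ccontr)
  assume "v \<notin> Y"
  moreover have "0 \<in> Y" by (rule adj[of 0 0]) simp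
  ultimately obtain w where w: "w \<noteq> 0" "\<And>y. y \<in> Y \<Longrightarrow> cinner y w = 0"
    using exists_orthogonal Y by metis
  \<comment> \<open>The Riesz vector \<open>y\<close> of \<open>cinner h \<circ> j\<close> lies in
    \<open>Y\<close>, so it is orthogonal to \<open>w\<close>; as this holds for every
    \<open>h\<close>, the vector \<open>j w\<close> vanishes, against injectivity.\<close>
  have "cinner h (j w) = 0" for h
  proof -
    obtain y where "cinner_form h o\<^sub>L j = cinner_form y"
      using j by (metis bops_compose cinner_form_bops riesz_representation)
    then have "cinner y u = cinner h (j u)" for u
      by (metis blinfun_apply_blinfun_compose cinner_form_apply)
    then show ?thesis using w(2)[OF adj] by metis
  qed
  then have "j w = 0" using cinner_ext[of "j w" 0] by simp
  then show False
    using w(1) j(2) by (metis blinfun.zero_right injD)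
qed

text \<open>For fixed \<open>u\<close> the conjugate of \<open>\<lambda>v. b v u\<close> is a linear
  functional, and its Riesz vector is the value of the operator at \<open>u\<close>. Linearity in
  \<open>u\<close> follows because a vector is determined by its inner products.\<close>

lemma sesquilinear_operator:
  fixes b :: "'b::complex_hilbert \<Rightarrow> 'a::complex_hilbert \<Rightarrow> complex"
  assumes add1: "\<And>u v w. b (u + v) w = b u w + b v w" and add2: "\<And>u v w. b w (u + v) = b w u + b w v"
    and scale1: "\<And>c u v. b (c *\<^sub>C u) v = cnj c * b u v" and scale2: "\<And>c u v. b u (c *\<^sub>C v) = c * b u v"
    and bound: "\<And>u v. cmod (b u v) \<le> C * norm u * norm v"
  obtains A where "A \<in> bops" "\<And>u v. cinner v (blinfun_apply A u) = b v u"
proof -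
  have "\<exists>w. \<forall>v. cinner v w = b v u" for u
  proof -
    have bl: "bounded_linear (\<lambda>v. cnj (b v u))"
    proof (rule bounded_linear_intro[where K = "C * norm u"])
      show "cnj (b (r *\<^sub>R x) u) = r *\<^sub>R cnj (b x u)" for r x
        by (simp add: scale1 scaleR_conv_of_real flip: scaleC_of_real)
    qed (use bound in \<open>auto simp: add1 mult_ac\<close>)
    then have "Blinfun (\<lambda>v. cnj (b v u)) \<in> bops"
      by (intro bopsI) (simp add: bounded_linear_Blinfun_apply scale1 scaleC_complex_def)
    then obtain w where "Blinfun (\<lambda>v. cnj (b v u)) = cinner_form w"
      by (rule riesz_representation)
    then have "cnj (b v u) = cinner w v" for v
      using bl by (metis bounded_linear_Blinfun_apply cinner_form_apply)
    then show ?thesis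
      by (metis cinner_commute complex_cnj_cnj)
  qed
  then obtain A where A: "\<And>u v. cinner v (A u) = b v u" by metis
  have scaleC: "A (c *\<^sub>C u) = c *\<^sub>C A u" for c u
    by (rule cinner_ext) (simp add: A scale2 cinner_scaleC_right)
  \<comment> \<open>The bound on the form leaves the sign of \<open>C\<close> open, hence the
    absolute value.\<close>
  have "bounded_linear A"
  proof (rule bounded_linear_intro[where K = "\<bar>C\<bar>"])
    show "A (u + v) = A u + A v" for u v
      by (rule cinner_ext) (simp add: A add2 cinner_add_right)
    show "A (r *\<^sub>R u) = r *\<^sub>R A u" for r u
      using scaleC[of "complex_of_real r" u] by (simp add: scaleC_of_real)
    show "norm (A u) \<le> norm u * \<bar>C\<bar>" for u
    proof (rule norm_le_cinnerI)
      fix v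
      have "cmod (cinner v (A u)) \<le> C * (norm v * norm u)"
        using bound[of v u] by (simp add: A mult_ac)
      also have "\<dots> \<le> \<bar>C\<bar> * (norm v * norm u)"
        by (intro mult_right_mono) auto
      finally show "cmod (cinner v (A u)) \<le> norm u * \<bar>C\<bar> * norm v"
        by (simp add: mult_ac)
    qed simp
  qed
  then show ?thesis
    by (intro that[of "Blinfun A"] bopsI) (simp_all add: bounded_linear_Blinfun_apply A scaleC)
qed

section \<open>The dual group\<close>

lemma char_add: "char_of k (x + y) = char_of k x * char_of k y"
  using char_of[of k] by blast

lemma cmod_char [simp]: "cmod (char_of k x) = 1"
  using char_of[of k] by blast

lemma continuous_on_char: "continuous_on UNIV (char_of k)"
  using char_of[of k] by blast

lemma char_zero [simp]: "char_of k 0 = 1"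
  using char_add[of k 0 0] by (metis add_0 cmod_char mult_cancel_left1 norm_zero zero_neq_one)

lemma char_minus: "char_of k (- x) = cnj (char_of k x)"
proof -
  have "char_of k x * char_of k (- x) = char_of k x * cnj (char_of k x)"
    using char_add[of k x "- x"] complex_norm_square[of "char_of k x"] by simp
  moreover have "char_of k x \<noteq> 0" by (metis cmod_char norm_zero zero_neq_one)
  ultimately show ?thesis by simp
qed

text \<open>A subbasic set of the compact-open topology prescribes one open target for a whole
  compact set. Uniform closeness on \<open>C\<close> is therefore enforced by splitting
  \<open>C\<close> into finitely many compact pieces on which \<open>char_of l\<close> is almost
  constant.\<close>

lemma eventually_nhds_dual_near:
  assumes C: "compact C" and r: "0 < r"
  shows "\<forall>\<^sub>F k in nhds l. \<forall>x\<in>C. cmod (char_of k x - char_of l x) < r"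
proof -
  let ?l = "char_of l"
  \<comment> \<open>Closed balls make the pieces compact. Radius \<open>r / 3\<close> is strictly
    below the target radius \<open>r / 2\<close>, which puts \<open>l\<close> into \<open>W\<close>,
    and the two radii add up to less than \<open>r\<close>.\<close>
  define D where "D y = C \<inter> ?l -` cball (?l y) (r/3)" for y
  have cl: "continuous_on UNIV ?l" by (rule continuous_on_char)
  obtain Y where Y: "Y \<subseteq> C" "finite Y" "C \<subseteq> (\<Union>y\<in>Y. ?l -` ball (?l y) (r/3))"
  proof (rule compactE_image[OF C])
    show "open (?l -` ball (?l y) (r/3))" for y
      by (rule open_vimage[OF open_ball cl])
    show "C \<subseteq> (\<Union>y\<in>C. ?l -` ball (?l y) (r/3))" using r by auto
  qed
  define W where "W = (\<Inter>y\<in>Y. {k. char_of k ` D y \<subseteq> ball (?l y) (r/2)})"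
  have "compact (D y)" for y
    unfolding D_def using C closed_vimage[OF closed_cball cl] by blast
  then have "open {k. char_of k ` D y \<subseteq> ball (?l y) (r/2)}" for y
    unfolding open_dual_def by (intro generate_topology.Basis) blast
  then have "open W" unfolding W_def using Y(2) by blast
  moreover have "l \<in> W" using r by (auto simp: W_def D_def)
  moreover have "\<forall>x\<in>C. cmod (char_of k x - ?l x) < r" if "k \<in> W" for k
  proof
    fix x assume x: "x \<in> C"
    then obtain y where y: "y \<in> Y" "dist (?l y) (?l x) < r/3" using Y(3) by auto
    then have "x \<in> D y" using x by (auto simp: D_def)
    moreover have "char_of k ` D y \<subseteq> ball (?l y) (r/2)" using that y(1) by (simp add: W_def)
    ultimately have "dist (?l y) (char_of k x) < r/2" by auto
    moreover have "dist (char_of k x) (?l x) \<le> dist (?l y) (char_of k x) + dist (?l y) (?l x)"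
      by (rule dist_triangle3)
    ultimately show "cmod (char_of k x - ?l x) < r"
      unfolding dist_norm[symmetric] using y(2) r by simp
  qed
  ultimately show ?thesis unfolding eventually_nhds by blast
qed

text \<open>A compact image inside an open set leaves a positive margin, and a finite intersection
  costs only a larger compact set and a smaller radius.\<close>

lemma open_dual_near:
  fixes W :: "'x::topological_ab_group_add dual set"
  assumes "open W" "l \<in> W"
  shows "\<exists>C r. compact C \<and> 0 < r \<and> (\<forall>k. (\<forall>x\<in>C. cmod (char_of k x - char_of l x) < r) \<longrightarrow> k \<in> W)"
  using assms unfolding open_dual_def
proof (induction rule: generate_topology.induct)
  case UNIV
  show ?case by (intro exI[of _ "{}"] exI[of _ 1]) simp
next
  case (Int a b)
  then obtain C1 r1 C2 r2 where 1: "compact C1" "0 < r1"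
      "\<forall>k. (\<forall>x\<in>C1. cmod (char_of k x - char_of l x) < r1) \<longrightarrow> k \<in> a"
    and 2: "compact C2" "0 < r2"
      "\<forall>k. (\<forall>x\<in>C2. cmod (char_of k x - char_of l x) < r2) \<longrightarrow> k \<in> b"
    by auto
  then show ?case
    by (intro exI[of _ "C1 \<union> C2"] exI[of _ "min r1 r2"])
      (simp add: compact_Un ball_Un)
next
  case (UN S)
  then obtain A where "A \<in> S" "l \<in> A" by blast
  with UN show ?case by (meson UnionI)
next
  case (Basis S)
  then obtain C U where S: "S = {k. char_of k ` C \<subseteq> U}" "compact C" "open U" by blast
  have "compact (char_of l ` C)"
    using S(2) by (rule compact_continuous_image[OF continuous_on_subset[OF continuous_on_char subset_UNIV]])
  moreover have "char_of l ` C \<subseteq> U" using Basis S by blast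
  ultimately obtain r where r: "0 < r" "(\<Union>x\<in>char_of l ` C. ball x r) \<subseteq> U"
    using S(3) by (metis compact_subset_open_imp_ball_epsilon_subset)
  have "k \<in> S" if "\<forall>x\<in>C. cmod (char_of k x - char_of l x) < r" for k
  proof -
    have "char_of k x \<in> U" if "x \<in> C" for x
      using r(2) that \<open>\<forall>x\<in>C. _ x\<close> by (force simp: dist_norm norm_minus_commute)
    then show ?thesis using S(1) by blast
  qed
  then show ?case using S(2) r(1) by blast
qed

text \<open>Continuity of the group operations becomes an estimate of unimodular numbers once
  neighbourhoods are described by uniform closeness on compact sets.\<close>

lemma eventually_nhds_dual:
  "(\<forall>\<^sub>F k in nhds l. P k) \<longleftrightarrow>
    (\<exists>C r. compact C \<and> 0 < r \<and> (\<forall>k. (\<forall>x\<in>C. cmod (char_of k x - char_of l x) < r) \<longrightarrow> P k))"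
proof
  assume "\<forall>\<^sub>F k in nhds l. P k"
  then obtain W where "open W" "l \<in> W" "\<forall>k\<in>W. P k" unfolding eventually_nhds by blast
  then show "\<exists>C r. compact C \<and> 0 < r \<and> (\<forall>k. (\<forall>x\<in>C. cmod (char_of k x - char_of l x) < r) \<longrightarrow> P k)"
    using open_dual_near[of W l] by metis
next
  assume "\<exists>C r. compact C \<and> 0 < r \<and> (\<forall>k. (\<forall>x\<in>C. cmod (char_of k x - char_of l x) < r) \<longrightarrow> P k)"
  then obtain C r where "compact C" "0 < r" "\<forall>k. (\<forall>x\<in>C. cmod (char_of k x - char_of l x) < r) \<longrightarrow> P k"
    by blast
  then show "\<forall>\<^sub>F k in nhds l. P k"
    using eventually_mono[OF eventually_nhds_dual_near[of C r l]] by blast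
qed

instance dual :: (topological_ab_group_add) topological_ab_group_add
proof
  fix a b :: "'a dual"
  show "LIM x (nhds a \<times>\<^sub>F nhds b). fst x + snd x :> nhds (a + b)"
    unfolding filterlim_iff
  proof (intro allI impI)
    fix P assume "\<forall>\<^sub>F k in nhds (a + b). P k"
    then obtain C r where C: "compact C" "0 < r"
      and P: "\<And>k. (\<forall>x\<in>C. cmod (char_of k x - char_of (a + b) x) < r) \<Longrightarrow> P k"
      unfolding eventually_nhds_dual by blast
    have "P (k + l)" if k: "\<forall>x\<in>C. cmod (char_of k x - char_of a x) < r/2"
      and l: "\<forall>x\<in>C. cmod (char_of l x - char_of b x) < r/2" for k l
    proof (rule P, rule ballI)
      fix x assume x: "x \<in> C"
      \<comment> \<open>The factors left over in this telescoping have modulus \<open>1\<close>, so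
        each summand may use \<open>r / 2\<close>.\<close>
      have "char_of (k + l) x - char_of (a + b) x
          = (char_of k x - char_of a x) * char_of l x + char_of a x * (char_of l x - char_of b x)"
        by (simp add: plus_dual.rep_eq algebra_simps)
      then have "cmod (char_of (k + l) x - char_of (a + b) x)
          \<le> cmod (char_of k x - char_of a x) + cmod (char_of l x - char_of b x)"
        using norm_triangle_ineq[of "(char_of k x - char_of a x) * char_of l x"
            "char_of a x * (char_of l x - char_of b x)"] by (simp add: norm_mult)
      also have "\<dots> < r" using bspec[OF k x] bspec[OF l x] by linarith
      finally show "cmod (char_of (k + l) x - char_of (a + b) x) < r" .
    qed
    then show "\<forall>\<^sub>F x in nhds a \<times>\<^sub>F nhds b. P (fst x + snd x)"
      unfolding eventually_prod_filter
      using eventually_nhds_dual_near[OF C(1), of "r/2" a] eventually_nhds_dual_near[OF C(1), of "r/2" b] C(2)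
      by (intro exI conjI) auto
  qed
next
  fix a :: "'a dual"
  show "(uminus \<longlongrightarrow> - a) (nhds a)"
    unfolding filterlim_iff
  proof (intro allI impI)
    fix P assume "\<forall>\<^sub>F k in nhds (- a). P k"
    then obtain C r where C: "compact C" "0 < r"
      and P: "\<And>k. (\<forall>x\<in>C. cmod (char_of k x - char_of (- a) x) < r) \<Longrightarrow> P k"
      unfolding eventually_nhds_dual by blast
    have "cmod (char_of (- k) x - char_of (- a) x) = cmod (char_of k x - char_of a x)" for k x
      unfolding uminus_dual.rep_eq complex_cnj_diff[symmetric] by (rule complex_mod_cnj)
    then have "P (- k)" if "\<forall>x\<in>C. cmod (char_of k x - char_of a x) < r" for k
      using that by (intro P) simp
    then show "\<forall>\<^sub>F k in nhds a. P (- k)"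
      unfolding eventually_nhds_dual using C by blast
  qed
qed

lemma continuous_on_char_eval: "continuous_on UNIV (\<lambda>k. char_of k x)"
proof -
  have "((\<lambda>k. char_of k x) \<longlongrightarrow> char_of l x) (nhds l)" for l
    unfolding tendsto_iff dist_norm
    using eventually_nhds_dual_near[of "{x}" _ l] by simp
  then show ?thesis
    unfolding continuous_on_def unfolding at_within_def by (blast intro: tendsto_mono[OF inf_le1])
qed

instance dual :: (topological_ab_group_add) t2_space
proof
  fix k l :: "'a dual" assume "k \<noteq> l"
  then obtain x where "char_of k x \<noteq> char_of l x"
    by (metis char_of_inject ext)
  then obtain A B where AB: "open A" "open B" "char_of k x \<in> A" "char_of l x \<in> B" "A \<inter> B = {}"
    by (metis hausdorff)
  then show "\<exists>U V. open U \<and> open V \<and> k \<in> U \<and> l \<in> V \<and> U \<inter> V = {}"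
    by (intro exI[of _ "(\<lambda>k. char_of k x) -` A"] exI[of _ "(\<lambda>k. char_of k x) -` B"])
      (auto intro: open_vimage continuous_on_char_eval)
qed

lemma image_add_eq_vimage: "(+) a ` A = (\<lambda>x. x - a) -` A" for a :: "'a::ab_group_add"
proof -
  have "x \<in> (+) a ` A" if "x - a \<in> A" for x
    using that by (intro image_eqI[of _ _ "x - a"]) auto
  then show ?thesis by auto
qed

lemma open_translation_group: "open A \<Longrightarrow> open ((+) a ` A)" for a :: "'a::topological_ab_group_add"
  unfolding image_add_eq_vimage by (intro open_vimage) (auto intro!: continuous_intros)

lemma compact_translation_group: "compact A \<Longrightarrow> compact ((+) a ` A)" for a :: "'a::topological_ab_group_add"
  by (intro compact_continuous_image) (auto intro!: continuous_intros)

lemma compact_sums_group: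
  fixes A B :: "'a::topological_ab_group_add set"
  assumes "compact A" "compact B"
  shows "compact {x + y | x y. x \<in> A \<and> y \<in> B}"
proof -
  have "compact ((\<lambda>(x, y). x + y) ` (A \<times> B))"
    using assms by (intro compact_continuous_image compact_Times)
      (auto simp: case_prod_beta intro!: continuous_intros)
  moreover have "(\<lambda>(x, y). x + y) ` (A \<times> B) = {x + y | x y. x \<in> A \<and> y \<in> B}"
    by auto
  ultimately show ?thesis by simp
qed

section \<open>Haar measures\<close>

context
  fixes m :: "'x::{topological_ab_group_add, t2_space} measure"
  assumes haar: "haar_measure m"
begin

lemma haar_sets: "sets m = sets borel" and haar_space: "space m = UNIV"
  using haar sets_eq_imp_space_eq[of m borel] by (auto simp: haar_measure_def)

lemma haar_measurable: "continuous_on UNIV f \<Longrightarrow> f \<in> borel_measurable m"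
  using borel_measurable_continuous_onI measurable_cong_sets[OF haar_sets refl] by blast

lemma haar_compact_finite: "compact C \<Longrightarrow> emeasure m C < \<infinity>"
  using haar by (auto simp: haar_measure_def)

lemma haar_translate: "A \<in> sets borel \<Longrightarrow> emeasure m ((+) a ` A) = emeasure m A"
proof -
  have "\<forall>x. \<forall>A\<in>sets borel. emeasure m ((+) x ` A) = emeasure m A"
    using haar unfolding haar_measure_def by (elim conjE)
  then show "A \<in> sets borel \<Longrightarrow> emeasure m ((+) a ` A) = emeasure m A" by blast
qed

lemma distr_translation: "distr m m ((+) a) = m"
proof (rule measure_eqI)
  have meas: "(+) a \<in> measurable m m"
    unfolding measurable_cong_sets[OF haar_sets haar_sets]
    by (intro borel_measurable_continuous_onI continuous_intros)
  fix A assume "A \<in> sets (distr m m ((+) a))"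
  then have A: "A \<in> sets m" by simp
  have "(+) a -` A = (+) (- a) ` A"
    unfolding image_add_eq_vimage by (simp add: vimage_def add.commute)
  then have "emeasure (distr m m ((+) a)) A = emeasure m ((+) (- a) ` A)"
    using A by (simp add: emeasure_distr[OF meas] haar_space)
  also have "\<dots> = emeasure m A"
    using A by (simp only: haar_sets haar_translate)
  finally show "emeasure (distr m m ((+) a)) A = emeasure m A" .
qed simp

lemma has_bochner_integral_translation:
  fixes f :: "'x \<Rightarrow> 'b::{banach, second_countable_topology}"
  assumes "has_bochner_integral m f I"
  shows "has_bochner_integral m (\<lambda>x. f (a + x)) I"
proof -
  have meas: "(+) a \<in> measurable m m"
    unfolding measurable_cong_sets[OF haar_sets haar_sets]
    by (intro borel_measurable_continuous_onI continuous_intros)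
  have f: "integrable m f" "integral\<^sup>L m f = I"
    using assms by (auto simp: has_bochner_integral_iff)
  then have "integrable (distr m m ((+) a)) f" "integral\<^sup>L (distr m m ((+) a)) f = I"
    by (simp_all add: distr_translation)
  then show ?thesis
    using f borel_measurable_integrable[OF f(1)]
    by (simp add: has_bochner_integral_iff integrable_distr_eq[OF meas] integral_distr[OF meas])
qed

text \<open>Finitely many translates of a nonempty open set cover any compact set. Were the open set
  null, all compact sets would be null, and inner regularity would make the whole measure
  vanish.\<close>

lemma haar_open_pos:
  assumes "open A" "A \<noteq> {}"
  shows "emeasure m A \<noteq> 0"
proof
  assume A0: "emeasure m A = 0"
  obtain a where a: "a \<in> A" using assms by blast
  have zero: "emeasure m C = 0" if C: "compact C" for C
  proof -
    obtain Y where Y: "finite Y" "C \<subseteq> (\<Union>y\<in>Y. (+) y ` A)"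
    proof (rule compactE_image[OF C])
      show "open ((+) y ` A)" for y using assms(1) by (rule open_translation_group)
      have "x \<in> (+) (x - a) ` A" for x
        using a by (intro image_eqI[of _ _ a]) auto
      then show "C \<subseteq> (\<Union>y\<in>UNIV. (+) y ` A)" by blast
    qed
    have S: "(+) y ` A \<in> sets m" for y
      using open_translation_group[OF assms(1)] by (simp add: haar_sets)
    have "emeasure m C \<le> emeasure m (\<Union>y\<in>Y. (+) y ` A)"
      using Y S by (intro emeasure_mono) auto
    also have "\<dots> \<le> (\<Sum>y\<in>Y. emeasure m ((+) y ` A))"
      using Y S by (intro emeasure_subadditive_finite) auto
    also have "\<dots> = 0"
    proof -
      have "emeasure m ((+) y ` A) = 0" for y
        using A0 by (simp add: haar_translate assms(1))
      then show ?thesis by simp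
    qed
    finally show ?thesis by simp
  qed
  have "emeasure m UNIV = (SUP C\<in>{C. compact C \<and> C \<subseteq> UNIV}. emeasure m C)"
    using haar open_UNIV unfolding haar_measure_def by blast
  also have "\<dots> \<le> 0"
    by (rule SUP_least) (simp add: zero)
  finally have "emeasure m UNIV \<le> 0" .
  then show False using haar by (simp add: haar_measure_def)
qed

text \<open>Approximation by compact sets from inside is available for open sets, so the compact set
  is reached in stages: a level set of finite measure carrying most of the integral, an open set of
  finite measure around it, and a compact subset of that open set.\<close>

lemma haar_integral_tail:
  fixes f :: "'x \<Rightarrow> complex"
  assumes f: "integrable m f" and e: "0 < e"
  obtains C where "compact C" "(\<integral>x. indicator (- C) x * cmod (f x) \<partial>m) < e"
proof -
  define h where "h x = cmod (f x)" for x
  have h: "integrable m h" "h \<in> borel_measurable m" "\<And>x. 0 \<le> h x"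
    using f by (auto simp: h_def[abs_def])
  \<comment> \<open>The lower bound makes the measure of the level set finite; the upper bound
    limits what a small part of it can contribute.\<close>
  define A where "A N = {x. 1 / (real N + 1) < h x \<and> h x \<le> real N}" for N :: nat
  have A: "A N \<in> sets m" for N
  proof -
    have "A N = {x \<in> space m. 1 / (real N + 1) < h x \<and> h x \<le> real N}"
      by (simp add: A_def haar_space)
    then show ?thesis using h(2) by simp
  qed
  have iA: "integrable m (\<lambda>x. indicator S x * h x)" if "S \<in> sets m" for S
    using integrable_mult_indicator[OF that h(1)] by simp
  have "(\<lambda>N. \<integral>x. indicator (- A N) x * h x \<partial>m) \<longlonglongrightarrow> (\<integral>x. 0 \<partial>m)"
  proof (rule integral_dominated_convergence[where w = h])
    have "(\<lambda>N. indicator (- A N) x * h x) \<longlonglongrightarrow> 0" for x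
    proof (cases "h x = 0")
      case False
      then have pos: "0 < h x" using h(3)[of x] by simp
      have "\<forall>\<^sub>F N in sequentially. h x \<le> real N"
        using filterlim_real_sequentially by (simp add: filterlim_at_top)
      moreover have "(\<lambda>N. 1 / (real N + 1)) \<longlonglongrightarrow> 0"
        using LIMSEQ_inverse_real_of_nat by (simp add: inverse_eq_divide add.commute)
      then have "\<forall>\<^sub>F N in sequentially. 1 / (real N + 1) < h x"
        using pos by (rule order_tendstoD(2))
      ultimately have "\<forall>\<^sub>F N in sequentially. indicator (- A N) x * h x = 0"
        by eventually_elim (simp add: A_def)
      then show ?thesis by (rule tendsto_eventually)
    qed simp
    then show "AE x in m. (\<lambda>N. indicator (- A N) x * h x) \<longlonglongrightarrow> 0" by simp
    show "AE x in m. norm (indicator (- A N) x * h x) \<le> h x" for N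
      using h(3) by (auto simp: indicator_def)
    have "- A N \<in> sets m" for N
      using sets.compl_sets[OF A[of N]] by (simp add: haar_space Compl_eq_Diff_UNIV)
    then show "(\<lambda>x. indicator (- A N) x * h x) \<in> borel_measurable m" for N
      using h(2) by (intro borel_measurable_times borel_measurable_indicator)
  qed (use h in auto)
  then have "\<forall>\<^sub>F N in sequentially. (\<integral>x. indicator (- A N) x * h x \<partial>m) < e / 2"
    using e by (intro order_tendstoD(2)) auto
  then obtain N where N: "(\<integral>x. indicator (- A N) x * h x \<partial>m) < e / 2"
    unfolding eventually_sequentially by blast
  have Afin: "emeasure m (A N) < \<infinity>"
  proof -
    have "emeasure m (A N) = (\<integral>\<^sup>+x. indicator (A N) x \<partial>m)"
      using A by simp
    also have "\<dots> \<le> (\<integral>\<^sup>+x. ennreal ((real N + 1) * h x) \<partial>m)"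
    proof (rule nn_integral_mono)
      fix x
      have "1 \<le> (real N + 1) * h x" if "x \<in> A N"
        using that by (simp add: A_def field_simps)
      then show "indicator (A N) x \<le> ennreal ((real N + 1) * h x)"
        by (simp add: indicator_def)
    qed
    also have "\<dots> < \<infinity>"
    proof -
      have "integrable m (\<lambda>x. (real N + 1) * h x)" using h(1) by simp
      then show ?thesis
        using h(3) by (subst nn_integral_eq_integral) auto
    qed
    finally show ?thesis .
  qed
  have "emeasure m (A N) = (INF U\<in>{U. open U \<and> A N \<subseteq> U}. emeasure m U)"
    using haar A[of N] haar_sets unfolding haar_measure_def by blast
  then obtain U where U: "open U" "A N \<subseteq> U" "emeasure m U < \<infinity>"
    using Afin by (auto simp: INF_less_iff)
  \<comment> \<open>On \<open>A N - C\<close> the integrand is at most \<open>N\<close>, so a defect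
    of measure below \<open>d\<close> costs at most \<open>e / 2\<close>; \<open>N + 1\<close>
    avoids division by zero.\<close>
  define d where "d = e / (2 * (real N + 1))"
  have d: "0 < d" using e by (simp add: d_def)
  have "\<exists>C. compact C \<and> C \<subseteq> U \<and> emeasure m U < emeasure m C + ennreal d"
  \<comment> \<open>Subtraction of \<open>d\<close> is truncated at \<open>0\<close>, so it lowers
    the measure of \<open>U\<close> strictly only if this measure is not zero.\<close>
  proof (cases "emeasure m U = 0")
    case True
    then show ?thesis using d by (intro exI[of _ "{}"]) auto
  next
    case False
    then have "emeasure m U - ennreal d < emeasure m U"
      using d U(3) by (intro ennreal_between) (auto simp: zero_less_iff_neq_zero)
    also have "emeasure m U = (SUP C\<in>{C. compact C \<and> C \<subseteq> U}. emeasure m C)"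
      using haar U(1) unfolding haar_measure_def by blast
    finally obtain C where C: "compact C" "C \<subseteq> U" "emeasure m U - ennreal d < emeasure m C"
      by (auto simp: less_SUP_iff)
    then show ?thesis
      using ennreal_le_minus_iff[of "emeasure m C" "emeasure m U" "ennreal d"]
      by (meson not_le)
  qed
  then obtain C where C: "compact C" "C \<subseteq> U" "emeasure m U < emeasure m C + ennreal d"
    by blast
  have Cs: "C \<in> sets m" "- C \<in> sets m" and Us: "U \<in> sets m"
    using compact_imp_closed[OF C(1)] U(1) by (auto simp: haar_sets)
  have Cfin: "emeasure m C < \<infinity>" by (rule haar_compact_finite[OF C(1)])
  have UC: "emeasure m (U - C) < \<infinity>"
    using emeasure_mono[of "U - C" U m] Us U(3) by (auto intro: le_less_trans)
  have "measure m (U - C) = measure m U - measure m C"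
    using Cs Us C(2) U(3) by (intro measure_Diff) auto
  moreover have "measure m U < measure m C + d"
  proof -
    have "ennreal (measure m U) < ennreal (measure m C + d)"
      using C(3) U(3) Cfin d by (simp add: emeasure_eq_ennreal_measure ennreal_plus less_top)
    then show ?thesis by (simp add: ennreal_less_iff)
  qed
  ultimately have mUC: "measure m (U - C) < d" by simp
  have UCs: "U - C \<in> sets m" and As: "- A N \<in> sets m"
    using Cs Us sets.compl_sets[OF A[of N]] by (auto simp: haar_space Compl_eq_Diff_UNIV)
  have iI: "integrable m (\<lambda>x. real N * indicator (U - C) x :: real)"
    using UCs UC by (intro integrable_mult_right) auto
  have "(\<integral>x. indicator (- C) x * h x \<partial>m) \<le> (\<integral>x. indicator (- A N) x * h x + real N * indicator (U - C) x \<partial>m)"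
  proof (rule integral_mono[OF iA[OF Cs(2)] Bochner_Integration.integrable_add[OF iA[OF As] iI]])
    fix x
    show "indicator (- C) x * h x \<le> indicator (- A N) x * h x + real N * indicator (U - C) x"
      using U(2) h(3)[of x] by (auto simp: indicator_def A_def)
  qed
  also have "\<dots> = (\<integral>x. indicator (- A N) x * h x \<partial>m) + real N * measure m (U - C)"
    using UCs by (subst Bochner_Integration.integral_add[OF iA[OF As] iI]) (simp add: haar_space)
  also have "\<dots> < e / 2 + e / 2"
  proof -
    have "real N * measure m (U - C) \<le> (real N + 1) * d"
      using mUC by (intro mult_mono) auto
    also have "\<dots> = e / 2" by (simp add: d_def field_simps)
    finally show ?thesis using N by simp
  qed
  finally show ?thesis
    using C(1) by (intro that) (simp_all add: h_def)
qed

end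

section \<open>Fourier transforms supported near the origin\<close>

text \<open>These are the functions whose operators generate
  \<open>multiplier_algebra\<close>.\<close>

definition test_function ::
    "'x::topological_ab_group_add measure \<Rightarrow> 'x dual measure \<Rightarrow> ('x \<Rightarrow> complex) \<Rightarrow> bool"
  where "test_function m n \<phi> \<longleftrightarrow> integrable m \<phi> \<and> integrable n (fourier m \<phi>) \<and>
    compact (closure {k. fourier m \<phi> k \<noteq> 0})"

text \<open>
  Translations of \<open>\<phi>\<close> multiply its transform by the evaluations \<open>k \<mapsto> k(x)\<close>, so trigonometric
  polynomials on the dual group are Fourier multipliers and no convolution on \<open>X\<close> is needed.
\<close>

definition fourier_multiplier :: "'x::topological_ab_group_add measure \<Rightarrow> ('x dual \<Rightarrow> complex) \<Rightarrow> bool"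
  where "fourier_multiplier m p \<longleftrightarrow>
    (\<forall>\<phi>. integrable m \<phi> \<longrightarrow> (\<exists>\<psi>. integrable m \<psi> \<and> (\<forall>k. fourier m \<psi> k = p k * fourier m \<phi> k)))"

lemma norm_integral_le:
  fixes f :: "'a \<Rightarrow> 'b::{banach, second_countable_topology}"
  assumes "integrable M f" "integrable M g" "\<And>x. norm (f x) \<le> g x"
  shows "norm (\<integral>x. f x \<partial>M) \<le> (\<integral>x. g x \<partial>M)"
  using integral_norm_bound[of M f] integral_mono[OF integrable_norm[OF assms(1)] assms(2,3)]
  by linarith

lemma compact_closure_subset:
  fixes A K :: "'a::t2_space set"
  assumes "A \<subseteq> K" "compact K"
  shows "compact (closure A)"
  using assms compact_imp_closed closure_minimal compact_Int_closed[of K "closure A"]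
  by (metis closed_closure inf.absorb2)

context
  fixes m :: "'x::{topological_ab_group_add, t2_space} measure"
  assumes haar: "haar_measure m"
begin

lemma integrable_char_mult:
  assumes "integrable m \<phi>"
  shows "integrable m (\<lambda>x. cnj (char_of k x) * \<phi> x)" "integrable m (\<lambda>x. char_of k x * \<phi> x)"
proof -
  have "char_of k \<in> borel_measurable m"
    by (rule haar_measurable[OF haar continuous_on_char])
  moreover have "(\<lambda>x. cnj (char_of k x)) \<in> borel_measurable m"
    by (intro haar_measurable[OF haar] continuous_on_cnj continuous_on_char)
  ultimately have "(\<lambda>x. cnj (char_of k x) * \<phi> x) \<in> borel_measurable m" "(\<lambda>x. char_of k x * \<phi> x) \<in> borel_measurable m"
    using borel_measurable_integrable[OF assms] by (simp_all add: borel_measurable_times)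
  then show "integrable m (\<lambda>x. cnj (char_of k x) * \<phi> x)" "integrable m (\<lambda>x. char_of k x * \<phi> x)"
    by (auto intro!: Bochner_Integration.integrable_bound[OF assms] simp: norm_mult)
qed

text \<open>The difference of the integrands has modulus
  \<open>cmod (char_of k x - 1) * cmod (\<phi> x)\<close>. This does not involve \<open>l\<close>,
  so the estimate is uniform in \<open>l\<close>; off \<open>C\<close> the first factor is at most
  \<open>2\<close>.\<close>

lemma fourier_diff_le:
  assumes \<phi>: "integrable m \<phi>" and C: "compact C" and d: "0 \<le> d"
    and near: "\<And>x. x \<in> C \<Longrightarrow> cmod (char_of k x - 1) \<le> d"
  shows "cmod (fourier m \<phi> (l + k) - fourier m \<phi> l)
    \<le> d * (\<integral>x. cmod (\<phi> x) \<partial>m) + 2 * (\<integral>x. indicator (- C) x * cmod (\<phi> x) \<partial>m)"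
proof -
  have "- C \<in> sets m"
    using compact_imp_closed[OF C] by (simp add: haar_sets[OF haar])
  then have i: "integrable m (\<lambda>x. indicator (- C) x * cmod (\<phi> x))"
    using integrable_mult_indicator[of "- C" m "\<lambda>x. cmod (\<phi> x)"] \<phi> by simp
  have "fourier m \<phi> (l + k) - fourier m \<phi> l
      = (\<integral>x. cnj (char_of (l + k) x) * \<phi> x - cnj (char_of l x) * \<phi> x \<partial>m)"
    unfolding fourier_def
    by (rule Bochner_Integration.integral_diff[symmetric]) (intro integrable_char_mult \<phi>)+
  also have "cmod \<dots> \<le> (\<integral>x. d * cmod (\<phi> x) + 2 * (indicator (- C) x * cmod (\<phi> x)) \<partial>m)"
  proof (rule norm_integral_le)
    show "integrable m (\<lambda>x. d * cmod (\<phi> x) + 2 * (indicator (- C) x * cmod (\<phi> x)))"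
      using \<phi> i by simp
    fix x
    have "cnj (char_of (l + k) x) * \<phi> x - cnj (char_of l x) * \<phi> x
        = cnj (char_of l x) * cnj (char_of k x - 1) * \<phi> x"
      by (simp add: plus_dual.rep_eq algebra_simps)
    then have "cmod (cnj (char_of (l + k) x) * \<phi> x - cnj (char_of l x) * \<phi> x)
        = cmod (char_of k x - 1) * cmod (\<phi> x)"
      by (simp only: norm_mult complex_mod_cnj cmod_char mult_1_left)
    also have "cmod (char_of k x - 1) \<le> d + 2 * indicator (- C) x"
    proof (cases "x \<in> C")
      case False
      have "cmod (char_of k x - 1) \<le> 2"
        using norm_triangle_ineq4[of "char_of k x" 1] by simp
      with False d show ?thesis by simp
    qed (simp add: near)
    finally show "norm (cnj (char_of (l + k) x) * \<phi> x - cnj (char_of l x) * \<phi> x)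
        \<le> d * cmod (\<phi> x) + 2 * (indicator (- C) x * cmod (\<phi> x))"
      by (simp add: algebra_simps mult_right_mono)
  qed (intro Bochner_Integration.integrable_diff integrable_char_mult \<phi>)
  also have "\<dots> = d * (\<integral>x. cmod (\<phi> x) \<partial>m) + 2 * (\<integral>x. indicator (- C) x * cmod (\<phi> x) \<partial>m)"
    using \<phi> i by simp
  finally show ?thesis .
qed

text \<open>Uniformity in \<open>l\<close> serves the norm continuity of multipliers, where a symbol
  and its translate must be close everywhere at once. Outside a compact set \<open>\<phi>\<close>
  has a small integral, and on that set all \<open>k\<close> near \<open>0\<close> have values near
  \<open>1\<close>.\<close>

lemma fourier_uniformly_continuous:
  assumes \<phi>: "integrable m \<phi>" and e: "0 < e"
  shows "\<forall>\<^sub>F k in nhds 0. \<forall>l. cmod (fourier m \<phi> (l + k) - fourier m \<phi> l) < e"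
proof -
  have "0 < e / 4" using e by simp
  then obtain C where C: "compact C" "(\<integral>x. indicator (- C) x * cmod (\<phi> x) \<partial>m) < e / 4"
    using haar_integral_tail[OF haar \<phi>] by blast
  define A where "A = (\<integral>x. cmod (\<phi> x) \<partial>m)"
  have A: "0 \<le> A" by (simp add: A_def)
  \<comment> \<open>The compact set uses half of \<open>e\<close>, and twice a tail below
    \<open>e / 4\<close> stays below the other half; the \<open>1\<close> covers
    \<open>A = 0\<close>.\<close>
  define d where "d = e / (2 * (A + 1))"
  have d: "0 < d" "d * A \<le> e / 2"
    using e A by (auto simp: d_def field_simps)
  have "\<forall>\<^sub>F k in nhds 0. \<forall>x\<in>C. cmod (char_of k x - char_of 0 x) < d"
    by (rule eventually_nhds_dual_near[OF C(1) d(1)])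
  then show ?thesis
  proof (rule eventually_mono, intro allI)
    fix k l :: "'x dual" assume k: "\<forall>x\<in>C. cmod (char_of k x - char_of 0 x) < d"
    have "cmod (fourier m \<phi> (l + k) - fourier m \<phi> l)
        \<le> d * A + 2 * (\<integral>x. indicator (- C) x * cmod (\<phi> x) \<partial>m)"
      unfolding A_def using k d by (intro fourier_diff_le \<phi> C) (auto simp: zero_dual.rep_eq intro: less_imp_le)
    then show "cmod (fourier m \<phi> (l + k) - fourier m \<phi> l) < e"
      using C(2) d(2) by linarith
  qed
qed

lemma continuous_on_fourier:
  assumes \<phi>: "integrable m \<phi>"
  shows "continuous_on UNIV (fourier m \<phi>)"
proof -
  have "(fourier m \<phi> \<longlongrightarrow> fourier m \<phi> l) (nhds l)" for l
    unfolding tendsto_iff dist_norm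
  proof (intro allI impI)
    fix e :: real assume "0 < e"
    then have "\<forall>\<^sub>F k in nhds 0. \<forall>l. cmod (fourier m \<phi> (l + k) - fourier m \<phi> l) < e"
      by (rule fourier_uniformly_continuous[OF \<phi>])
    moreover have "((\<lambda>k. k - l) \<longlongrightarrow> l - l) (nhds l)"
      by (intro tendsto_intros filterlim_ident)
    then have "filterlim (\<lambda>k. k - l) (nhds 0) (nhds l)" by simp
    ultimately have "\<forall>\<^sub>F k in nhds l. \<forall>l'. cmod (fourier m \<phi> (l' + (k - l)) - fourier m \<phi> l') < e"
      by (rule eventually_compose_filterlim)
    then show "\<forall>\<^sub>F k in nhds l. cmod (fourier m \<phi> k - fourier m \<phi> l) < e"
      by (rule eventually_mono) (metis add.commute diff_add_cancel)
  qed
  then show ?thesis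
    unfolding continuous_on_def at_within_def by (blast intro: tendsto_mono[OF inf_le1])
qed

section \<open>Multipliers of Fourier transforms and trigonometric polynomials with a peak at the
  origin\<close>

lemma fourier_char_mult: "fourier m (\<lambda>x. char_of l x * \<phi> x) k = fourier m \<phi> (k - l)"
  unfolding fourier_def
  by (rule Bochner_Integration.integral_cong) (simp_all add: minus_dual.rep_eq mult_ac)

lemma fourier_multiplier_const: "fourier_multiplier m (\<lambda>_. c)"
  unfolding fourier_multiplier_def
proof (intro allI impI)
  fix \<phi> :: "'x \<Rightarrow> complex" assume "integrable m \<phi>"
  then show "\<exists>\<psi>. integrable m \<psi> \<and> (\<forall>k. fourier m \<psi> k = c * fourier m \<phi> k)"
    by (intro exI[of _ "\<lambda>x. c * \<phi> x"]) (simp add: fourier_def mult.left_commute[of _ c])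
qed

lemma fourier_multiplier_add:
  assumes "fourier_multiplier m p" "fourier_multiplier m q"
  shows "fourier_multiplier m (\<lambda>k. p k + q k)"
  unfolding fourier_multiplier_def
proof (intro allI impI)
  fix \<phi> :: "'x \<Rightarrow> complex" assume "integrable m \<phi>"
  with assms obtain \<psi>1 \<psi>2 where "integrable m \<psi>1" "\<And>k. fourier m \<psi>1 k = p k * fourier m \<phi> k"
    "integrable m \<psi>2" "\<And>k. fourier m \<psi>2 k = q k * fourier m \<phi> k"
    unfolding fourier_multiplier_def by blast
  moreover from this have "fourier m (\<lambda>x. \<psi>1 x + \<psi>2 x) k = fourier m \<psi>1 k + fourier m \<psi>2 k" for k
    unfolding fourier_def distrib_left by (intro Bochner_Integration.integral_add integrable_char_mult)
  ultimately show "\<exists>\<psi>. integrable m \<psi> \<and> (\<forall>k. fourier m \<psi> k = (p k + q k) * fourier m \<phi> k)"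
    by (intro exI[of _ "\<lambda>x. \<psi>1 x + \<psi>2 x"]) (simp add: distrib_right)
qed

lemma fourier_multiplier_mult:
  assumes "fourier_multiplier m p" "fourier_multiplier m q"
  shows "fourier_multiplier m (\<lambda>k. p k * q k)"
  unfolding fourier_multiplier_def
proof (intro allI impI)
  fix \<phi> :: "'x \<Rightarrow> complex" assume "integrable m \<phi>"
  with assms obtain \<psi>1 \<psi>2 where "integrable m \<psi>1" "\<And>k. fourier m \<psi>1 k = q k * fourier m \<phi> k"
    "integrable m \<psi>2" "\<And>k. fourier m \<psi>2 k = p k * fourier m \<psi>1 k"
    unfolding fourier_multiplier_def by metis
  then show "\<exists>\<psi>. integrable m \<psi> \<and> (\<forall>k. fourier m \<psi> k = p k * q k * fourier m \<phi> k)"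
    by (intro exI[of _ \<psi>2]) simp
qed

lemma fourier_multiplier_power:
  assumes "fourier_multiplier m p"
  shows "fourier_multiplier m (\<lambda>k. p k ^ N)"
proof (induction N)
  case 0
  show ?case using fourier_multiplier_const[of 1] by simp
next
  case (Suc N)
  show ?case using fourier_multiplier_mult[OF assms Suc] by simp
qed

lemma fourier_multiplier_char: "fourier_multiplier m (\<lambda>k. char_of k y)"
  unfolding fourier_multiplier_def
proof (intro allI impI)
  fix \<phi> :: "'x \<Rightarrow> complex" assume \<phi>: "integrable m \<phi>"
  have "integrable m (\<lambda>x. \<phi> (y + x))"
    using has_bochner_integral_translation[OF haar has_bochner_integral_integrable[OF \<phi>]]
    by (auto simp: has_bochner_integral_iff)
  moreover have "fourier m (\<lambda>x. \<phi> (y + x)) k = char_of k y * fourier m \<phi> k" for k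
  proof -
    have "has_bochner_integral m (\<lambda>x. cnj (char_of k x) * \<phi> x) (fourier m \<phi> k)"
      unfolding fourier_def using integrable_char_mult(1)[OF \<phi>] by (rule has_bochner_integral_integrable)
    from has_bochner_integral_translation[OF haar this, of y]
    have "(\<integral>x. cnj (char_of k (y + x)) * \<phi> (y + x) \<partial>m) = fourier m \<phi> k"
      by (rule has_bochner_integral_integral_eq)
    then have "cnj (char_of k y) * fourier m (\<lambda>x. \<phi> (y + x)) k = fourier m \<phi> k"
      unfolding fourier_def by (simp add: char_add mult.assoc)
    then have "char_of k y * cnj (char_of k y) * fourier m (\<lambda>x. \<phi> (y + x)) k = char_of k y * fourier m \<phi> k"
      by (simp add: mult.assoc)
    moreover have "char_of k y * cnj (char_of k y) = 1"
      using complex_norm_square[of "char_of k y"] by simp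
    ultimately show ?thesis by simp
  qed
  ultimately show "\<exists>\<psi>. integrable m \<psi> \<and> (\<forall>k. fourier m \<psi> k = char_of k y * fourier m \<phi> k)"
    by blast
qed

text \<open>For one \<open>y\<close> the function \<open>(1 + Re (char_of k y)) / 2\<close> has
  values in the unit interval, is \<open>1\<close> at the origin, and is smaller wherever
  \<open>char_of k y \<noteq> 1\<close>. Some \<open>y\<close> detects each nonzero
  \<open>k\<close>; by compactness finitely many detect all of \<open>L\<close>, and the product of
  their functions is below \<open>1\<close> there.\<close>

lemma fourier_multiplier_peak:
  fixes L :: "'x dual set"
  assumes L: "compact L" "0 \<notin> L"
  obtains q s where "continuous_on UNIV q" "fourier_multiplier m (\<lambda>k. complex_of_real (q k))"
    "\<And>k. 0 \<le> q k" "\<And>k. q k \<le> 1" "q 0 = 1" "0 < s" "s < 1" "\<And>k. k \<in> L \<Longrightarrow> q k \<le> s"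
proof -
  define good where "good q \<longleftrightarrow> continuous_on UNIV q \<and> fourier_multiplier m (\<lambda>k. complex_of_real (q k)) \<and>
    (\<forall>k. 0 \<le> q k \<and> q k \<le> 1) \<and> q 0 = 1" for q :: "'x dual \<Rightarrow> real"
  define p where "p y k = (1 + Re (char_of k y)) / 2" for y and k :: "'x dual"
  have cp: "continuous_on UNIV (p y)" for y
    unfolding p_def by (intro continuous_intros continuous_on_char_eval) simp
  have range: "0 \<le> p y k" "p y k \<le> 1" for y k
    using abs_Re_le_cmod[of "char_of k y"] by (auto simp: p_def)
  have good_p: "good (p y)" for y
  proof -
    \<comment> \<open>The real part of a character value is the mean of the values at
      \<open>y\<close> and \<open>- y\<close>.\<close>
    have "(\<lambda>k. complex_of_real (p y k)) = (\<lambda>k. 1/2 + (1/4) * (char_of k y + char_of k (- y)))"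
      by (rule ext) (simp add: p_def char_minus complex_add_cnj)
    moreover have "fourier_multiplier m (\<lambda>k. 1/2 + (1/4) * (char_of k y + char_of k (- y)))"
      by (intro fourier_multiplier_add fourier_multiplier_mult fourier_multiplier_const fourier_multiplier_char)
    ultimately show ?thesis
      using cp range by (simp add: good_def p_def zero_dual.rep_eq)
  qed
  have p_less: "p y k < 1" if "char_of k y \<noteq> 1" for y k
  proof -
    have "Re (char_of k y) \<noteq> 1"
    proof
      assume 1: "Re (char_of k y) = 1"
      have "(Re (char_of k y))\<^sup>2 + (Im (char_of k y))\<^sup>2 = 1"
        using cmod_power2[of "char_of k y"] by simp
      with 1 have "Im (char_of k y) = 0" by simp
      with 1 that show False by (simp add: complex_eq_iff)
    qed
    with range(2)[of y k] show ?thesis by (simp add: p_def)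
  qed
  obtain Y where Y: "finite Y" "L \<subseteq> (\<Union>y\<in>Y. {k. p y k < 1})"
  proof (rule compactE_image[OF L(1)])
    show "open {k. p y k < 1}" for y
      by (intro open_Collect_less cp continuous_on_const)
    show "L \<subseteq> (\<Union>y\<in>UNIV. {k. p y k < 1})"
    proof
      fix k assume "k \<in> L"
      with L(2) have "k \<noteq> 0" by blast
      then obtain y where "char_of k y \<noteq> char_of 0 y" by (metis char_of_inject ext)
      then show "k \<in> (\<Union>y\<in>UNIV. {k. p y k < 1})" using p_less by (auto simp: zero_dual.rep_eq)
    qed
  qed
  from Y(1) have "\<exists>q. good q \<and> (\<forall>k. (\<exists>y\<in>Y. p y k < 1) \<longrightarrow> q k < 1)"
  proof (induction Y rule: finite_induct)
    case empty
    have "good (\<lambda>_. 1)" using fourier_multiplier_const[of 1] by (simp add: good_def)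
    then show ?case by blast
  next
    case (insert y Y)
    then obtain q where q: "good q" "\<And>k. (\<exists>y\<in>Y. p y k < 1) \<Longrightarrow> q k < 1" by blast
    have gq: "0 \<le> q k" "q k \<le> 1" for k using q(1) by (auto simp: good_def)
    have "good (\<lambda>k. p y k * q k)"
      using q(1) good_p[of y] fourier_multiplier_mult[of "\<lambda>k. complex_of_real (p y k)" "\<lambda>k. complex_of_real (q k)"]
      by (auto simp: good_def intro!: continuous_intros mult_le_one)
    moreover have "p y k * q k \<le> p y k" "p y k * q k \<le> q k" for k
      using gq[of k] range[of y k] by (simp_all add: mult_left_le mult_left_le_one_le)
    then have "p y k * q k < 1" if "\<exists>y'\<in>insert y Y. p y' k < 1" for k
      using that q(2)[of k] by (metis insert_iff le_less_trans)
    ultimately show ?case by blast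
  qed
  then obtain q where q: "good q" "\<And>k. k \<in> L \<Longrightarrow> q k < 1" using Y(2) by blast
  have "\<exists>s. 0 < s \<and> s < 1 \<and> (\<forall>k\<in>L. q k \<le> s)"
  proof (cases "L = {}")
    case True
    then show ?thesis by (intro exI[of _ "1/2"]) simp
  next
    case False
    have "continuous_on L q" using q(1) continuous_on_subset by (auto simp: good_def)
    then obtain k0 where "k0 \<in> L" "\<forall>k\<in>L. q k \<le> q k0"
      using continuous_attains_sup[OF L(1) False] by blast
    then show ?thesis
      \<comment> \<open>The second entry of the maximum keeps \<open>s\<close> positive even if
        \<open>q\<close> vanishes on \<open>L\<close>.\<close>
      using q by (intro exI[of _ "max (q k0) (1/2)"]) (auto simp: max_def intro: order_trans)
  qed
  then show ?thesis using that q(1) unfolding good_def by blast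
qed

end

text \<open>Multiplying a function by a character translates its transform, so a nonzero value can
  be moved to the origin and scaled to \<open>1\<close>.\<close>

lemma test_function_normalized:
  fixes m :: "'x::{topological_ab_group_add, t2_space} measure"
  assumes haar: "haar_measure m" "haar_measure n"
    and \<phi>: "test_function m n \<phi>" and nz: "fourier m \<phi> k0 \<noteq> 0"
  obtains \<psi> where "test_function m n \<psi>" "fourier m \<psi> 0 = 1"
proof -
  define \<psi> where "\<psi> x = char_of (- k0) x * (inverse (fourier m \<phi> k0) * \<phi> x)" for x
  have F: "fourier m \<psi> k = inverse (fourier m \<phi> k0) * fourier m \<phi> (k0 + k)" for k
  proof -
    have "fourier m \<psi> k = fourier m (\<lambda>x. inverse (fourier m \<phi> k0) * \<phi> x) (k - (- k0))"
      unfolding \<psi>_def by (rule fourier_char_mult[OF haar(1)])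
    also have "\<dots> = inverse (fourier m \<phi> k0) * fourier m \<phi> (k0 + k)"
      by (simp add: fourier_def mult.left_commute[of _ "inverse _"] add.commute)
    finally show ?thesis .
  qed
  have i: "integrable m \<phi>" "integrable n (fourier m \<phi>)" "compact (closure {k. fourier m \<phi> k \<noteq> 0})"
    using \<phi> by (auto simp: test_function_def)
  have "integrable m \<psi>"
    unfolding \<psi>_def using i(1) by (intro integrable_char_mult haar) simp
  moreover have "integrable n (\<lambda>k. fourier m \<phi> (k0 + k))"
    using has_bochner_integral_translation[OF haar(2) has_bochner_integral_integrable[OF i(2)]]
    by (auto simp: has_bochner_integral_iff)
  then have "integrable n (fourier m \<psi>)" unfolding F[abs_def] by simp
  moreover have "compact (closure {k. fourier m \<psi> k \<noteq> 0})"
  proof (rule compact_closure_subset)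
    show "compact ((+) (- k0) ` closure {k. fourier m \<phi> k \<noteq> 0})"
      by (rule compact_translation_group[OF i(3)])
    have "k \<in> (+) (- k0) ` closure {k. fourier m \<phi> k \<noteq> 0}" if "fourier m \<psi> k \<noteq> 0" for k
      using that closure_subset[of "{k. fourier m \<phi> k \<noteq> 0}"]
      by (intro image_eqI[of _ _ "k0 + k"]) (auto simp: F)
    then show "{k. fourier m \<psi> k \<noteq> 0} \<subseteq> (+) (- k0) ` closure {k. fourier m \<phi> k \<noteq> 0}" by blast
  qed
  ultimately have "test_function m n \<psi>" by (simp add: test_function_def)
  moreover have "fourier m \<psi> 0 = 1" using nz by (simp add: F)
  ultimately show ?thesis by (rule that)
qed

text \<open>
  The powers \<open>q\<^sup>N\<close> of a trigonometric polynomial peaking at \<open>0\<close> concentrate the mass of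
  \<open>q\<^sup>N * fourier m \<phi>\<close> near \<open>0\<close>, while its support stays inside that of \<open>fourier m \<phi>\<close>.
\<close>

lemma approximate_unit:
  fixes m :: "'x::{topological_ab_group_add, t2_space} measure"
  assumes haar: "haar_measure m" "haar_measure n"
    and \<phi>: "test_function m n \<phi>" "fourier m \<phi> 0 = 1"
    and W: "\<forall>\<^sub>F k in nhds 0. k \<in> W" and e: "0 < e"
  obtains \<psi> where "test_function m n \<psi>" "\<And>k. fourier m \<phi> k = 0 \<Longrightarrow> fourier m \<psi> k = 0"
    "(\<integral>k. fourier m \<psi> k \<partial>n) = 1" "(\<integral>k. cmod (fourier m \<psi> k) \<partial>n) \<le> 5"
    "(\<integral>k. (if k \<in> W then 0 else cmod (fourier m \<psi> k)) \<partial>n) \<le> e"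
proof -
  define f where "f = fourier m \<phi>"
  define K where "K = closure {k. f k \<noteq> 0}"
  have \<phi>i: "integrable m \<phi>" and fi: "integrable n f" and K: "compact K"
    using \<phi>(1) by (auto simp: test_function_def f_def K_def)
  have f0: "f 0 = 1" using \<phi>(2) by (simp add: f_def)
  have fc: "continuous_on UNIV f" unfolding f_def by (rule continuous_on_fourier[OF haar(1) \<phi>i])
  have inK: "k \<in> K" if "f k \<noteq> 0" for k
    using that subsetD[OF closure_subset, of k "{k. f k \<noteq> 0}"] by (simp add: K_def)
  obtain W0 where W0: "open W0" "0 \<in> W0" "W0 \<subseteq> W"
    using W unfolding eventually_nhds by blast
  \<comment> \<open>On this set \<open>f\<close> is so near \<open>1\<close> that its real part
    controls its modulus, which excludes cancellation in integrals over it.\<close>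
  define W1 where "W1 = W0 \<inter> {k. cmod (f k - 1) < 1/2}"
  have "open {k. cmod (f k - 1) < 1/2}"
    by (intro open_Collect_less continuous_intros fc)
  then have W1: "open W1" "0 \<in> W1" "W1 \<subseteq> W"
    using W0 f0 by (auto simp: W1_def)
  define L where "L = K - W1"
  have L: "compact L" "0 \<notin> L"
    using K W1 by (auto simp: L_def compact_diff)
  obtain q s where q: "continuous_on UNIV q" "fourier_multiplier m (\<lambda>k. complex_of_real (q k))"
    "\<And>k. 0 \<le> q k" "\<And>k. q k \<le> 1" "q 0 = 1" and s: "0 < s" "s < 1" "\<And>k. k \<in> L \<Longrightarrow> q k \<le> s"
    using fourier_multiplier_peak[OF haar(1) L] by blast
  define t where "t = (1 + s) / 2"
  \<comment> \<open>The level \<open>t\<close> separates \<open>s\<close> from \<open>1\<close>: the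
    mass near the origin is at least of order \<open>t ^ N\<close>, the mass off \<open>W1\<close>
    at most of order \<open>s ^ N\<close>, and \<open>(s / t) ^ N\<close> tends to
    \<open>0\<close>.\<close>
  have t: "0 < t" "s < t" "t < 1" using s by (auto simp: t_def)
  define O1 where "O1 = W1 \<inter> {k. t < q k}"
  have "open {k. t < q k}"
    by (intro open_Collect_less continuous_intros q)
  then have O1: "open O1" "0 \<in> O1"
    using W1 q t by (auto simp: O1_def)
  have f_half: "1/2 \<le> Re (f k)" "cmod (f k) \<le> 3 * Re (f k)" "1/2 \<le> cmod (f k)" if "k \<in> W1" for k
  proof -
    have n: "cmod (f k - 1) < 1/2" using that by (simp add: W1_def)
    then have "\<bar>Re (f k) - 1\<bar> < 1/2" using abs_Re_le_cmod[of "f k - 1"] by simp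
    then show R: "1/2 \<le> Re (f k)" by linarith
    have "cmod (f k) \<le> cmod (f k - 1) + 1" using norm_triangle_ineq[of "f k - 1" 1] by simp
    then show "cmod (f k) \<le> 3 * Re (f k)" using n R by linarith
    show "1/2 \<le> cmod (f k)" using R complex_Re_le_cmod[of "f k"] by linarith
  qed
  have "O1 \<subseteq> K"
  proof
    fix k assume "k \<in> O1"
    then have "f k \<noteq> 0" using f_half(1)[of k] by (auto simp: O1_def)
    then show "k \<in> K" by (rule inK)
  qed
  then have "emeasure n O1 \<le> emeasure n K"
    using compact_imp_closed[OF K] by (intro emeasure_mono) (auto simp: haar_sets[OF haar(2)])
  then have finO: "emeasure n O1 < \<infinity>"
    using haar_compact_finite[OF haar(2) K] by (rule le_less_trans)
  define \<mu> where "\<mu> = measure n O1"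
  have \<mu>: "0 < \<mu>"
    using finO haar_open_pos[OF haar(2) O1(1)] O1(2) unfolding \<mu>_def
    by (auto simp: measure_def enn2real_positive_iff zero_less_iff_neq_zero)
  have meas: "O1 \<in> sets n" "W1 \<in> sets n" "- W1 \<in> sets n"
    using O1(1) W1(1) by (auto simp: haar_sets[OF haar(2)])
  have qm: "q \<in> borel_measurable n" by (rule haar_measurable[OF haar(2) q(1)])
  have fm: "f \<in> borel_measurable n" using fi by (rule borel_measurable_integrable)
  have q01: "q k ^ N \<le> 1" for k N using q by (simp add: power_le_one)
  define h where "h N k = f k * complex_of_real (q k ^ N)" for N k
  have ch: "cmod (h N k) = cmod (f k) * q k ^ N" for N k
    using q(3) by (simp add: h_def norm_mult norm_power)
  have hi: "integrable n (h N)" for N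
  proof (rule Bochner_Integration.integrable_bound[OF fi])
    show "h N \<in> borel_measurable n"
      unfolding h_def[abs_def] using fm qm by measurable
    show "AE k in n. norm (h N k) \<le> norm (f k)"
      using q01 by (auto simp: ch mult_left_le)
  qed
  have hiS: "integrable n (\<lambda>k. indicator S k *\<^sub>R h N k)" if "S \<in> sets n" for S N
    using that hi by (rule integrable_mult_indicator)
  have hiS': "integrable n (\<lambda>k. indicator S k * cmod (h N k))" if "S \<in> sets n" for S N
    using integrable_mult_indicator[OF that integrable_norm[OF hi]] by simp
  define A where "A = (\<integral>k. cmod (f k) \<partial>n)"
  have A: "0 \<le> A" by (simp add: A_def)
  define J where "J N = (\<integral>k. indicator W1 k * cmod (h N k) \<partial>n)" for N
  define T where "T N = (\<integral>k. indicator (- W1) k * cmod (h N k) \<partial>n)" for N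
  have J: "t ^ N * \<mu> / 2 \<le> J N" for N
  proof -
    have "t ^ N * \<mu> / 2 = (\<integral>k. (t ^ N / 2) * indicator O1 k \<partial>n)"
      using meas(1) by (simp add: \<mu>_def haar_space[OF haar(2)])
    also have "\<dots> \<le> J N"
      unfolding J_def
    proof (rule integral_mono)
      show "integrable n (\<lambda>k. (t ^ N / 2) * indicator O1 k :: real)"
        using meas(1) finO by (intro integrable_mult_right) auto
      show "integrable n (\<lambda>k. indicator W1 k * cmod (h N k))" by (rule hiS'[OF meas(2)])
      fix k
      have "t ^ N / 2 \<le> cmod (f k) * q k ^ N" if k: "k \<in> O1"
      proof -
        have "t ^ N \<le> q k ^ N" using k t by (intro power_mono) (auto simp: O1_def)
        then have "(1/2) * t ^ N \<le> cmod (f k) * q k ^ N"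
          using k f_half(3)[of k] t by (intro mult_mono) (auto simp: O1_def)
        then show ?thesis by simp
      qed
      then show "(t ^ N / 2) * indicator O1 k \<le> indicator W1 k * cmod (h N k)"
        by (auto simp: indicator_def ch O1_def q(3))
    qed
    finally show ?thesis .
  qed
  have T: "T N \<le> s ^ N * A" for N
  proof -
    have "T N \<le> (\<integral>k. s ^ N * cmod (f k) \<partial>n)"
      unfolding T_def
    proof (rule integral_mono[OF hiS'[OF meas(3)]])
      show "integrable n (\<lambda>k. s ^ N * cmod (f k))" using fi by simp
      fix k
      have "cmod (f k) * q k ^ N \<le> s ^ N * cmod (f k)" if "k \<notin> W1"
      proof (cases "f k = 0")
        case False
        then have "q k \<le> s" using that inK by (intro s) (simp add: L_def)
        then have "q k ^ N \<le> s ^ N" using q(3) by (intro power_mono)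
        then show ?thesis using mult_left_mono[of "q k ^ N" "s ^ N" "cmod (f k)"] by (simp add: mult.commute)
      qed simp
      then show "indicator (- W1) k * cmod (h N k) \<le> s ^ N * cmod (f k)"
        using s by (auto simp: indicator_def ch)
    qed
    then show ?thesis using fi by (simp add: A_def)
  qed
  \<comment> \<open>Here \<open>1/12\<close> is \<open>1/3 - 1/4\<close>: the estimate
    \<open>cmod c \<ge> J N / 3 - T N\<close> then leaves \<open>J N / 4\<close>. It follows that
    \<open>J N + T N\<close> is at most \<open>(13/12) * 4 * cmod c\<close>, below
    \<open>5 * cmod c\<close>, and the entry \<open>e/4\<close> gives
    \<open>T N \<le> e * cmod c\<close>.\<close>
  define \<tau> where "\<tau> = min (1/12) (e/4)"
  have \<tau>: "0 < \<tau>" "\<tau> \<le> 1/12" "\<tau> \<le> e/4" using e by (auto simp: \<tau>_def)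
  have "(\<lambda>N. A * (s / t) ^ N) \<longlonglongrightarrow> A * 0"
    using s t by (intro tendsto_intros LIMSEQ_power_zero) auto
  then have "\<forall>\<^sub>F N in sequentially. A * (s / t) ^ N < \<tau> * \<mu> / 2"
    using \<tau>(1) \<mu> by (intro order_tendstoD(2)) auto
  then obtain N where "A * (s / t) ^ N < \<tau> * \<mu> / 2"
    unfolding eventually_sequentially by blast
  then have "s ^ N * A \<le> \<tau> * (t ^ N * \<mu> / 2)"
    using t(1) by (simp add: power_divide field_simps)
  also have "\<dots> \<le> \<tau> * J N" using J \<tau> by (intro mult_left_mono) auto
  finally have TJ: "T N \<le> \<tau> * J N" using T[of N] by linarith
  have J0: "0 < J N" using J[of N] t(1) \<mu> by (smt (verit) divide_pos_pos mult_pos_pos zero_less_power)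
  \<comment> \<open>Division by \<open>c\<close> normalizes the integral. Bounding
    \<open>cmod c\<close> below by a fixed fraction of \<open>J N\<close> keeps the
    \<open>L\<^sup>1\<close> norm bounded after the division.\<close>
  define c where "c = (\<integral>k. h N k \<partial>n)"
  have c: "J N / 4 \<le> cmod c"
  proof -
    have split: "h N k = indicator W1 k *\<^sub>R h N k + indicator (- W1) k *\<^sub>R h N k" for k
      by (simp add: indicator_def)
    have "c = (\<integral>k. indicator W1 k *\<^sub>R h N k + indicator (- W1) k *\<^sub>R h N k \<partial>n)"
      unfolding c_def by (rule Bochner_Integration.integral_cong[OF refl split])
    also have "\<dots> = (\<integral>k. indicator W1 k *\<^sub>R h N k \<partial>n) + (\<integral>k. indicator (- W1) k *\<^sub>R h N k \<partial>n)"
      by (intro Bochner_Integration.integral_add hiS meas)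
    finally have c_eq: "c = (\<integral>k. indicator W1 k *\<^sub>R h N k \<partial>n) + (\<integral>k. indicator (- W1) k *\<^sub>R h N k \<partial>n)" .
    have "cmod (\<integral>k. indicator (- W1) k *\<^sub>R h N k \<partial>n) \<le> T N"
      using integral_norm_bound[of n "\<lambda>k. indicator (- W1) k *\<^sub>R h N k"] by (simp add: T_def)
    moreover have "J N / 3 \<le> Re (\<integral>k. indicator W1 k *\<^sub>R h N k \<partial>n)"
    proof -
      have "J N / 3 = (\<integral>k. indicator W1 k * cmod (h N k) / 3 \<partial>n)"
        by (simp add: J_def)
      also have "\<dots> \<le> (\<integral>k. Re (indicator W1 k *\<^sub>R h N k) \<partial>n)"
      proof (rule integral_mono)
        show "integrable n (\<lambda>k. indicator W1 k * cmod (h N k) / 3)"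
          using hiS'[OF meas(2)] by simp
        show "integrable n (\<lambda>k. Re (indicator W1 k *\<^sub>R h N k))"
          using hiS[OF meas(2)] by (rule integrable_Re)
        fix k
        have "cmod (f k) * q k ^ N \<le> 3 * (Re (f k) * q k ^ N)" if "k \<in> W1"
          using mult_right_mono[OF f_half(2)[OF that], of "q k ^ N"] q(3) by (simp add: mult.assoc)
        moreover have "Re (h N k) = Re (f k) * q k ^ N"
          by (simp add: h_def flip: of_real_power)
        ultimately show "indicator W1 k * cmod (h N k) / 3 \<le> Re (indicator W1 k *\<^sub>R h N k)"
          by (simp add: indicator_def ch mult.commute)
      qed
      also have "\<dots> = Re (\<integral>k. indicator W1 k *\<^sub>R h N k \<partial>n)"
        using hiS[OF meas(2)] by (rule integral_Re)
      finally show ?thesis .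
    qed
    moreover have "Re (\<integral>k. indicator W1 k *\<^sub>R h N k \<partial>n) \<le> cmod c + cmod (\<integral>k. indicator (- W1) k *\<^sub>R h N k \<partial>n)"
      using complex_Re_le_cmod[of "\<integral>k. indicator W1 k *\<^sub>R h N k \<partial>n"]
        norm_triangle_ineq4[of c "\<integral>k. indicator (- W1) k *\<^sub>R h N k \<partial>n"] c_eq by simp
    moreover have "\<tau> * J N \<le> (1/12) * J N" using \<tau>(2) J0 by (intro mult_right_mono) auto
    ultimately show ?thesis using TJ by linarith
  qed
  then have c0: "0 < cmod c" using J0 by linarith
  have "fourier_multiplier m (\<lambda>k. inverse c * complex_of_real (q k) ^ N)"
    by (intro fourier_multiplier_mult fourier_multiplier_const fourier_multiplier_power haar q)
  then obtain \<psi> where \<psi>: "integrable m \<psi>" "\<And>k. fourier m \<psi> k = inverse c * complex_of_real (q k) ^ N * f k"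
    unfolding fourier_multiplier_def f_def using \<phi>i by blast
  have F: "fourier m \<psi> = (\<lambda>k. inverse c * h N k)"
    by (rule ext) (simp add: \<psi>(2) h_def mult_ac)
  have cF: "cmod (fourier m \<psi> k) = cmod (h N k) / cmod c" for k
    by (simp add: F norm_mult norm_inverse divide_inverse mult.commute)
  have sum: "(\<integral>k. cmod (h N k) \<partial>n) = J N + T N"
    unfolding J_def T_def Bochner_Integration.integral_add[OF hiS'[OF meas(2)] hiS'[OF meas(3)], symmetric]
    by (rule Bochner_Integration.integral_cong) (simp_all add: indicator_def)
  show ?thesis
  proof (rule that)
    show z: "fourier m \<psi> k = 0" if "fourier m \<phi> k = 0" for k
      using that by (simp add: \<psi>(2) f_def)
    show "test_function m n \<psi>"
      unfolding test_function_def
    proof (intro conjI \<psi>(1))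
      show "integrable n (fourier m \<psi>)" unfolding F using hi by simp
      show "compact (closure {k. fourier m \<psi> k \<noteq> 0})"
      proof (rule compact_closure_subset[OF _ K])
        show "{k. fourier m \<psi> k \<noteq> 0} \<subseteq> K" using z inK by (auto simp: f_def)
      qed
    qed
    show "(\<integral>k. fourier m \<psi> k \<partial>n) = 1"
      unfolding F using c0 by (simp flip: c_def)
    have "J N + T N \<le> 5 * cmod c"
    proof -
      have "\<tau> * J N \<le> (1/12) * J N" using \<tau>(2) J0 by (intro mult_right_mono) auto
      then show ?thesis using TJ c c0 by linarith
    qed
    then show "(\<integral>k. cmod (fourier m \<psi> k) \<partial>n) \<le> 5"
      unfolding cF using c0 sum by (simp add: divide_le_eq)
    have "T N \<le> e * cmod c"
    proof -
      have "T N \<le> e / 4 * J N"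
        using TJ mult_right_mono[OF \<tau>(3) less_imp_le[OF J0]] by linarith
      also have "\<dots> \<le> e * cmod c" using mult_left_mono[OF c, of e] e by simp
      finally show ?thesis .
    qed
    \<comment> \<open>The set \<open>W\<close> may fail to be measurable. The integral of a
      non-integrable function is \<open>0\<close> by default, so a nonnegative integrable majorant
      bounds it in every case.\<close>
    have "(\<integral>k. (if k \<in> W then 0 else cmod (fourier m \<psi> k)) \<partial>n)
        \<le> (\<integral>k. indicator (- W1) k * cmod (h N k) / cmod c \<partial>n)"
    proof (rule integral_mono')
      show "integrable n (\<lambda>k. indicator (- W1) k * cmod (h N k) / cmod c)"
        using hiS'[OF meas(3)] by simp
    qed (use W1(3) c0 in \<open>auto simp: cF indicator_def\<close>)
    also have "\<dots> = T N / cmod c" by (simp add: T_def)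
    also have "\<dots> \<le> e" using c0 \<open>T N \<le> e * cmod c\<close> by (simp add: divide_le_eq)
    finally show "(\<integral>k. (if k \<in> W then 0 else cmod (fourier m \<psi> k)) \<partial>n) \<le> e" .
  qed
qed

section \<open>Operator integrals\<close>

text \<open>
  Strong continuity is replaced by weak continuity and local boundedness, which suffice for the
  operator integrals and are easier to obtain for the restricted representations.
\<close>

definition weak_module ::
    "('x::topological_ab_group_add dual \<Rightarrow> ('f::complex_hilbert \<Rightarrow>\<^sub>L 'f)) \<Rightarrow> bool"
  where "weak_module V \<longleftrightarrow> (\<forall>k. V k \<in> bops) \<and> V 0 = id_blinfun \<and>
    (\<forall>k l. V (k + l) = V k o\<^sub>L V l) \<and>
    (\<forall>C. compact C \<longrightarrow> bdd_above ((\<lambda>k. norm (V k)) ` C)) \<and>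
    (\<forall>u v. continuous_on UNIV (\<lambda>k. cinner v (V k u)))"

text \<open>By the Riesz representation the functionals in the definition of the operator integral
  are exactly the \<open>cinner_form v\<close>.\<close>

lemma has_operator_integral_cinner:
  fixes V :: "'x::topological_ab_group_add dual \<Rightarrow> ('f::complex_hilbert \<Rightarrow>\<^sub>L 'f)"
  shows "has_operator_integral n f V A \<longleftrightarrow> A \<in> bops \<and>
    (\<forall>u v. has_bochner_integral n (\<lambda>k. f k * cinner v (V k u)) (cinner v (A u)))"
    (is "?L \<longleftrightarrow> ?R")
proof
  assume ?L
  then show ?R
    unfolding has_operator_integral_def using cinner_form_bops by (metis (no_types, lifting) cinner_form_apply ext)
next
  assume R: ?R
  have "has_bochner_integral n (\<lambda>k. f k * l (V k u)) (l (A u))" if l: "l \<in> bops" for u and l :: "'f \<Rightarrow>\<^sub>L complex"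
  proof -
    obtain v where "l = cinner_form v" using riesz_representation[OF l] by blast
    then show ?thesis using R by simp
  qed
  then show ?L using R by (simp add: has_operator_integral_def)
qed

lemma multiplier_algebra_test:
  "multiplier_algebra m n V = closure {A. \<exists>\<phi>. test_function m n \<phi> \<and> has_operator_integral n (fourier m \<phi>) V A}"
  by (simp add: multiplier_algebra_def test_function_def conj_assoc)

lemma test_function_support:
  assumes "test_function m n \<phi>"
  obtains K where "compact K" "\<And>k. k \<notin> K \<Longrightarrow> fourier m \<phi> k = 0"
proof (rule that)
  show "compact (closure {k. fourier m \<phi> k \<noteq> 0})"
    using assms by (simp add: test_function_def)
  show "fourier m \<phi> k = 0" if "k \<notin> closure {k. fourier m \<phi> k \<noteq> 0}" for k
    using that subsetD[OF closure_subset, of k "{k. fourier m \<phi> k \<noteq> 0}"] by blast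
qed

text \<open>The bound for \<open>F\<close> is local to the support of \<open>f\<close> because the
  representations are bounded on compact sets only.\<close>

lemma integrable_mult_continuous:
  fixes n :: "'x::{topological_ab_group_add, t2_space} measure"
  assumes haar: "haar_measure n" and f: "integrable n f" "\<And>k. k \<notin> K \<Longrightarrow> f k = 0"
    and F: "continuous_on UNIV F" "\<And>k. k \<in> K \<Longrightarrow> cmod (F k) \<le> B"
  shows "integrable n (\<lambda>k. f k * F k :: complex)"
    "cmod (\<integral>k. f k * F k \<partial>n) \<le> B * (\<integral>k. cmod (f k) \<partial>n)"
proof -
  have le: "norm (f k * F k) \<le> B * cmod (f k)" for k
  proof (cases "k \<in> K")
    case True
    then show ?thesis using mult_right_mono[OF F(2)[OF True], of "cmod (f k)"] by (simp add: norm_mult mult.commute)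
  qed (simp add: f)
  have Bf: "integrable n (\<lambda>k. B * cmod (f k))" using f(1) by simp
  show i: "integrable n (\<lambda>k. f k * F k)"
  proof (rule Bochner_Integration.integrable_bound[OF Bf])
    show "(\<lambda>k. f k * F k) \<in> borel_measurable n"
      using borel_measurable_integrable[OF f(1)] haar_measurable[OF haar F(1)] by (rule borel_measurable_times)
    show "AE k in n. norm (f k * F k) \<le> norm (B * cmod (f k))"
      using le by (intro AE_I2) (metis abs_ge_self order_trans real_norm_def)
  qed
  show "cmod (\<integral>k. f k * F k \<partial>n) \<le> B * (\<integral>k. cmod (f k) \<partial>n)"
    using norm_integral_le[OF i Bf le] f(1) by simp
qed

lemma cmod_cinner_blinfun_le:
  "cmod (cinner v (blinfun_apply T u)) \<le> norm T * norm u * norm v"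
proof -
  have "cmod (cinner v (T u)) \<le> norm v * norm (T u)" by (rule cinner_Cauchy_Schwarz)
  also have "\<dots> \<le> norm v * (norm T * norm u)" by (intro mult_left_mono norm_blinfun norm_ge_zero)
  finally show ?thesis by (simp add: mult_ac)
qed

lemma weak_module_bounded:
  assumes "weak_module V" "compact K"
  obtains b where "0 < b" "\<And>k. k \<in> K \<Longrightarrow> norm (V k) \<le> b"
proof -
  have "bdd_above ((\<lambda>k. norm (V k)) ` K)" using assms by (simp add: weak_module_def)
  then obtain b where "\<And>k. k \<in> K \<Longrightarrow> norm (V k) \<le> b" by (auto simp: bdd_above_def)
  then show ?thesis by (intro that[of "max b 1"]) (auto simp: max_def intro: order_trans)
qed

context
  fixes n :: "'x::topological_ab_group_add dual measure"
    and V :: "'x dual \<Rightarrow> ('f::complex_hilbert \<Rightarrow>\<^sub>L 'f)"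
  assumes haar: "haar_measure n" and V: "weak_module V"
begin

lemma V_bops: "V k \<in> bops" and V_add: "V (k + l) = V k o\<^sub>L V l"
  and V_cont: "continuous_on UNIV (\<lambda>k. cinner v (V k u))"
  using V by (auto simp: weak_module_def)

text \<open>The matrix elements of \<open>V\<close> integrate to a bounded sesquilinear form; the
  compact support of \<open>f\<close> turns the local bound on \<open>V\<close> into a global one
  for the form.\<close>

lemma operator_integral_exists:
  assumes f: "integrable n f" and K: "compact K" "\<And>k. k \<notin> K \<Longrightarrow> f k = 0"
  obtains A where "has_operator_integral n f V A"
proof -
  obtain b where b: "0 < b" "\<And>k. k \<in> K \<Longrightarrow> norm (V k) \<le> b"
    using weak_module_bounded[OF V K(1)] by blast
  have bd: "cmod (cinner v (V k u)) \<le> b * norm u * norm v" if "k \<in> K" for k u v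
    using cmod_cinner_blinfun_le[of v "V k" u] b(2)[OF that]
    by (meson mult_right_mono norm_ge_zero order_trans)
  note I = integrable_mult_continuous[OF haar f K(2) V_cont bd]
  obtain A where A: "A \<in> bops" "\<And>u v. cinner v (blinfun_apply A u) = (\<integral>k. f k * cinner v (V k u) \<partial>n)"
  proof (rule sesquilinear_operator)
    fix u v w :: 'f and c :: complex
    show "(\<integral>k. f k * cinner (u + v) (V k w) \<partial>n)
        = (\<integral>k. f k * cinner u (V k w) \<partial>n) + (\<integral>k. f k * cinner v (V k w) \<partial>n)"
      by (simp add: cinner_add_left distrib_left I)
    show "(\<integral>k. f k * cinner w (V k (u + v)) \<partial>n)
        = (\<integral>k. f k * cinner w (V k u) \<partial>n) + (\<integral>k. f k * cinner w (V k v) \<partial>n)"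
      by (simp add: blinfun.add_right cinner_add_right distrib_left I)
    show "(\<integral>k. f k * cinner (c *\<^sub>C u) (V k v) \<partial>n) = cnj c * (\<integral>k. f k * cinner u (V k v) \<partial>n)"
      by (simp add: cinner_scaleC_left mult.left_commute[of _ "cnj c"])
    show "(\<integral>k. f k * cinner u (V k (c *\<^sub>C v)) \<partial>n) = c * (\<integral>k. f k * cinner u (V k v) \<partial>n)"
      by (simp add: bops_scaleC[OF V_bops] cinner_scaleC_right mult.left_commute[of _ c])
    show "cmod (\<integral>k. f k * cinner u (V k v) \<partial>n) \<le> (b * (\<integral>k. cmod (f k) \<partial>n)) * norm u * norm v"
    proof -
      have "cmod (\<integral>k. f k * cinner u (V k v) \<partial>n) \<le> (b * norm v * norm u) * (\<integral>k. cmod (f k) \<partial>n)"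
        by (rule I(2))
      also have "\<dots> = (b * (\<integral>k. cmod (f k) \<partial>n)) * norm u * norm v"
        by (simp only: mult_ac)
      finally show ?thesis .
    qed
  qed blast
  show ?thesis
    by (rule that[of A]) (simp add: has_operator_integral_cinner A has_bochner_integral_iff I)
qed

text \<open>A change of variable: composition with \<open>V h\<close>, on either side, shifts the
  symbol by \<open>h\<close>. Continuity in \<open>h\<close> thereby becomes a question about the
  symbol alone.\<close>

lemma has_operator_integral_translation:
  assumes A: "has_operator_integral n f V A"
  shows "has_operator_integral n (\<lambda>k. f (k - h)) V (V h o\<^sub>L A)"
    and "has_operator_integral n (\<lambda>k. f (k - h)) V (A o\<^sub>L V h)"
proof -
  have Ab: "A \<in> bops" using A by (simp add: has_operator_integral_def)
  have *: "has_bochner_integral n (\<lambda>k. f (k - h) * cinner v (V k u)) I"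
    if "has_bochner_integral n (\<lambda>k. f k * cinner v (V (k + h) u)) I" for I u v
    using has_bochner_integral_translation[OF haar that, of "- h"] by (simp add: add.commute)
  show "has_operator_integral n (\<lambda>k. f (k - h)) V (V h o\<^sub>L A)"
    unfolding has_operator_integral_cinner
  proof (intro conjI allI)
    show "V h o\<^sub>L A \<in> bops" using Ab V_bops by blast
    fix u v
    have "cinner_form v o\<^sub>L V h \<in> bops" using V_bops by blast
    then have "has_bochner_integral n (\<lambda>k. f k * (cinner_form v o\<^sub>L V h) (V k u)) ((cinner_form v o\<^sub>L V h) (A u))"
      using A by (simp add: has_operator_integral_def del: blinfun_apply_blinfun_compose)
    then show "has_bochner_integral n (\<lambda>k. f (k - h) * cinner v (V k u)) (cinner v ((V h o\<^sub>L A) u))"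
      by (intro *) (simp add: add.commute[of _ h] V_add)
  qed
  show "has_operator_integral n (\<lambda>k. f (k - h)) V (A o\<^sub>L V h)"
    unfolding has_operator_integral_cinner
  proof (intro conjI allI)
    show "A o\<^sub>L V h \<in> bops" using Ab V_bops by blast
    fix u v
    have "has_bochner_integral n (\<lambda>k. f k * cinner v (V k (V h u))) (cinner v (A (V h u)))"
      using A by (simp add: has_operator_integral_cinner)
    then show "has_bochner_integral n (\<lambda>k. f (k - h) * cinner v (V k u)) (cinner v ((A o\<^sub>L V h) u))"
      by (intro *) (simp add: V_add)
  qed
qed

text \<open>The symbols are compared in the uniform norm, in which Fourier transforms depend
  continuously on translations. A common compact support has finite measure, so this yields an
  operator bound.\<close>

lemma operator_integral_diff_le:
  assumes A: "has_operator_integral n f V A" and B: "has_operator_integral n g V B"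
    and K: "compact K" "\<And>k. k \<notin> K \<Longrightarrow> f k = 0" "\<And>k. k \<notin> K \<Longrightarrow> g k = 0"
    and b: "0 \<le> b" "\<And>k. k \<in> K \<Longrightarrow> norm (V k) \<le> b" and d: "0 \<le> d" "\<And>k. cmod (f k - g k) \<le> d"
  shows "norm (A - B) \<le> d * b * measure n K"
proof (rule norm_blinfun_le_cinnerI)
  show "0 \<le> d * b * measure n K" using b d by simp
  fix u v
  have Ks: "K \<in> sets n" using compact_imp_closed[OF K(1)] by (simp add: haar_sets[OF haar])
  have AB: "has_bochner_integral n (\<lambda>k. f k * cinner v (V k u)) (cinner v (A u))"
    "has_bochner_integral n (\<lambda>k. g k * cinner v (V k u)) (cinner v (B u))"
    using A B by (auto simp: has_operator_integral_cinner)
  have AB': "has_bochner_integral n (\<lambda>k. (f k - g k) * cinner v (V k u)) (cinner v ((A - B) u))"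
    using has_bochner_integral_diff[OF AB] by (simp add: left_diff_distrib blinfun.diff_left cinner_diff_right)
  have "cmod (cinner v ((A - B) u)) = cmod (\<integral>k. (f k - g k) * cinner v (V k u) \<partial>n)"
    using AB' by (simp add: has_bochner_integral_iff)
  also have "\<dots> \<le> (\<integral>k. (d * b * norm u * norm v) * indicator K k \<partial>n)"
  proof (rule norm_integral_le)
    show "integrable n (\<lambda>k. (f k - g k) * cinner v (V k u))" using AB' by (simp add: has_bochner_integral_iff)
    show "integrable n (\<lambda>k. (d * b * norm u * norm v) * indicator K k :: real)"
      using Ks haar_compact_finite[OF haar K(1)] by (intro integrable_mult_right) auto
    fix k
    show "norm ((f k - g k) * cinner v (V k u)) \<le> (d * b * norm u * norm v) * indicator K k"
    proof (cases "k \<in> K")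
      case True
      have "cmod (cinner v (V k u)) \<le> b * norm u * norm v"
        using cmod_cinner_blinfun_le[of v "V k" u] b(2)[OF True]
        by (meson mult_right_mono norm_ge_zero order_trans)
      then have "cmod (f k - g k) * cmod (cinner v (V k u)) \<le> d * (b * norm u * norm v)"
        using d by (intro mult_mono) auto
      then show ?thesis using True by (simp add: norm_mult mult_ac)
    qed (simp add: K)
  qed
  also have "\<dots> = d * b * measure n K * norm u * norm v"
    using Ks by (simp add: haar_space[OF haar])
  finally show "cmod (cinner v ((A - B) u)) \<le> d * b * measure n K * norm u * norm v" .
qed

end

text \<open>Both products have the symbol \<open>\<lambda>k. fourier m \<phi> (k - h)\<close>, which
  is uniformly near the original one for small \<open>h\<close>. Keeping \<open>h\<close> in the
  compact set \<open>C\<close> confines all supports to the sum of \<open>K\<close> and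
  \<open>C\<close>, where \<open>V\<close> is bounded.\<close>

lemma multiplier_norm_continuous:
  fixes m :: "'x::{topological_ab_group_add, t2_space} measure" and C :: "'x dual set"
  assumes haar: "haar_measure m" "haar_measure n" and V: "weak_module V"
    and \<phi>: "test_function m n \<phi>" and M: "has_operator_integral n (fourier m \<phi>) V M"
    and C: "compact C" "\<forall>\<^sub>F k in nhds 0. k \<in> C" and e: "0 < e"
  shows "\<forall>\<^sub>F h in nhds 0. norm ((V h o\<^sub>L M) - M) \<le> e" "\<forall>\<^sub>F h in nhds 0. norm ((M o\<^sub>L V h) - M) \<le> e"
proof -
  let ?f = "fourier m \<phi>"
  obtain K where K: "compact K" "\<And>k. k \<notin> K \<Longrightarrow> ?f k = 0"
    using test_function_support[OF \<phi>] by blast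
  define K' where "K' = {x + y | x y. x \<in> K \<and> y \<in> C}"
  have K': "compact K'" unfolding K'_def using K(1) C(1) by (rule compact_sums_group)
  have "0 \<in> C" using C(2) by (rule eventually_nhds_x_imp_x)
  have out: "?f (k - h) = 0" if "k \<notin> K'" "h \<in> C" for k h
  proof (rule K(2))
    show "k - h \<notin> K" using that unfolding K'_def by (metis (mono_tags, lifting) diff_add_cancel mem_Collect_eq)
  qed
  obtain b where b: "0 < b" "\<And>k. k \<in> K' \<Longrightarrow> norm (V k) \<le> b"
    using weak_module_bounded[OF V K'] by blast
  define d where "d = e / (b * measure n K' + 1)"
  have "0 \<le> b * measure n K'" using b(1) by simp
  then have d: "0 < d" "d * b * measure n K' \<le> e"
    using e by (auto simp: d_def field_simps)
  have "integrable m \<phi>" using \<phi> by (simp add: test_function_def)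
  from fourier_uniformly_continuous[OF haar(1) this d(1)]
  have ev: "\<forall>\<^sub>F k in nhds 0. \<forall>l. cmod (?f (l + k) - ?f l) < d" .
  have near: "\<forall>\<^sub>F h in nhds 0. h \<in> C \<and> (\<forall>k. cmod (?f (k - h) - ?f k) \<le> d)"
    using C(2) ev
  proof eventually_elim
    case (elim h)
    have "cmod (?f (k - h) - ?f k) \<le> d" for k
      \<comment> \<open>Uniform continuity is used at the point \<open>k - h\<close>, from which the
        increment \<open>h\<close> leads back to \<open>k\<close>.\<close>
      using elim(2) spec[OF elim(2), of "k - h"] by (simp add: norm_minus_commute)
    then show ?case using elim(1) by blast
  qed
  have le: "norm (B - M) \<le> e"
    if "has_operator_integral n (\<lambda>k. ?f (k - h)) V B" "h \<in> C \<and> (\<forall>k. cmod (?f (k - h) - ?f k) \<le> d)" for B h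
  proof -
    have "norm (B - M) \<le> d * b * measure n K'"
      using that out out[of _ 0] \<open>0 \<in> C\<close> b d
      by (intro operator_integral_diff_le[OF haar(2) V that(1) M K']) auto
    with d(2) show ?thesis by linarith
  qed
  show "\<forall>\<^sub>F h in nhds 0. norm ((V h o\<^sub>L M) - M) \<le> e"
    using near by (rule eventually_mono) (erule le[OF has_operator_integral_translation(1)[OF haar(2) V M]])
  show "\<forall>\<^sub>F h in nhds 0. norm ((M o\<^sub>L V h) - M) \<le> e"
    using near by (rule eventually_mono) (erule le[OF has_operator_integral_translation(2)[OF haar(2) V M]])
qed

text \<open>As the transform of \<open>\<psi>\<close> has integral \<open>1\<close>, the operator
  \<open>Y - P 0\<close> is the integral of \<open>P k - P 0\<close> against it. The family
  \<open>P\<close> stands for both \<open>V2 k o\<^sub>L X\<close> and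
  \<open>X o\<^sub>L V1 k\<close>, and \<open>Y\<close> is described by matrix elements so that a
  product of \<open>X\<close> with an operator integral qualifies on either side.\<close>

lemma approximate_unit_operator:
  fixes m :: "'x::{topological_ab_group_add, t2_space} measure"
    and P :: "'x dual \<Rightarrow> ('a::complex_hilbert \<Rightarrow>\<^sub>L 'b::complex_hilbert)"
  assumes haar: "haar_measure m" "haar_measure n"
    and \<phi>: "test_function m n \<phi>" "fourier m \<phi> 0 = 1"
    and P: "\<And>u v. continuous_on UNIV (\<lambda>k. cinner v (P k u))"
      "\<And>K. compact K \<Longrightarrow> \<exists>b. \<forall>k\<in>K. norm (P k) \<le> b"
      "\<And>e. 0 < e \<Longrightarrow> \<forall>\<^sub>F k in nhds 0. norm (P k - P 0) \<le> e"
    and e: "0 < e"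
  obtains \<psi> where "test_function m n \<psi>"
    "\<And>Y. (\<And>u v. cinner v (blinfun_apply Y u) = (\<integral>k. fourier m \<psi> k * cinner v (P k u) \<partial>n)) \<Longrightarrow>
      norm (Y - P 0) \<le> e"
proof -
  obtain K where K: "compact K" "\<And>k. k \<notin> K \<Longrightarrow> fourier m \<phi> k = 0"
    using test_function_support[OF \<phi>(1)] by blast
  obtain b0 where "\<forall>k\<in>K. norm (P k) \<le> b0" using P(2)[OF K(1)] by blast
  then obtain b where b: "0 \<le> b" "\<And>k. k \<in> K \<Longrightarrow> norm (P k) \<le> b"
    by (metis max.cobounded2 max.coboundedI1)
  \<comment> \<open>The transform of \<open>\<psi>\<close> will vanish off \<open>K\<close>, so
    \<open>B\<close> can be fixed before the neighbourhood \<open>W\<close> and the tolerance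
    \<open>e'\<close> are chosen.\<close>
  define B where "B = b + norm (P 0)"
  have B: "0 \<le> B" using b(1) by (simp add: B_def)
  have "\<forall>\<^sub>F k in nhds 0. norm (P k - P 0) \<le> e / 10" using e by (intro P) simp
  then obtain W where W: "open W" "0 \<in> W" "\<And>k. k \<in> W \<Longrightarrow> norm (P k - P 0) \<le> e / 10"
    unfolding eventually_nhds by blast
  have ev: "\<forall>\<^sub>F k in nhds 0. k \<in> W" using W(1,2) eventually_nhds by blast
  \<comment> \<open>On \<open>W\<close> the error \<open>e / 10\<close> meets a mass of at most
    \<open>5\<close>; off \<open>W\<close> the error \<open>B\<close> meets a mass of at most
    \<open>e'\<close>. Each contributes half of \<open>e\<close>.\<close>
  define e' where "e' = e / (2 * (B + 1))"
  have e': "0 < e'" "B * e' \<le> e / 2" using B e by (auto simp: e'_def field_simps)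
  obtain \<psi> where \<psi>: "test_function m n \<psi>" "\<And>k. fourier m \<phi> k = 0 \<Longrightarrow> fourier m \<psi> k = 0"
    "(\<integral>k. fourier m \<psi> k \<partial>n) = 1" "(\<integral>k. cmod (fourier m \<psi> k) \<partial>n) \<le> 5"
    "(\<integral>k. (if k \<in> W then 0 else cmod (fourier m \<psi> k)) \<partial>n) \<le> e'"
    using approximate_unit[OF haar \<phi> ev e'(1)] by blast
  let ?g = "fourier m \<psi>"
  have gi: "integrable n ?g" using \<psi>(1) by (simp add: test_function_def)
  have g0: "?g k = 0" if "k \<notin> K" for k using that K(2) \<psi>(2) by blast
  have Wi: "integrable n (\<lambda>k. if k \<in> W then 0 else cmod (?g k))"
  proof -
    have "- W \<in> sets n" using W(1) by (simp add: haar_sets[OF haar(2)])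
    then have "integrable n (\<lambda>k. indicator (- W) k *\<^sub>R cmod (?g k))"
      using gi by (intro integrable_mult_indicator) auto
    moreover have "(\<lambda>k. indicator (- W) k *\<^sub>R cmod (?g k)) = (\<lambda>k. if k \<in> W then 0 else cmod (?g k))"
      by (auto simp: indicator_def)
    ultimately show ?thesis by simp
  qed
  show ?thesis
  proof (rule that[OF \<psi>(1)])
    fix Y assume Y: "\<And>u v. cinner v (blinfun_apply Y u) = (\<integral>k. ?g k * cinner v (P k u) \<partial>n)"
    show "norm (Y - P 0) \<le> e"
    proof (rule norm_blinfun_le_cinnerI)
      fix u v
      have bd: "cmod (cinner v (P k u)) \<le> b * norm u * norm v" if "k \<in> K" for k
        using cmod_cinner_blinfun_le[of v "P k" u] b(2)[OF that]
        by (meson mult_right_mono norm_ge_zero order_trans)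
      have i: "integrable n (\<lambda>k. ?g k * cinner v (P k u))"
        by (rule integrable_mult_continuous[OF haar(2) gi g0 P(1) bd])
      have i0: "integrable n (\<lambda>k. ?g k * cinner v (P 0 u))" using gi by simp
      have eq: "?g k * cinner v (P k u) - ?g k * cinner v (P 0 u) = ?g k * cinner v ((P k - P 0) u)" for k
        by (simp add: blinfun.diff_left cinner_diff_right right_diff_distrib)
      have "cinner v ((Y - P 0) u) = (\<integral>k. ?g k * cinner v (P k u) \<partial>n) - (\<integral>k. ?g k * cinner v (P 0 u) \<partial>n)"
        using \<psi>(3) gi by (simp add: blinfun.diff_left cinner_diff_right Y)
      also have "\<dots> = (\<integral>k. ?g k * cinner v ((P k - P 0) u) \<partial>n)"
        using Bochner_Integration.integral_diff[OF i i0] by (simp add: eq)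
      finally have "cmod (cinner v ((Y - P 0) u)) = cmod (\<integral>k. ?g k * cinner v ((P k - P 0) u) \<partial>n)" by simp
      also have "\<dots> \<le> (\<integral>k. (norm u * norm v) * (e / 10 * cmod (?g k) + B * (if k \<in> W then 0 else cmod (?g k))) \<partial>n)"
      proof (rule norm_integral_le)
        show "integrable n (\<lambda>k. ?g k * cinner v ((P k - P 0) u))"
          using Bochner_Integration.integrable_diff[OF i i0] by (simp add: eq)
        show "integrable n (\<lambda>k. (norm u * norm v) * (e / 10 * cmod (?g k) + B * (if k \<in> W then 0 else cmod (?g k))))"
          using gi Wi by (intro integrable_mult_right Bochner_Integration.integrable_add integrable_norm)
        fix k
        have "cmod (cinner v ((P k - P 0) u)) \<le> norm (P k - P 0) * norm u * norm v"
          by (rule cmod_cinner_blinfun_le)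
        then have 1: "norm (?g k * cinner v ((P k - P 0) u)) \<le> cmod (?g k) * (norm (P k - P 0) * norm u * norm v)"
          unfolding norm_mult by (rule mult_left_mono) simp
        have "norm (P k - P 0) * cmod (?g k) \<le> e / 10 * cmod (?g k) + B * (if k \<in> W then 0 else cmod (?g k))"
        proof (cases "k \<in> W")
          case True
          then show ?thesis using mult_right_mono[OF W(3)[OF True], of "cmod (?g k)"] by simp
        next
          case False
          show ?thesis
          proof (cases "k \<in> K")
            case True
            have "norm (P k - P 0) \<le> B"
              using norm_triangle_ineq4[of "P k" "P 0"] b(2)[OF True] by (simp add: B_def)
            then have "norm (P k - P 0) * cmod (?g k) \<le> B * cmod (?g k)"
              by (rule mult_right_mono) simp
            moreover have "0 \<le> e / 10 * cmod (?g k)" using e by simp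
            ultimately show ?thesis using False by simp
          qed (simp add: g0)
        qed
        then have "(norm u * norm v) * (norm (P k - P 0) * cmod (?g k))
            \<le> (norm u * norm v) * (e / 10 * cmod (?g k) + B * (if k \<in> W then 0 else cmod (?g k)))"
          by (rule mult_left_mono) simp
        with 1 show "norm (?g k * cinner v ((P k - P 0) u))
            \<le> (norm u * norm v) * (e / 10 * cmod (?g k) + B * (if k \<in> W then 0 else cmod (?g k)))"
          by (simp only: mult_ac)
      qed
      also have "\<dots> = (norm u * norm v) * (e / 10 * (\<integral>k. cmod (?g k) \<partial>n)
          + B * (\<integral>k. (if k \<in> W then 0 else cmod (?g k)) \<partial>n))"
        unfolding integral_mult_right_zero
        by (subst Bochner_Integration.integral_add)
          (simp_all only: integral_mult_right_zero integrable_mult_right integrable_norm gi Wi)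
      also have "\<dots> \<le> (norm u * norm v) * e"
      proof (rule mult_left_mono)
        have "e / 10 * (\<integral>k. cmod (?g k) \<partial>n) \<le> e / 10 * 5"
          using \<psi>(4) e by (intro mult_left_mono) auto
        moreover have "B * (\<integral>k. (if k \<in> W then 0 else cmod (?g k)) \<partial>n) \<le> B * e'"
          using \<psi>(5) B by (intro mult_left_mono) auto
        ultimately show "e / 10 * (\<integral>k. cmod (?g k) \<partial>n)
            + B * (\<integral>k. (if k \<in> W then 0 else cmod (?g k)) \<partial>n) \<le> e"
          using e'(2) by simp
      qed simp
      finally show "cmod (cinner v ((Y - P 0) u)) \<le> e * norm u * norm v" by (simp add: mult_ac)
    qed (use e in simp)
  qed
qed

lemmas tendsto_blinfun_compose = bounded_bilinear.tendsto[OF bounded_bilinear_blinfun_compose]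

lemma tendsto_nhds_of_continuous_on: "continuous_on UNIV f \<Longrightarrow> (f \<longlongrightarrow> f a) (nhds a)"
  using tendsto_at_iff_tendsto_nhds[of f a] by (simp add: continuous_on_def)

lemma blinfun_compose_id [simp]: "id_blinfun o\<^sub>L A = A" "A o\<^sub>L id_blinfun = A"
  by (rule blinfun_eqI, simp)+

lemma blinfun_compose_assoc: "A o\<^sub>L B o\<^sub>L C = A o\<^sub>L (B o\<^sub>L C)"
  by (rule blinfun_eqI) simp

section \<open>Decay preserving operators\<close>

lemma dual_compact_neighbourhood:
  fixes m :: "'x::{topological_ab_group_add, t2_space} measure"
  assumes haar: "haar_measure m" and \<phi>: "test_function m n \<phi>" "fourier m \<phi> 0 = 1"
  obtains C :: "'x dual set" where "compact C" "\<forall>\<^sub>F k in nhds 0. k \<in> C"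
proof -
  obtain K where K: "compact K" "\<And>k. k \<notin> K \<Longrightarrow> fourier m \<phi> k = 0"
    using test_function_support[OF \<phi>(1)] by blast
  have "continuous_on UNIV (fourier m \<phi>)"
    using \<phi>(1) by (intro continuous_on_fourier[OF haar]) (simp add: test_function_def)
  then have "open {k. fourier m \<phi> k \<noteq> 0}"
    by (intro open_Collect_neq continuous_on_const)
  moreover have "0 \<in> {k. fourier m \<phi> k \<noteq> 0}" using \<phi>(2) by simp
  moreover have "\<forall>k\<in>{k. fourier m \<phi> k \<noteq> 0}. k \<in> K" using K(2) by blast
  ultimately have "\<forall>\<^sub>F k in nhds 0. k \<in> K" unfolding eventually_nhds by blast
  with K(1) show ?thesis by (rule that)
qed

lemma weak_module_functional_continuous:
  fixes V :: "'x::topological_ab_group_add dual \<Rightarrow> ('f::complex_hilbert \<Rightarrow>\<^sub>L 'f)" and l :: "'f \<Rightarrow>\<^sub>L complex"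
  assumes V: "weak_module V" and l: "l \<in> bops"
  shows "continuous_on UNIV (\<lambda>k. blinfun_apply l (V k u))"
proof -
  obtain v where "l = cinner_form v" using riesz_representation[OF l] by blast
  then show ?thesis using V by (simp add: weak_module_def)
qed

lemma closure_compose_closed:
  fixes X :: "('a::real_normed_vector \<Rightarrow>\<^sub>L 'b::real_normed_vector) set"
    and F :: "('a \<Rightarrow>\<^sub>L 'b) \<Rightarrow> 'c::topological_space"
  assumes "continuous_on UNIV F" "closed c" "\<And>A. A \<in> X \<Longrightarrow> F A \<in> c" "M \<in> closure X"
  shows "F M \<in> c"
proof -
  have "closure X \<subseteq> F -` c"
    using assms by (intro closure_minimal closed_vimage) auto
  then show ?thesis using assms(4) by blast
qed

lemma multiplier_tendsto:
  fixes m :: "'x::{topological_ab_group_add, t2_space} measure" and C :: "'x dual set"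
  assumes "haar_measure m" "haar_measure n" "weak_module V" "test_function m n \<phi>"
    and "has_operator_integral n (fourier m \<phi>) V M" and "compact C" "\<forall>\<^sub>F k in nhds 0. k \<in> C"
  shows "((\<lambda>k. V k o\<^sub>L M) \<longlongrightarrow> M) (nhds 0)" "((\<lambda>k. M o\<^sub>L V k) \<longlongrightarrow> M) (nhds 0)"
proof -
  have "\<forall>\<^sub>F k in nhds 0. dist (V k o\<^sub>L M) M < e" "\<forall>\<^sub>F k in nhds 0. dist (M o\<^sub>L V k) M < e" if "0 < e" for e
  proof -
    have half: "0 < e / 2" using that by simp
    have lt: "dist A M < e" if "norm (A - M) \<le> e / 2" for A
      using that \<open>0 < e\<close> by (simp add: dist_norm)
    show "\<forall>\<^sub>F k in nhds 0. dist (V k o\<^sub>L M) M < e"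
      using multiplier_norm_continuous(1)[OF assms half] by (rule eventually_mono) (rule lt)
    show "\<forall>\<^sub>F k in nhds 0. dist (M o\<^sub>L V k) M < e"
      using multiplier_norm_continuous(2)[OF assms half] by (rule eventually_mono) (rule lt)
  qed
  then show "((\<lambda>k. V k o\<^sub>L M) \<longlongrightarrow> M) (nhds 0)" "((\<lambda>k. M o\<^sub>L V k) \<longlongrightarrow> M) (nhds 0)"
    by (simp_all add: tendsto_iff)
qed

theorem decay_preserving_if_continuous:
  fixes m :: "'x::{topological_ab_group_add, t2_space} measure"
    and V1 :: "'x dual \<Rightarrow> ('a::complex_hilbert \<Rightarrow>\<^sub>L 'a)"
    and V2 :: "'x dual \<Rightarrow> ('b::complex_hilbert \<Rightarrow>\<^sub>L 'b)"
  assumes haar: "haar_measure m" "haar_measure n"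
    and \<phi>: "test_function m n \<phi>" "fourier m \<phi> 0 = 1"
    and V1: "weak_module V1" and V2: "weak_module V2" and S: "S \<in> bops"
    and lim: "((\<lambda>k. V2 (- k) o\<^sub>L S o\<^sub>L V1 k) \<longlongrightarrow> S) (nhds 0)"
  shows "decay_preserving m n V1 V2 S"
proof -
  obtain C :: "'x dual set" where C: "compact C" "\<forall>\<^sub>F k in nhds 0. k \<in> C"
    by (rule dual_compact_neighbourhood[OF haar(1) \<phi>])
  note tends = multiplier_tendsto[OF haar _ _ _ C]
  have V0: "V1 0 = id_blinfun" "V2 0 = id_blinfun" and inv: "V1 k o\<^sub>L V1 (- k) = id_blinfun"
      "V1 (- k) o\<^sub>L V1 k = id_blinfun" "V2 k o\<^sub>L V2 (- k) = id_blinfun" for k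
    using V1 V2 unfolding weak_module_def by (metis add.right_inverse add.left_inverse)+
  have le_e: "\<forall>\<^sub>F k in nhds 0. norm (P k - X) \<le> e" if "(P \<longlongrightarrow> X) (nhds 0)" "0 < e"
    for P :: "'x dual \<Rightarrow> 'a \<Rightarrow>\<^sub>L 'b" and X e
    using tendstoD[OF that] by eventually_elim (simp add: dist_norm)
  define cl1 where "cl1 = closure (span {N o\<^sub>L T | N T. N \<in> multiplier_algebra m n V2 \<and> T \<in> (bops :: ('a \<Rightarrow>\<^sub>L 'b) set)})"
  define cl2 where "cl2 = closure (span {T o\<^sub>L M | T M. M \<in> multiplier_algebra m n V1 \<and> T \<in> (bops :: ('a \<Rightarrow>\<^sub>L 'b) set)})"
  have left: "S o\<^sub>L M \<in> cl1"
    if \<phi>': "test_function m n \<phi>'" and M: "has_operator_integral n (fourier m \<phi>') V1 M" for M \<phi>'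
    unfolding cl1_def closure_approachable
  proof (intro allI impI)
    fix e :: real assume e: "0 < e"
    define X where "X = S o\<^sub>L M"
    have Xb: "X \<in> bops" using S M by (auto simp: X_def has_operator_integral_def)
    define P where "P k = V2 k o\<^sub>L X" for k
    have P0: "P 0 = X" by (simp add: P_def V0)
    \<comment> \<open>Replacing \<open>k\<close> by \<open>- k\<close> in the hypothesis puts
      \<open>V2 k\<close> on the left of \<open>S\<close>. Then
      \<open>V2 k o\<^sub>L S o\<^sub>L M\<close> is the product of two families with norm limits,
      the conjugate of \<open>S\<close> and \<open>V1 k o\<^sub>L M\<close>, since the inner factors
      cancel.\<close>
    have "filterlim (uminus :: 'x dual \<Rightarrow> _) (nhds 0) (nhds 0)"
      using tendsto_uminus_nhds[of "0 :: 'x dual"] by simp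
    from filterlim_compose[OF lim this]
    have "((\<lambda>k. V2 k o\<^sub>L S o\<^sub>L V1 (- k)) \<longlongrightarrow> S) (nhds 0)" by simp
    from tendsto_blinfun_compose[OF this tends(1)[OF V1 \<phi>' M]]
    have "((\<lambda>k. (V2 k o\<^sub>L S o\<^sub>L V1 (- k)) o\<^sub>L (V1 k o\<^sub>L M)) \<longlongrightarrow> P 0) (nhds 0)"
      by (simp add: P0 X_def)
    moreover have "(V2 k o\<^sub>L S o\<^sub>L V1 (- k)) o\<^sub>L (V1 k o\<^sub>L M) = V2 k o\<^sub>L S o\<^sub>L (V1 (- k) o\<^sub>L V1 k) o\<^sub>L M" for k
      by (simp only: blinfun_compose_assoc)
    then have "(V2 k o\<^sub>L S o\<^sub>L V1 (- k)) o\<^sub>L (V1 k o\<^sub>L M) = P k" for k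
      by (simp only: inv P_def X_def blinfun_compose_id) (simp only: blinfun_compose_assoc)
    ultimately have Plim: "(P \<longlongrightarrow> P 0) (nhds 0)" by simp
    obtain \<psi> where \<psi>: "test_function m n \<psi>"
      "\<And>Y. (\<And>u v. cinner v (blinfun_apply Y u) = (\<integral>k. fourier m \<psi> k * cinner v (P k u) \<partial>n)) \<Longrightarrow>
        norm (Y - P 0) \<le> e / 2"
    proof (rule approximate_unit_operator[OF haar \<phi>, of P "e/2"])
      show "continuous_on UNIV (\<lambda>k. cinner v (P k u))" for u v
        using V2 by (simp add: P_def weak_module_def)
      show "\<exists>b. \<forall>k\<in>K. norm (P k) \<le> b" if K: "compact K" for K
      proof -
        obtain b where b: "\<And>k. k \<in> K \<Longrightarrow> norm (V2 k) \<le> b" using weak_module_bounded[OF V2 K] by blast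
        have "norm (P k) \<le> b * norm X" if "k \<in> K" for k
          unfolding P_def using norm_blinfun_compose[of "V2 k" X] b[OF that]
          by (meson mult_right_mono norm_ge_zero order_trans)
        then show ?thesis by blast
      qed
    qed (use e le_e[OF Plim] in auto)
    obtain K where K: "compact K" "\<And>k. k \<notin> K \<Longrightarrow> fourier m \<psi> k = 0"
      using test_function_support[OF \<psi>(1)] by blast
    have gi: "integrable n (fourier m \<psi>)" using \<psi>(1) by (simp add: test_function_def)
    obtain N where N: "has_operator_integral n (fourier m \<psi>) V2 N"
      using operator_integral_exists[OF haar(2) V2 gi K] by blast
    have "norm ((N o\<^sub>L X) - P 0) \<le> e / 2"
      by (rule \<psi>(2)) (use N in \<open>simp add: P_def has_operator_integral_cinner has_bochner_integral_iff\<close>)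
    \<comment> \<open>The approximation is a single product, with \<open>X\<close> itself as the
      bounded factor \<open>T\<close>.\<close>
    moreover have "N \<in> multiplier_algebra m n V2"
      unfolding multiplier_algebra_test using N \<psi>(1) by (intro subsetD[OF closure_subset]) blast
    then have "N o\<^sub>L X \<in> span {N o\<^sub>L T | N T. N \<in> multiplier_algebra m n V2 \<and> T \<in> bops}"
      using Xb by (intro span_base) blast
    ultimately show "\<exists>y\<in>span {N o\<^sub>L T | N T. N \<in> multiplier_algebra m n V2 \<and> T \<in> bops}. dist y (S o\<^sub>L M) < e"
      using e by (intro bexI[of _ "N o\<^sub>L X"]) (simp_all add: dist_norm P0 X_def)
  qed
  have right: "M o\<^sub>L S \<in> cl2"
    if \<phi>': "test_function m n \<phi>'" and M: "has_operator_integral n (fourier m \<phi>') V2 M" for M \<phi>'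
    unfolding cl2_def closure_approachable
  proof (intro allI impI)
    fix e :: real assume e: "0 < e"
    define X where "X = M o\<^sub>L S"
    have Xb: "X \<in> bops" using S M by (auto simp: X_def has_operator_integral_def)
    define P where "P k = X o\<^sub>L V1 k" for k
    have P0: "P 0 = X" by (simp add: P_def V0)
    \<comment> \<open>On this side the norm continuous factor is \<open>M o\<^sub>L V2 k\<close>,
      and the conjugate of \<open>S\<close> enters as in the hypothesis.\<close>
    from tendsto_blinfun_compose[OF tends(2)[OF V2 \<phi>' M] lim]
    have "((\<lambda>k. (M o\<^sub>L V2 k) o\<^sub>L (V2 (- k) o\<^sub>L S o\<^sub>L V1 k)) \<longlongrightarrow> P 0) (nhds 0)"
      by (simp add: P0 X_def)
    moreover have "(M o\<^sub>L V2 k) o\<^sub>L (V2 (- k) o\<^sub>L S o\<^sub>L V1 k) = M o\<^sub>L (V2 k o\<^sub>L V2 (- k)) o\<^sub>L S o\<^sub>L V1 k" for k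
      by (simp only: blinfun_compose_assoc)
    then have "(M o\<^sub>L V2 k) o\<^sub>L (V2 (- k) o\<^sub>L S o\<^sub>L V1 k) = P k" for k
      by (simp only: inv P_def X_def blinfun_compose_id)
    ultimately have Plim: "(P \<longlongrightarrow> P 0) (nhds 0)" by simp
    obtain \<psi> where \<psi>: "test_function m n \<psi>"
      "\<And>Y. (\<And>u v. cinner v (blinfun_apply Y u) = (\<integral>k. fourier m \<psi> k * cinner v (P k u) \<partial>n)) \<Longrightarrow>
        norm (Y - P 0) \<le> e / 2"
    proof (rule approximate_unit_operator[OF haar \<phi>, of P "e/2"])
      show "continuous_on UNIV (\<lambda>k. cinner v (P k u))" for u v
        using weak_module_functional_continuous[OF V1, of "cinner_form v o\<^sub>L X" u] Xb
        by (simp add: P_def bops_compose)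
      show "\<exists>b. \<forall>k\<in>K. norm (P k) \<le> b" if K: "compact K" for K
      proof -
        obtain b where b: "\<And>k. k \<in> K \<Longrightarrow> norm (V1 k) \<le> b" using weak_module_bounded[OF V1 K] by blast
        have "norm (P k) \<le> norm X * b" if "k \<in> K" for k
          unfolding P_def using norm_blinfun_compose[of X "V1 k"] b[OF that]
          by (meson mult_left_mono norm_ge_zero order_trans)
        then show ?thesis by blast
      qed
    qed (use e le_e[OF Plim] in auto)
    obtain K where K: "compact K" "\<And>k. k \<notin> K \<Longrightarrow> fourier m \<psi> k = 0"
      using test_function_support[OF \<psi>(1)] by blast
    have gi: "integrable n (fourier m \<psi>)" using \<psi>(1) by (simp add: test_function_def)
    obtain N where N: "has_operator_integral n (fourier m \<psi>) V1 N"
      using operator_integral_exists[OF haar(2) V1 gi K] by blast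
    have "norm ((X o\<^sub>L N) - P 0) \<le> e / 2"
    proof (rule \<psi>(2))
      fix u v
      have "cinner_form v o\<^sub>L X \<in> bops" using Xb by blast
      then have "has_bochner_integral n (\<lambda>k. fourier m \<psi> k * (cinner_form v o\<^sub>L X) (V1 k u)) ((cinner_form v o\<^sub>L X) (N u))"
        using N by (simp add: has_operator_integral_def del: blinfun_apply_blinfun_compose)
      then show "cinner v ((X o\<^sub>L N) u) = (\<integral>k. fourier m \<psi> k * cinner v (P k u) \<partial>n)"
        by (simp add: has_bochner_integral_iff P_def)
    qed
    moreover have "N \<in> multiplier_algebra m n V1"
      unfolding multiplier_algebra_test using N \<psi>(1) by (intro subsetD[OF closure_subset]) blast
    then have "X o\<^sub>L N \<in> span {T o\<^sub>L M | T M. M \<in> multiplier_algebra m n V1 \<and> T \<in> bops}"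
      using Xb by (intro span_base) blast
    ultimately show "\<exists>y\<in>span {T o\<^sub>L M | T M. M \<in> multiplier_algebra m n V1 \<and> T \<in> bops}. dist y (M o\<^sub>L S) < e"
      using e by (intro bexI[of _ "X o\<^sub>L N"]) (simp_all add: dist_norm P0 X_def)
  qed
  \<comment> \<open>It is enough to treat generators of the algebras: composition with
    \<open>S\<close> is norm continuous and the target sets are closed.\<close>
  have "S o\<^sub>L M \<in> cl1" if "M \<in> multiplier_algebra m n V1" for M
  proof (rule closure_compose_closed[where F = "\<lambda>M. S o\<^sub>L M"])
    show "M \<in> closure {A. \<exists>\<phi>. test_function m n \<phi> \<and> has_operator_integral n (fourier m \<phi>) V1 A}"
      using that by (simp add: multiplier_algebra_test)
    show "continuous_on UNIV (\<lambda>M. S o\<^sub>L M)"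
      by (intro bounded_bilinear.continuous_on[OF bounded_bilinear_blinfun_compose] continuous_intros)
  qed (use left in \<open>auto simp: cl1_def\<close>)
  moreover have "M o\<^sub>L S \<in> cl2" if "M \<in> multiplier_algebra m n V2" for M
  proof (rule closure_compose_closed[where F = "\<lambda>M. M o\<^sub>L S"])
    show "M \<in> closure {A. \<exists>\<phi>. test_function m n \<phi> \<and> has_operator_integral n (fourier m \<phi>) V2 A}"
      using that by (simp add: multiplier_algebra_test)
    show "continuous_on UNIV (\<lambda>M. M o\<^sub>L S)"
      by (intro bounded_bilinear.continuous_on[OF bounded_bilinear_blinfun_compose] continuous_intros)
  qed (use right in \<open>auto simp: cl2_def\<close>)
  ultimately show ?thesis
    using S unfolding decay_preserving_def cl1_def cl2_def by blast
qed

lemma multiplier_algebra_trivial: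
  fixes V :: "'x::topological_ab_group_add dual \<Rightarrow> ('f::complex_hilbert \<Rightarrow>\<^sub>L 'f)"
  assumes triv: "\<And>\<phi> k. test_function m n \<phi> \<Longrightarrow> fourier m \<phi> k = 0" and M: "M \<in> multiplier_algebra m n V"
  shows "M = 0"
proof -
  have "A = 0" if "test_function m n \<phi>" "has_operator_integral n (fourier m \<phi>) V A" for \<phi> A
  proof -
    have "cinner v (A u) = 0" for u v
      using that triv[OF that(1)] by (simp add: has_operator_integral_cinner has_bochner_integral_iff)
    then have "norm A \<le> 0" by (intro norm_blinfun_le_cinnerI) auto
    then show ?thesis by simp
  qed
  then have "{A. \<exists>\<phi>. test_function m n \<phi> \<and> has_operator_integral n (fourier m \<phi>) V A} \<subseteq> {0}" by blast
  from closure_mono[OF this] show ?thesis using M by (auto simp: multiplier_algebra_test)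
qed

lemma decay_preserving_trivial:
  fixes V1 :: "'x::topological_ab_group_add dual \<Rightarrow> ('a::complex_hilbert \<Rightarrow>\<^sub>L 'a)"
    and V2 :: "'x dual \<Rightarrow> ('b::complex_hilbert \<Rightarrow>\<^sub>L 'b)"
  assumes triv: "\<And>\<phi> k. test_function m n \<phi> \<Longrightarrow> fourier m \<phi> k = 0" and S: "S \<in> bops"
  shows "decay_preserving m n V1 V2 S"
proof -
  have *: "S o\<^sub>L M \<in> closure (span X)" "N o\<^sub>L S \<in> closure (span X)"
    if "M = 0" "N = 0" for M N and X :: "('a \<Rightarrow>\<^sub>L 'b) set"
    using that span_zero[of X] closure_subset[of "span X"]
    by (auto simp: bounded_bilinear.zero_left[OF bounded_bilinear_blinfun_compose]
        bounded_bilinear.zero_right[OF bounded_bilinear_blinfun_compose])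
  have z1: "M = 0" if "M \<in> multiplier_algebra m n V1" for M
    by (rule multiplier_algebra_trivial[OF _ that]) (rule triv)
  have z2: "M = 0" if "M \<in> multiplier_algebra m n V2" for M
    by (rule multiplier_algebra_trivial[OF _ that]) (rule triv)
  show ?thesis
    unfolding decay_preserving_def using S by (intro conjI ballI *) (simp_all add: z1 z2)
qed

section \<open>Friedrichs modules\<close>

lemma hilbert_module_weak:
  assumes V: "hilbert_module V"
  shows "weak_module V"
proof -
  have "norm (V k u) = norm u" for k u
  proof -
    have "cinner (V k u) (V k u) = cinner u u" using V by (simp add: hilbert_module_def)
    then show ?thesis by (metis cinner_self norm_ge_zero of_real_eq_iff power2_eq_iff_nonneg)
  qed
  then have "norm (V k) \<le> 1" for k by (intro norm_blinfun_bound) auto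
  then have "bdd_above ((\<lambda>k. norm (V k)) ` C)" for C by (intro bdd_aboveI2)
  moreover have "continuous_on UNIV (\<lambda>k. cinner v (V k u))" for u v
    using V by (intro bounded_linear.continuous_on[OF bounded_linear_cinner])
      (simp add: hilbert_module_def banach_module_def)
  ultimately show ?thesis
    using V by (simp add: weak_module_def hilbert_module_def banach_module_def)
qed

context
  fixes j :: "'g::complex_hilbert \<Rightarrow>\<^sub>L 'h::complex_hilbert"
    and V :: "'x::topological_ab_group_add dual \<Rightarrow> ('h \<Rightarrow>\<^sub>L 'h)"
  assumes fm: "stable_friedrichs_module j V"
begin

lemma friedrichs_j: "j \<in> bops" "inj j" "closure (range j) = UNIV"
  and friedrichs_V: "hilbert_module V"
  using fm by (auto simp: stable_friedrichs_module_def)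

text \<open>The term \<open>Blinfun\<close> in \<open>restr\<close> has its intended value only for
  a bounded map. The graph is closed because limits can be compared after applying \<open>j\<close>,
  where \<open>V k\<close> is continuous, and \<open>j\<close> is injective.\<close>

lemma restr_apply: "j (restr j V k u) = V k (j u)"
proof -
  define T where "T u = inv j (V k (j u))" for u
  have jT: "j (T u) = V k (j u)" for u
  proof -
    have "V k (j u) \<in> range j" using fm unfolding stable_friedrichs_module_def by (meson image_subset_iff rangeI)
    then show ?thesis unfolding T_def by (rule f_inv_into_f)
  qed
  note inj = injD[OF friedrichs_j(2)]
  have "bounded_linear T"
  proof (rule closed_graph)
    show "linear T"
      by (intro linearI inj) (simp_all add: jT blinfun.add_right blinfun.scaleR_right)
    fix u x y assume u: "u \<longlonglongrightarrow> x" "(\<lambda>n::nat. T (u n)) \<longlonglongrightarrow> y"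
    have "(\<lambda>n. j (T (u n))) \<longlonglongrightarrow> j y" by (intro tendsto_intros u)
    moreover have "(\<lambda>n. j (T (u n))) \<longlonglongrightarrow> V k (j x)" unfolding jT by (intro tendsto_intros u)
    ultimately have "j y = j (T x)" unfolding jT by (rule LIMSEQ_unique)
    then show "T x = y" by (rule inj[symmetric])
  qed
  then have "restr j V k u = T u"
    by (simp add: restr_def T_def[abs_def] bounded_linear_Blinfun_apply)
  then show ?thesis by (simp add: jT)
qed

lemma restr_bops: "restr j V k \<in> bops"
proof (rule bopsI)
  have "V k \<in> bops" using friedrichs_V by (simp add: hilbert_module_def banach_module_def)
  then show "restr j V k (c *\<^sub>C x) = c *\<^sub>C restr j V k x" for c x
    by (intro injD[OF friedrichs_j(2)]) (simp add: restr_apply bops_scaleC friedrichs_j)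
qed

lemma restr_zero: "restr j V 0 = id_blinfun"
  using friedrichs_V
  by (intro blinfun_eqI injD[OF friedrichs_j(2)]) (simp add: restr_apply hilbert_module_def banach_module_def)

lemma restr_add: "restr j V (k + l) = restr j V k o\<^sub>L restr j V l"
  using friedrichs_V
  by (intro blinfun_eqI injD[OF friedrichs_j(2)]) (simp add: restr_apply hilbert_module_def banach_module_def)

lemma restr_inverse: "restr j V k o\<^sub>L restr j V (- k) = id_blinfun" "restr j V (- k) o\<^sub>L restr j V k = id_blinfun"
  unfolding restr_add[symmetric] by (simp_all add: restr_zero)

text \<open>Stability bounds the orbit of each vector over \<open>C\<close>; uniform boundedness
  makes the bound independent of the vector.\<close>

lemma restr_bounded: "compact C \<Longrightarrow> bdd_above ((\<lambda>k. norm (restr j V k)) ` C)"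
proof (rule uniform_boundedness)
  fix x assume "compact C"
  moreover have "restr j V k x = inv j (V k (j x))" for k
    using friedrichs_j(2) by (metis inv_f_f restr_apply)
  ultimately show "bdd_above ((\<lambda>k. norm (restr j V k x)) ` C)"
    using fm by (simp add: stable_friedrichs_module_def)
qed

text \<open>
  The vectors \<open>v\<close> for which \<open>k \<mapsto> cinner v (V\<^sub>k u)\<close> is continuous form a closed subspace, by local
  uniformity in \<open>k\<close>, and contain the range of \<open>j\<^sup>*\<close>, which is dense because \<open>j\<close> is injective.
\<close>

lemma restr_weak_module:
  assumes C: "compact C" "\<forall>\<^sub>F k :: 'x dual in nhds 0. k \<in> C"
  shows "weak_module (restr j V)"
proof -
  define Y where "Y = {v. \<forall>u. continuous_on UNIV (\<lambda>k. cinner v (restr j V k u))}"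
  have "v \<in> Y" for v
  proof (rule adjoint_range_total[OF friedrichs_j(1,2)])
    obtain W where W: "open W" "0 \<in> W" "W \<subseteq> C" using C(2) unfolding eventually_nhds by blast
    show "closed Y"
      unfolding closed_sequential_limits
    proof (intro allI impI, elim conjE)
      fix y l assume y: "\<forall>n. y n \<in> Y" and lim: "y \<longlonglongrightarrow> l"
      have "isCont (\<lambda>k. cinner l (restr j V k u)) k0" for u k0
      proof -
        \<comment> \<open>This neighbourhood of \<open>k0\<close> lies in a translate of the compact
          set \<open>C\<close>. The norms are bounded there, so convergence of \<open>y\<close>
          makes the matrix elements converge uniformly on it.\<close>
        define W' where "W' = (+) k0 ` W"
        have W': "open W'" "k0 \<in> W'" "W' \<subseteq> (+) k0 ` C"
          using W by (auto simp: W'_def open_translation_group image_iff intro: bexI[of _ 0])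
        obtain b where "\<And>k. k \<in> (+) k0 ` C \<Longrightarrow> norm (restr j V k) \<le> b"
          using restr_bounded[OF compact_translation_group[OF C(1)], of k0] by (auto simp: bdd_above_def)
        then have b: "norm (restr j V k) \<le> b" if "k \<in> W'" for k using that W'(3) by blast
        have "uniform_limit W' (\<lambda>n k. cinner (y n) (restr j V k u)) (\<lambda>k. cinner l (restr j V k u)) sequentially"
        proof (rule uniform_limitI)
          fix e :: real assume "0 < e"
          have "(\<lambda>n. norm (y n - l) * (b * norm u)) \<longlonglongrightarrow> norm (l - l) * (b * norm u)"
            by (intro tendsto_intros lim)
          then have "\<forall>\<^sub>F n in sequentially. norm (y n - l) * (b * norm u) < e"
            using \<open>0 < e\<close> by (intro order_tendstoD(2)) auto
          then show "\<forall>\<^sub>F n in sequentially. \<forall>k\<in>W'. dist (cinner (y n) (restr j V k u)) (cinner l (restr j V k u)) < e"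
          proof (rule eventually_mono, intro ballI)
            fix n k assume n: "norm (y n - l) * (b * norm u) < e" and k: "k \<in> W'"
            have "dist (cinner (y n) (restr j V k u)) (cinner l (restr j V k u)) = cmod (cinner (y n - l) (restr j V k u))"
              by (simp add: dist_norm cinner_diff_left)
            also have "\<dots> \<le> norm (y n - l) * norm (restr j V k u)" by (rule cinner_Cauchy_Schwarz)
            also have "\<dots> \<le> norm (y n - l) * (b * norm u)"
            proof (rule mult_left_mono)
              show "norm (restr j V k u) \<le> b * norm u"
                using norm_blinfun[of "restr j V k" u] b[OF k] by (meson mult_right_mono norm_ge_zero order_trans)
            qed simp
            finally show "dist (cinner (y n) (restr j V k u)) (cinner l (restr j V k u)) < e" using n by linarith
          qed
        qed
        moreover have "\<forall>\<^sub>F n in sequentially. continuous_on W' (\<lambda>k. cinner (y n) (restr j V k u))"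
          using y by (intro always_eventually allI) (auto simp: Y_def intro: continuous_on_subset)
        ultimately have "continuous_on W' (\<lambda>k. cinner l (restr j V k u))"
          by (intro uniform_limit_theorem) auto
        then show ?thesis using W' by (simp add: continuous_on_eq_continuous_at)
      qed
      then show "l \<in> Y" by (auto simp: Y_def intro: continuous_at_imp_continuous_on)
    qed
    show "x + y \<in> Y" if "x \<in> Y" "y \<in> Y" for x y
      using that by (auto simp: Y_def cinner_add_left intro!: continuous_on_add)
    show "c *\<^sub>C x \<in> Y" if "x \<in> Y" for c x
      using that by (auto simp: Y_def cinner_scaleC_left intro!: continuous_on_mult_left)
    \<comment> \<open>For \<open>v = j\<^sup>* h\<close> the matrix element is
      \<open>cinner h (V k (j u))\<close>, whose continuity is known in the larger space.\<close>
    show "v \<in> Y" if "\<And>u. cinner v u = cinner h (j u)" for h v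
      using hilbert_module_weak[OF friedrichs_V] by (simp add: Y_def that restr_apply weak_module_def)
  qed
  then show ?thesis
    using restr_bops restr_zero restr_add restr_bounded by (auto simp: weak_module_def Y_def)
qed

end

section \<open>The resolvent of the associated operator\<close>

lemma antidual_eqI: "(\<And>u. blinfun_apply (form_of f) u = blinfun_apply (form_of g) u) \<Longrightarrow> f = g"
  by (metis blinfun_eqI form_of_inject)

lemma form_of_scaleC: "blinfun_apply (form_of (c *\<^sub>C f)) u = c * blinfun_apply (form_of f) u"
  by (simp add: scaleC_antidual.rep_eq bounded_linear_Blinfun_apply bounded_linear_mult_right)

lemma adj_apply: "S \<in> bops \<Longrightarrow> blinfun_apply (form_of (adj S f)) u = blinfun_apply (form_of f) (S u)"
  by (simp add: form_of_adj)

lemma bops_diff: "S \<in> bops \<Longrightarrow> T \<in> bops \<Longrightarrow> S - T \<in> bops"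
proof (rule bopsI)
  fix c x assume "S \<in> bops" "T \<in> bops"
  moreover have "c *\<^sub>C (y - z) = c *\<^sub>C y - c *\<^sub>C z" for y z :: 'b
    using scaleC_add_right[of c "y - z" z] by simp
  ultimately show "(S - T) (c *\<^sub>C x) = c *\<^sub>C (S - T) x"
    by (simp add: blinfun.diff_left bops_scaleC)
qed

lemma adj_diff: "S \<in> bops \<Longrightarrow> T \<in> bops \<Longrightarrow> adj S - adj T = adj (S - T)"
  by (intro blinfun_eqI antidual_eqI)
    (simp add: adj_apply bops_diff blinfun.diff_left minus_antidual.rep_eq blinfun.diff_right)

lemma norm_adj_le: "S \<in> bops \<Longrightarrow> norm (adj S) \<le> norm S"
proof (rule norm_blinfun_bound)
  fix f assume "S \<in> bops"
  then have "norm (adj S f) = norm (form_of f o\<^sub>L S)" by (simp add: norm_antidual.rep_eq form_of_adj)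
  also have "\<dots> \<le> norm S * norm f"
    using norm_blinfun_compose[of "form_of f" S] by (simp add: norm_antidual.rep_eq mult.commute)
  finally show "norm (adj S f) \<le> norm S * norm f" .
qed simp

lemma tendsto_adj:
  assumes "(f \<longlongrightarrow> S) F" "\<And>k. f k \<in> bops" "S \<in> bops"
  shows "((\<lambda>k. adj (f k)) \<longlongrightarrow> adj S) F"
proof (rule LIM_zero_cancel, rule Lim_null_comparison)
  show "((\<lambda>k. norm (f k - S)) \<longlongrightarrow> 0) F"
    using assms(1) by (simp add: LIM_zero tendsto_norm_zero)
  show "\<forall>\<^sub>F k in F. norm (adj (f k) - adj S) \<le> norm (f k - S)"
    using assms by (simp add: adj_diff norm_adj_le bops_diff)
qed

lemma bounded_linear_scaleC: "bounded_linear (\<lambda>x :: 'a::complex_banach. c *\<^sub>C x)"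
proof (rule bounded_linear_intro[where K = "cmod c"])
  show "c *\<^sub>C (r *\<^sub>R x) = r *\<^sub>R (c *\<^sub>C x)" for r and x :: 'a
    by (simp add: scaleC_scaleC mult.commute flip: scaleC_of_real)
qed (simp_all add: scaleC_add_right norm_scaleC)

lemma bounded_linear_embed:
  assumes j: "j \<in> bops"
  shows "bounded_linear (embed j)"
proof (rule bounded_linear_intro[where K = "norm j"])
  show "embed j (x + y) = embed j x + embed j y" for x y
    by (rule antidual_eqI) (simp add: plus_antidual.rep_eq blinfun.add_left form_of_embed[OF j] cinner_add_right)
  show "embed j (r *\<^sub>R x) = r *\<^sub>R embed j x" for r x
    by (rule antidual_eqI) (simp add: scaleR_antidual.rep_eq blinfun.scaleR_left form_of_embed[OF j] cinner_scaleR_right)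
  show "norm (embed j x) \<le> norm x * norm j" for x
    unfolding norm_antidual.rep_eq
  proof (rule norm_blinfun_bound)
    fix u
    have "cmod (cinner (j u) x) \<le> norm (j u) * norm x" by (rule cinner_Cauchy_Schwarz)
    also have "\<dots> \<le> (norm j * norm u) * norm x" by (intro mult_right_mono norm_blinfun norm_ge_zero)
    finally show "norm (blinfun_apply (form_of (embed j x)) u) \<le> norm x * norm j * norm u"
      by (simp add: form_of_embed[OF j] mult_ac)
  qed simp
qed

lemma embed_scaleC: "j \<in> bops \<Longrightarrow> embed j (c *\<^sub>C x) = c *\<^sub>C embed j x"
  by (rule antidual_eqI) (simp add: form_of_scaleC form_of_embed cinner_scaleC_right)

text \<open>Two vectors with the same form differ by a vector orthogonal to the range of
  \<open>j\<close>, hence by continuity to its closure and to itself.\<close>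

lemma inj_embed:
  assumes j: "j \<in> bops" "closure (range j) = UNIV"
  shows "inj (embed j)"
proof (rule injI)
  fix x y assume eq: "embed j x = embed j y"
  have "continuous_on UNIV (\<lambda>w. cinner (x - y) w)"
    by (rule bounded_linear.continuous_on[OF bounded_linear_cinner continuous_on_id])
  then have "closed {w. cinner (x - y) w = 0}"
    by (intro closed_Collect_eq continuous_on_const)
  moreover have "range j \<subseteq> {w. cinner (x - y) w = 0}"
  proof clarify
    fix u
    have "cinner (j u) x = cinner (j u) y"
      using eq by (metis form_of_embed[OF j(1)])
    then have "cinner (j u) (x - y) = 0" by (simp add: cinner_diff_right)
    then show "cinner (x - y) (j u) = 0" by (metis cinner_commute complex_cnj_zero)
  qed
  ultimately have "closure (range j) \<subseteq> {w. cinner (x - y) w = 0}" by (rule closure_minimal[rotated])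
  then have "cinner (x - y) (x - y) = 0" using j(2) by blast
  then show "x = y" by (simp add: cinner_self)
qed

text \<open>
  Conjugation by the representation turns \<open>B\<close> into \<open>B\<^sub>k = V\<^sub>k\<^sup>* B V\<^sub>k\<close> and its inverse \<open>R\<close> into
  \<open>R\<^sub>k = B\<^sub>k\<^sup>-\<^sup>1\<close>, and \<open>R\<^sub>k - R = R\<^sub>k (B - B\<^sub>k) R\<close>.
\<close>

lemma tendsto_inverse_operator:
  fixes B :: "'a::real_normed_vector \<Rightarrow>\<^sub>L 'b::real_normed_vector"
  assumes RB: "\<And>k. Rk k o\<^sub>L Bk k = id_blinfun" and BR: "B o\<^sub>L R = id_blinfun" and lim: "(Bk \<longlongrightarrow> B) F"
  shows "(Rk \<longlongrightarrow> R) F"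
proof -
  have diff: "Rk k - R = Rk k o\<^sub>L ((B - Bk k) o\<^sub>L R)" for k
  proof (rule blinfun_eqI)
    fix x
    have "B (R x) = x" using arg_cong[OF BR, of "\<lambda>T. T x"] by simp
    moreover have "Rk k (Bk k (R x)) = R x" using arg_cong[OF RB[of k], of "\<lambda>T. T (R x)"] by simp
    ultimately show "(Rk k - R) x = (Rk k o\<^sub>L ((B - Bk k) o\<^sub>L R)) x"
      by (simp add: blinfun.diff_left blinfun.diff_right)
  qed
  define d where "d k = norm (B - Bk k) * norm R" for k
  have d0: "0 \<le> d k" for k by (simp add: d_def)
  have "(d \<longlongrightarrow> norm (B - B) * norm R) F" unfolding d_def by (intro tendsto_intros lim)
  then have dlim: "(d \<longlongrightarrow> 0) F" by simp
  have le: "norm (Rk k - R) \<le> norm (Rk k) * d k" for k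
    unfolding diff d_def
    by (rule order_trans[OF norm_blinfun_compose mult_left_mono[OF norm_blinfun_compose]]) simp
  have "\<forall>\<^sub>F k in F. d k < 1/2" using dlim by (rule order_tendstoD) simp
  \<comment> \<open>No bound for \<open>Rk k\<close> is known beforehand. Once
    \<open>d k < 1/2\<close>, the difference identity gives
    \<open>norm (Rk k) \<le> norm R + norm (Rk k) / 2\<close>, so that \<open>norm (Rk k)\<close> is
    at most \<open>2 * norm R\<close>.\<close>
  then have ev: "\<forall>\<^sub>F k in F. norm (Rk k - R) \<le> 2 * norm R * d k"
  proof eventually_elim
    case (elim k)
    have "norm (Rk k) \<le> norm R + norm (Rk k - R)"
      using norm_triangle_ineq[of R "Rk k - R"] by simp
    also have "\<dots> \<le> norm R + norm (Rk k) * d k" using le by simp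
    also have "norm (Rk k) * d k \<le> norm (Rk k) * (1/2)" using elim by (intro mult_left_mono) auto
    finally have "norm (Rk k) \<le> 2 * norm R" by simp
    then have "norm (Rk k) * d k \<le> 2 * norm R * d k" using d0 by (rule mult_right_mono)
    with le show ?case by (rule order_trans)
  qed
  have "((\<lambda>k. 2 * norm R * d k) \<longlongrightarrow> 2 * norm R * 0) F" by (intro tendsto_intros dlim)
  then have "((\<lambda>k. Rk k - R) \<longlongrightarrow> 0) F" by (intro Lim_null_comparison[OF ev]) simp
  then show ?thesis by (rule LIM_zero_cancel)
qed

section \<open>The associated operator and conjugation of its resolvent\<close>

context
  fixes j :: "'g::complex_hilbert \<Rightarrow>\<^sub>L 'h::complex_hilbert"
    and A :: "'g \<Rightarrow>\<^sub>L 'g antidual" and z :: complex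
  assumes j: "j \<in> bops" "inj j" "closure (range j) = UNIV"
    and bij: "bij (\<lambda>u. A u - z *\<^sub>C embed j (j u))"
begin

definition shifted :: "'g \<Rightarrow>\<^sub>L 'g antidual"
  where "shifted = Blinfun (\<lambda>u. A u - z *\<^sub>C embed j (j u))"

definition shifted_inv :: "'g antidual \<Rightarrow>\<^sub>L 'g"
  where "shifted_inv = Blinfun (inv (\<lambda>u. A u - z *\<^sub>C embed j (j u)))"

lemma bounded_linear_shifted: "bounded_linear (\<lambda>u. A u - z *\<^sub>C embed j (j u))"
  by (intro bounded_linear_sub blinfun.bounded_linear_right
      bounded_linear_compose[OF bounded_linear_scaleC]
      bounded_linear_compose[OF bounded_linear_embed[OF j(1)]])

lemma shifted_apply: "shifted u = A u - z *\<^sub>C embed j (j u)"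
  by (simp add: shifted_def bounded_linear_Blinfun_apply[OF bounded_linear_shifted])

text \<open>The theorem \<open>bounded_inverse\<close> is what makes the \<open>Blinfun\<close> in
  \<open>shifted_inv\<close> denote the actual inverse.\<close>

lemma shifted_inverse: "shifted (shifted_inv f) = f" "shifted_inv (shifted u) = u"
proof -
  have inv: "blinfun_apply shifted_inv = inv (blinfun_apply shifted)"
    unfolding shifted_inv_def shifted_apply[abs_def]
      bounded_linear_Blinfun_apply[OF bounded_inverse[OF bounded_linear_shifted bij]] ..
  have bij': "bij (blinfun_apply shifted)"
    using bij unfolding shifted_apply[abs_def] .
  show "shifted (shifted_inv f) = f" "shifted_inv (shifted u) = u"
    unfolding inv using bij' by (simp_all add: bij_is_surj surj_f_inv_f bij_is_inj)
qed

lemma shifted_inv_bops: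
  assumes "A \<in> bops"
  shows "shifted_inv \<in> bops"
proof (rule bopsI)
  fix c f
  have "shifted (c *\<^sub>C shifted_inv f) = c *\<^sub>C shifted (shifted_inv f)"
    using scaleC_add_right[of c "A (shifted_inv f) - z *\<^sub>C embed j (j (shifted_inv f))" "z *\<^sub>C embed j (j (shifted_inv f))"]
    by (simp add: shifted_apply bops_scaleC assms j embed_scaleC scaleC_scaleC mult.commute)
  then show "shifted_inv (c *\<^sub>C f) = c *\<^sub>C shifted_inv f"
    by (metis shifted_inverse)
qed

text \<open>On its domain the shifted associated operator becomes \<open>shifted\<close> under
  \<open>embed j\<close>. Its domain therefore consists of the images under \<open>j\<close> of the
  vectors \<open>shifted_inv (embed j h)\<close>, and injectivity and surjectivity are inherited
  from \<open>shifted\<close>.\<close>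

lemma assoc_op_bij:
  "bij_betw (\<lambda>x. assoc_op j A x - z *\<^sub>C x) (assoc_dom j A) UNIV"
  and resolvent_eq: "resolvent j A z h = j (shifted_inv (embed j h))"
proof -
  note inje = inj_embed[OF j(1,3)]
  note E = bounded_linear_embed[OF j(1)]
  define F where "F x = assoc_op j A x - z *\<^sub>C x" for x
  have EF: "embed j (F (j u)) = shifted u" if Au: "A u \<in> range (embed j)" for u
  proof -
    obtain y where y: "A u = embed j y" using Au by blast
    have "F (j u) = y - z *\<^sub>C j u"
      using j(2) inje by (simp add: F_def assoc_op_def y inv_f_f)
    then show ?thesis
      by (simp add: shifted_apply y linear_diff[OF bounded_linear.linear[OF E]] embed_scaleC[OF j(1)])
  qed
  have dom: "j (shifted_inv (embed j h)) \<in> assoc_dom j A" "F (j (shifted_inv (embed j h))) = h" for h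
  proof -
    define u where "u = shifted_inv (embed j h)"
    have su: "shifted u = embed j h" by (simp add: u_def shifted_inverse)
    \<comment> \<open>The functionals \<open>shifted u\<close> and \<open>A u\<close> differ by a
      multiple of \<open>embed j (j u)\<close>, so one comes from the Hilbert space exactly when the
      other does.\<close>
    then have "A u = embed j (h + z *\<^sub>C j u)"
      by (simp add: shifted_apply linear_add[OF bounded_linear.linear[OF E]] embed_scaleC[OF j(1)] diff_eq_eq)
    then have r: "A u \<in> range (embed j)" by blast
    then show "j (shifted_inv (embed j h)) \<in> assoc_dom j A" by (auto simp: assoc_dom_def u_def)
    show "F (j (shifted_inv (embed j h))) = h"
      using EF[OF r] su inje by (simp add: u_def inj_eq)
  qed
  have inj: "inj_on F (assoc_dom j A)"
  proof (rule inj_onI)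
    fix x y assume "x \<in> assoc_dom j A" "y \<in> assoc_dom j A" and eq: "F x = F y"
    then obtain u v where u: "x = j u" "A u \<in> range (embed j)" and v: "y = j v" "A v \<in> range (embed j)"
      by (auto simp: assoc_dom_def)
    have "shifted u = shifted v" using EF[OF u(2)] EF[OF v(2)] eq u(1) v(1) by simp
    then have "u = v" by (metis shifted_inverse(2))
    then show "x = y" using u(1) v(1) by simp
  qed
  have "bij_betw F (assoc_dom j A) UNIV"
    unfolding bij_betw_def using inj dom by (metis surjI UNIV_eq_I image_eqI)
  then show "bij_betw (\<lambda>x. assoc_op j A x - z *\<^sub>C x) (assoc_dom j A) UNIV"
    unfolding F_def .
  have "inv_into (assoc_dom j A) F h = j (shifted_inv (embed j h))"
    using inj dom by (intro inv_into_f_eq)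
  then show "resolvent j A z h = j (shifted_inv (embed j h))"
    unfolding resolvent_def F_def .
qed

end

text \<open>The conjugate of \<open>S\<close> factors as
  \<open>Dk k o\<^sub>L Rk k o\<^sub>L E\<close>, because \<open>embed j\<close> intertwines
  \<open>V\<close> with the representation on the antidual. Norm limits of the conjugates of
  \<open>D\<close> and \<open>a\<close> thus pass to \<open>S\<close>, although \<open>V\<close>
  itself need not be norm continuous.\<close>

lemma resolvent_conjugation_continuous:
  fixes V :: "'x::topological_ab_group_add dual \<Rightarrow> ('h::complex_hilbert \<Rightarrow>\<^sub>L 'h)"
    and U :: "'x dual \<Rightarrow> ('k::complex_hilbert \<Rightarrow>\<^sub>L 'k)"
    and j :: "'g::complex_hilbert \<Rightarrow>\<^sub>L 'h" and i :: "'e::complex_hilbert \<Rightarrow>\<^sub>L 'k"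
    and D :: "'g \<Rightarrow>\<^sub>L 'e" and a :: "'e \<Rightarrow>\<^sub>L 'e antidual"
  assumes fj: "stable_friedrichs_module j V" and fi: "stable_friedrichs_module i U"
    and D: "class_Cu (restr j V) (restr i U) D"
    and a: "class_Cu (restr i U) (antidual_rep (restr i U)) a"
    and bij: "bij (\<lambda>u. blinfun_apply (adj D o\<^sub>L a o\<^sub>L D) u - z *\<^sub>C embed j (blinfun_apply j u))"
  defines "S \<equiv> D o\<^sub>L shifted_inv j (adj D o\<^sub>L a o\<^sub>L D) z o\<^sub>L Blinfun (embed j)"
  shows "S \<in> bops" "((\<lambda>k. restr i U (- k) o\<^sub>L S o\<^sub>L V k) \<longlongrightarrow> S) (nhds 0)"
proof -
  note j = friedrichs_j[OF fj]
  define A where "A = adj D o\<^sub>L a o\<^sub>L D"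
  define R where "R = shifted_inv j A z"
  define B where "B = shifted j A z"
  define E where "E = Blinfun (embed j)"
  define WG where "WG = restr j V"
  define WE where "WE = restr i U"
  note bij' = bij[folded A_def]
  note BR = shifted_inverse[OF j bij', folded R_def B_def]
  have E: "E h = embed j h" for h
    by (simp add: E_def bounded_linear_Blinfun_apply bounded_linear_embed j)
  have Db: "D \<in> bops" and ab: "a \<in> bops" using D a by (auto simp: class_Cu_def)
  have WGb: "WG k \<in> bops" and WEb: "WE k \<in> bops" for k
    using restr_bops[OF fj] restr_bops[OF fi] by (auto simp: WG_def WE_def)
  have Ab: "A \<in> bops"
  proof (rule bopsI, rule antidual_eqI)
    fix c x u
    show "blinfun_apply (form_of (A (c *\<^sub>C x))) u = blinfun_apply (form_of (c *\<^sub>C A x)) u"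
      by (simp add: A_def bops_scaleC Db ab adj_apply form_of_scaleC)
  qed
  have Rb: "R \<in> bops" unfolding R_def using shifted_inv_bops[OF j bij' Ab] .
  have Eb: "E \<in> bops" by (rule bopsI) (simp add: E embed_scaleC j)
  show Sb: "S \<in> bops" unfolding S_def A_def[symmetric] R_def[symmetric] E_def[symmetric]
    using Db Rb Eb by blast
  define Dk where "Dk k = WE (- k) o\<^sub>L D o\<^sub>L WG k" for k
  \<comment> \<open>The representation on the antidual at \<open>- k\<close> is
    \<open>adj (WE k)\<close>, so this is the conjugate of \<open>a\<close> that occurs in
    \<open>class_Cu\<close>.\<close>
  define ak where "ak k = adj (WE k) o\<^sub>L a o\<^sub>L WE k" for k
  have Dkb: "Dk k \<in> bops" for k unfolding Dk_def using WGb WEb Db by blast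
  have W0: "WG 0 = id_blinfun" "WE 0 = id_blinfun"
    using restr_zero[OF fj] restr_zero[OF fi] by (auto simp: WG_def WE_def)
  have WGi: "WG k (WG (- k) u) = u" "WG (- k) (WG k u) = u" for k u
    using restr_inverse[OF fj, of k] unfolding WG_def by (metis blinfun_apply_blinfun_compose id_blinfun.rep_eq)+
  have WEi: "WE k (WE (- k) u) = u" for k u
    using restr_inverse[OF fi, of k] unfolding WE_def by (metis blinfun_apply_blinfun_compose id_blinfun.rep_eq)
  have jW: "j (WG k u) = V k (j u)" for k u unfolding WG_def by (rule restr_apply[OF fj])
  have unitary: "cinner (V k x) (V k y) = cinner x y" for k x y
    using friedrichs_V[OF fj] by (simp add: hilbert_module_def)
  have Dlim: "(Dk \<longlongrightarrow> D) (nhds 0)"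
    using tendsto_nhds_of_continuous_on[of Dk 0] D
    by (simp add: class_Cu_def Dk_def[abs_def] WG_def[symmetric] WE_def[symmetric] W0)
  have adj_id: "adj (id_blinfun :: 'e \<Rightarrow>\<^sub>L 'e) = id_blinfun"
    by (intro blinfun_eqI antidual_eqI) (simp add: adj_apply bops_def)
  have alim: "(ak \<longlongrightarrow> a) (nhds 0)"
    using tendsto_nhds_of_continuous_on[of ak 0] a
    by (simp add: class_Cu_def antidual_rep_def ak_def[abs_def] WE_def[symmetric] W0 adj_id)
  define Bk where "Bk k = adj (WG k) o\<^sub>L B o\<^sub>L WG k" for k
  have Bu: "B u = A u - z *\<^sub>C embed j (j u)" for u
    unfolding B_def by (rule shifted_apply[OF j bij'])
  have Au: "blinfun_apply (form_of (A u)) v = blinfun_apply (form_of (a (D u))) (D v)" for u v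
    by (simp add: A_def adj_apply Db)
  have Dku: "Dk k u = WE (- k) (D (WG k u))" for k u
    by (simp add: Dk_def)
  \<comment> \<open>Unitarity of \<open>V\<close> leaves the term with \<open>z\<close> unchanged
    under conjugation. Inserting \<open>WE k o\<^sub>L WE (- k)\<close> next to \<open>a\<close> on
    the right, and its adjoint on the left, regroups the other term into conjugates.\<close>
  have Bk_eq: "Bk k = B + ((adj (Dk k) o\<^sub>L ak k o\<^sub>L Dk k) - A)" for k
  proof (intro blinfun_eqI antidual_eqI)
    fix u v
    have "cinner (j (WG k v)) (j (WG k u)) = cinner (j v) (j u)"
      by (simp add: jW unitary)
    then show "blinfun_apply (form_of (Bk k u)) v
        = blinfun_apply (form_of ((B + ((adj (Dk k) o\<^sub>L ak k o\<^sub>L Dk k) - A)) u)) v"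
      by (simp add: Bk_def Bu Au adj_apply WGb WEb Dkb Dku ak_def WEi  blinfun.diff_left blinfun.add_left
          minus_antidual.rep_eq plus_antidual.rep_eq form_of_scaleC form_of_embed j)
  qed
  have "((\<lambda>k. B + ((adj (Dk k) o\<^sub>L ak k o\<^sub>L Dk k) - A)) \<longlongrightarrow> B + ((adj D o\<^sub>L a o\<^sub>L D) - A)) (nhds 0)"
    by (intro tendsto_intros tendsto_blinfun_compose tendsto_adj Dlim alim Dkb Db)
  then have Blim: "(Bk \<longlongrightarrow> B) (nhds 0)"
    unfolding Bk_eq[abs_def] by (simp add: A_def)
  define Rk where "Rk k = WG (- k) o\<^sub>L R o\<^sub>L adj (WG (- k))" for k
  have adjW: "adj (WG (- k)) (adj (WG k) f) = f" for k f
    by (rule antidual_eqI) (simp add: adj_apply WGb WGi)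
  have Rlim: "(Rk \<longlongrightarrow> R) (nhds 0)"
  proof (rule tendsto_inverse_operator[OF _ _ Blim])
    show "Rk k o\<^sub>L Bk k = id_blinfun" for k
      by (rule blinfun_eqI) (simp add: Rk_def Bk_def adjW BR WGi)
    show "B o\<^sub>L R = id_blinfun" by (rule blinfun_eqI) (simp add: BR)
  qed
  \<comment> \<open>The representation on the antidual extends \<open>V\<close>: unitarity moves
    \<open>V (- k)\<close> across the inner product as \<open>V k\<close>.\<close>
  have EV: "E (V k h) = adj (WG (- k)) (E h)" for k h
  proof (rule antidual_eqI)
    fix u
    have "cinner (V (- k) (j u)) h = cinner (V k (V (- k) (j u))) (V k h)" by (rule unitary[symmetric])
    also have "V k (V (- k) (j u)) = j u" by (metis WGi(1) jW)
    finally show "blinfun_apply (form_of (E (V k h))) u = blinfun_apply (form_of (adj (WG (- k)) (E h))) u"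
      by (simp add: E form_of_embed j adj_apply WGb jW)
  qed
  have "restr i U (- k) o\<^sub>L S o\<^sub>L V k = Dk k o\<^sub>L Rk k o\<^sub>L E" for k
    by (rule blinfun_eqI)
      (simp add: S_def Dk_def Rk_def WGi EV WE_def[symmetric] A_def[symmetric] R_def[symmetric] E_def[symmetric])
  moreover have "((\<lambda>k. Dk k o\<^sub>L Rk k o\<^sub>L E) \<longlongrightarrow> D o\<^sub>L R o\<^sub>L E) (nhds 0)"
    by (intro tendsto_blinfun_compose Dlim Rlim tendsto_const)
  ultimately show "((\<lambda>k. restr i U (- k) o\<^sub>L S o\<^sub>L V k) \<longlongrightarrow> S) (nhds 0)"
    by (simp add: S_def A_def R_def E_def)
qed

theorem lemma4p14:
  fixes m :: "'x::{topological_ab_group_add, t2_space} measure"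
    and n :: "'x dual measure"
    and j :: "'g::complex_hilbert \<Rightarrow>\<^sub>L 'h::complex_hilbert"
    and V :: "'x dual \<Rightarrow> ('h \<Rightarrow>\<^sub>L 'h)"
    and i :: "'e::complex_hilbert \<Rightarrow>\<^sub>L 'k::complex_hilbert"
    and U :: "'x dual \<Rightarrow> ('k \<Rightarrow>\<^sub>L 'k)"
    and D :: "'g \<Rightarrow>\<^sub>L 'e"
    and a :: "'e \<Rightarrow>\<^sub>L 'e antidual"
    and z :: complex
  assumes "locally compact (UNIV :: 'x set)"
    and "\<not> compact (UNIV :: 'x set)"
    and "dual_haar_measures m n"
    and "stable_friedrichs_module j V"
    and "stable_friedrichs_module i U"
    and "class_Cu (restr j V) (restr i U) D"
    and "class_Cu (restr i U) (antidual_rep (restr i U)) a"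
    and "bij (\<lambda>u. blinfun_apply (adj D o\<^sub>L a o\<^sub>L D) u - z *\<^sub>C embed j (blinfun_apply j u))"
  shows "bij_betw (\<lambda>x. assoc_op j (adj D o\<^sub>L a o\<^sub>L D) x - z *\<^sub>C x)
      (assoc_dom j (adj D o\<^sub>L a o\<^sub>L D)) UNIV \<and>
    (\<exists>S :: 'h \<Rightarrow>\<^sub>L 'e.
      (\<forall>h. blinfun_apply S h =
        blinfun_apply D (inv (blinfun_apply j) (resolvent j (adj D o\<^sub>L a o\<^sub>L D) z h))) \<and>
      decay_preserving m n V (restr i U) S)"
proof -
  note j = friedrichs_j[OF assms(4)]
  have haar: "haar_measure m" "haar_measure n"
    using assms(3) by (auto simp: dual_haar_measures_def)
  \<comment> \<open>The inverse of the form operator has its values in the smaller space, where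
    \<open>D\<close> can act; applying \<open>j\<close> to these values gives the resolvent.\<close>
  define S where "S = D o\<^sub>L shifted_inv j (adj D o\<^sub>L a o\<^sub>L D) z o\<^sub>L Blinfun (embed j)"
  note S = resolvent_conjugation_continuous[OF assms(4-8), folded S_def]
  have "decay_preserving m n V (restr i U) S"
  proof (cases "\<exists>\<phi> k. test_function m n \<phi> \<and> fourier m \<phi> k \<noteq> 0")
    case True
    then obtain \<phi> where \<phi>: "test_function m n \<phi>" "fourier m \<phi> 0 = 1"
      using test_function_normalized[OF haar] by blast
    obtain C :: "'x dual set" where C: "compact C" "\<forall>\<^sub>F k in nhds 0. k \<in> C"
      by (rule dual_compact_neighbourhood[OF haar(1) \<phi>])
    show ?thesis
      using hilbert_module_weak[OF friedrichs_V[OF assms(4)]] restr_weak_module[OF assms(5) C] S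
      by (rule decay_preserving_if_continuous[OF haar \<phi>])
  next
    case False
    then show ?thesis using S(1) by (intro decay_preserving_trivial) auto
  qed
  moreover have "S h = D (inv j (resolvent j (adj D o\<^sub>L a o\<^sub>L D) z h))" for h
    using j(2) by (simp add: S_def resolvent_eq[OF j assms(8)] inv_f_f
        bounded_linear_Blinfun_apply[OF bounded_linear_embed[OF j(1)]])
  ultimately show ?thesis
    using assoc_op_bij[OF j assms(8)] by blast
qed

end
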